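(* Let $\mathbb{X}\subseteq\mathbb{P}^n$ be a $0$-dimensional scheme, and let $1\le m\le n+1$. Then $$\mathrm{ri}(\Omega^m_{R_{\mathbb{X}}/K})\le\max\{r_{\mathbb{X}}+m,\ \mathrm{ri}(\Omega^1_{R_{\mathbb{X}}/K})+m-1\}.$$
   Context: $K$ is a field of characteristic zero, $S=K[X_0,\dots,X_n]$ ($n\ge 1$) with the standard grading is the homogeneous coordinate ring of $\mathbb{P}^n$ over $K$. For a $0$-dimensional subscheme $\mathbb{X}\subseteq\mathbb{P}^n$, $I_{\mathbb{X}}\subseteq S$ is its saturated homogeneous vanishing ideal, $R_{\mathbb{X}}=S/I_{\mathbb{X}}$, and $x_i$ is the image of $X_i$. Coordinates are chosen so that no point of $\mathbb{X}$ lies on the hyperplane $X_0=0$. $\Omega^1_{R_{\mathbb{X}}/K}$ is the module of Kähler differentials of $R_{\mathbb{X}}/K$, a graded $R_{\mathbb{X}}$-module with $\deg(dx_i)=1$, and $\Omega^m_{R_{\mathbb{X}}/K}=\bigwedge^m_{R_{\mathbb{X}}}\Omega^1_{R_{\mathbb{X}}/K}$. For a finitely generated graded module $M$, $\mathrm{HF}_M(i)=\dim_K M_i$, $\mathrm{HP}_M$ is its Hilbert polynomial, and $\mathrm{ri}(M)=\min\{i\in\mathbb{Z}\mid \mathrm{HF}_M(j)=\mathrm{HP}_M(j)\text{ for all }j\ge i\}$ (with $\mathrm{ri}(M)=-\infty$ if equality holds for all $j\in\mathbb{Z}$) is its regularity index; $r_{\mathbb{X}}=\mathrm{ri}(R_{\mathbb{X}})$.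 *)

theory Defs
  imports
    "Jordan_Normal_Form.VS_Connect"
    "HOL-Algebra.QuotRing"
    "HOL-Library.Poly_Mapping"
    "HOL-Library.Extended"
begin

section \<open>Modules over a commutative ring\<close>

text \<open>Elements of the free module on \<open>B\<close> are extensional functions on \<open>B\<close> of finite support.\<close>

definition free_module :: "('r, 'x) ring_scheme \<Rightarrow> 'b set \<Rightarrow> ('r, 'b \<Rightarrow> 'r) module" where
  "free_module R B = (ring.func_space R B)
     \<lparr>carrier := {f \<in> B \<rightarrow>\<^sub>E carrier R. finite {b \<in> B. f b \<noteq> \<zero>\<^bsub>R\<^esub>}}\<rparr>"

definition free_gen :: "('r, 'x) ring_scheme \<Rightarrow> 'b set \<Rightarrow> 'b \<Rightarrow> 'b \<Rightarrow> 'r" where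
  "free_gen R B b = (\<lambda>x\<in>B. if x = b then \<one>\<^bsub>R\<^esub> else \<zero>\<^bsub>R\<^esub>)"

text \<open>The fields \<open>mult\<close> and \<open>one\<close> of a module record carry no meaning.\<close>

definition quot_module :: "('r, 'b, 'y) module_scheme \<Rightarrow> 'b set \<Rightarrow> ('r, 'b set) module" where
  "quot_module M N =
     \<lparr>carrier = a_rcosets\<^bsub>M\<^esub> N, mult = (\<lambda>_ _. N), one = N, zero = N, add = set_add M,
      smult = (\<lambda>r X. \<Union>x\<in>X. N +>\<^bsub>M\<^esub> (r \<odot>\<^bsub>M\<^esub> x))\<rparr>"

definition regular_module :: "('r, 'x) ring_scheme \<Rightarrow> ('r, 'r) module" where
  "regular_module R =
     \<lparr>carrier = carrier R, mult = mult R, one = one R, zero = zero R, add = add R,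
      smult = mult R\<rparr>"

definition restrict_scalars ::
    "('a \<Rightarrow> 'r) \<Rightarrow> ('r, 'b, 'y) module_scheme \<Rightarrow> ('a, 'b) module" where
  "restrict_scalars \<phi> M =
     \<lparr>carrier = carrier M, mult = mult M, one = one M, zero = zero M, add = add M,
      smult = (\<lambda>c x. \<phi> c \<odot>\<^bsub>M\<^esub> x)\<rparr>"

abbreviation module_span :: "('r, 'x) ring_scheme \<Rightarrow> ('r, 'b, 'y) module_scheme \<Rightarrow> 'b set \<Rightarrow> 'b set"
  where "module_span \<equiv> LinearCombinations.module.span"


section \<open>Kaehler differentials and exterior powers\<close>

text \<open>Throughout, \<open>\<phi>\<close> is the structure map \<open>K \<rightarrow> R\<close> of a \<open>K\<close>-algebra \<open>R\<close>, and the generator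
  \<open>free_gen R (carrier R) r\<close> stands for the symbol \<open>d r\<close>.\<close>

definition kaehler_rels ::
    "('a, 'z) ring_scheme \<Rightarrow> ('a \<Rightarrow> 'r) \<Rightarrow> ('r, 'x) ring_scheme \<Rightarrow> ('r \<Rightarrow> 'r) set" where
  "kaehler_rels K \<phi> R = (let F = free_module R (carrier R); e = free_gen R (carrier R) in
     {e (r \<oplus>\<^bsub>R\<^esub> s) \<ominus>\<^bsub>F\<^esub> (e r \<oplus>\<^bsub>F\<^esub> e s) | r s. r \<in> carrier R \<and> s \<in> carrier R} \<union>
     {e (r \<otimes>\<^bsub>R\<^esub> s) \<ominus>\<^bsub>F\<^esub> (r \<odot>\<^bsub>F\<^esub> e s \<oplus>\<^bsub>F\<^esub> s \<odot>\<^bsub>F\<^esub> e r) | r s. r \<in> carrier R \<and> s \<in> carrier R} \<union>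
     {e (\<phi> c) | c. c \<in> carrier K})"

definition kaehler_rel_submodule ::
    "('a, 'z) ring_scheme \<Rightarrow> ('a \<Rightarrow> 'r) \<Rightarrow> ('r, 'x) ring_scheme \<Rightarrow> ('r \<Rightarrow> 'r) set" where
  "kaehler_rel_submodule K \<phi> R =
     module_span R (free_module R (carrier R)) (kaehler_rels K \<phi> R)"

definition kaehler ::
    "('a, 'z) ring_scheme \<Rightarrow> ('a \<Rightarrow> 'r) \<Rightarrow> ('r, 'x) ring_scheme \<Rightarrow> ('r, ('r \<Rightarrow> 'r) set) module" where
  "kaehler K \<phi> R = quot_module (free_module R (carrier R)) (kaehler_rel_submodule K \<phi> R)"

definition kaehler_d ::
    "('a, 'z) ring_scheme \<Rightarrow> ('a \<Rightarrow> 'r) \<Rightarrow> ('r, 'x) ring_scheme \<Rightarrow> 'r \<Rightarrow> ('r \<Rightarrow> 'r) set" where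
  "kaehler_d K \<phi> R r =
     kaehler_rel_submodule K \<phi> R +>\<^bsub>free_module R (carrier R)\<^esub> free_gen R (carrier R) r"

text \<open>In the exterior power, the generator of a tuple \<open>[x\<^sub>1, \<dots>, x\<^sub>m]\<close> stands for
  \<open>x\<^sub>1 \<and> \<dots> \<and> x\<^sub>m\<close>; relations: multilinearity, alternation.\<close>

definition tuples :: "nat \<Rightarrow> ('r, 'b, 'y) module_scheme \<Rightarrow> 'b list set" where
  "tuples m M = {xs. length xs = m \<and> set xs \<subseteq> carrier M}"

definition exterior_rels ::
    "('r, 'x) ring_scheme \<Rightarrow> nat \<Rightarrow> ('r, 'b, 'y) module_scheme \<Rightarrow> ('b list \<Rightarrow> 'r) set" where
  "exterior_rels R m M = (let F = free_module R (tuples m M); e = free_gen R (tuples m M) in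
     {e (xs[i := x \<oplus>\<^bsub>M\<^esub> y]) \<ominus>\<^bsub>F\<^esub> (e (xs[i := x]) \<oplus>\<^bsub>F\<^esub> e (xs[i := y])) | xs i x y.
        xs \<in> tuples m M \<and> i < m \<and> x \<in> carrier M \<and> y \<in> carrier M} \<union>
     {e (xs[i := r \<odot>\<^bsub>M\<^esub> x]) \<ominus>\<^bsub>F\<^esub> r \<odot>\<^bsub>F\<^esub> e (xs[i := x]) | xs i r x.
        xs \<in> tuples m M \<and> i < m \<and> r \<in> carrier R \<and> x \<in> carrier M} \<union>
     {e xs | xs. xs \<in> tuples m M \<and> (\<exists>i j. i < j \<and> j < m \<and> xs ! i = xs ! j)})"

definition exterior_rel_submodule ::
    "('r, 'x) ring_scheme \<Rightarrow> nat \<Rightarrow> ('r, 'b, 'y) module_scheme \<Rightarrow> ('b list \<Rightarrow> 'r) set" where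
  "exterior_rel_submodule R m M =
     module_span R (free_module R (tuples m M)) (exterior_rels R m M)"

definition exterior_power ::
    "('r, 'x) ring_scheme \<Rightarrow> nat \<Rightarrow> ('r, 'b, 'y) module_scheme \<Rightarrow> ('r, ('b list \<Rightarrow> 'r) set) module" where
  "exterior_power R m M = quot_module (free_module R (tuples m M)) (exterior_rel_submodule R m M)"

definition wedge ::
    "('r, 'x) ring_scheme \<Rightarrow> nat \<Rightarrow> ('r, 'b, 'y) module_scheme \<Rightarrow> 'b list \<Rightarrow> ('b list \<Rightarrow> 'r) set" where
  "wedge R m M xs =
     exterior_rel_submodule R m M +>\<^bsub>free_module R (tuples m M)\<^esub> free_gen R (tuples m M) xs"


section \<open>Gradings\<close>

text \<open>A grading is given by its family of homogeneous components, indexed by the integers.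
  The map \<open>d\<close> preserves degrees, so \<open>r \<odot> d s\<close> has degree \<open>deg r + deg s\<close>; in
  particular \<open>deg (d x\<^sub>i) = 1\<close>. In \<open>exterior_grading\<close> the scalar \<open>r\<close> only matters for \<open>m = 0\<close>.\<close>

definition kaehler_grading ::
    "('a, 'z) ring_scheme \<Rightarrow> ('a \<Rightarrow> 'r) \<Rightarrow> ('r, 'x) ring_scheme \<Rightarrow> (int \<Rightarrow> 'r set)
      \<Rightarrow> int \<Rightarrow> ('r \<Rightarrow> 'r) set set" where
  "kaehler_grading K \<phi> R Rgr d =
     module_span K (restrict_scalars \<phi> (kaehler K \<phi> R))
       {r \<odot>\<^bsub>kaehler K \<phi> R\<^esub> kaehler_d K \<phi> R s | r s i j. r \<in> Rgr i \<and> s \<in> Rgr j \<and> i + j = d}"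

definition exterior_grading ::
    "('a, 'z) ring_scheme \<Rightarrow> ('a \<Rightarrow> 'r) \<Rightarrow> ('r, 'x) ring_scheme \<Rightarrow> (int \<Rightarrow> 'r set)
      \<Rightarrow> nat \<Rightarrow> ('r, 'b, 'y) module_scheme \<Rightarrow> (int \<Rightarrow> 'b set) \<Rightarrow> int \<Rightarrow> ('b list \<Rightarrow> 'r) set set" where
  "exterior_grading K \<phi> R Rgr m M Mgr d =
     module_span K (restrict_scalars \<phi> (exterior_power R m M))
       {r \<odot>\<^bsub>exterior_power R m M\<^esub> wedge R m M xs | r xs i ds.
          r \<in> Rgr i \<and> length xs = m \<and> length ds = m \<and> (\<forall>k<m. xs ! k \<in> Mgr (ds ! k)) \<and>
          i + sum_list ds = d}"


section \<open>Hilbert functions and regularity index\<close>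

definition hilbert_function ::
    "('a, 'z) ring_scheme \<Rightarrow> ('a \<Rightarrow> 'r) \<Rightarrow> ('r, 'b, 'y) module_scheme \<Rightarrow> (int \<Rightarrow> 'b set) \<Rightarrow> int \<Rightarrow> nat" where
  "hilbert_function K \<phi> M Mgr i =
     vectorspace.dim K ((restrict_scalars \<phi> M)\<lparr>carrier := Mgr i\<rparr>)"

text \<open>The next two definitions are meaningful for functions that agree with a polynomial in all
  large degrees and, for the second, vanish in all sufficiently negative degrees.\<close>

definition hilbert_polynomial :: "(int \<Rightarrow> nat) \<Rightarrow> rat poly" where
  "hilbert_polynomial HF = (THE p. \<forall>\<^sub>F i in at_top. of_nat (HF i) = poly p (of_int i))"

definition regularity_index :: "(int \<Rightarrow> nat) \<Rightarrow> int extended" where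
  "regularity_index HF =
     (if \<forall>j. of_nat (HF j) = poly (hilbert_polynomial HF) (of_int j) then Minf
      else Fin (LEAST i. \<forall>j\<ge>i. of_nat (HF j) = poly (hilbert_polynomial HF) (of_int j)))"


section \<open>Closed subschemes of projective space\<close>

type_synonym 'k mpoly = "(nat \<Rightarrow>\<^sub>0 nat) \<Rightarrow>\<^sub>0 'k"

definition poly_ring :: "nat \<Rightarrow> 'k::field mpoly ring" where
  "poly_ring n =
     \<lparr>carrier = {p. \<forall>t\<in>Poly_Mapping.keys p. Poly_Mapping.keys t \<subseteq> {..n}},
      mult = (*), one = 1, zero = 0, add = (+)\<rparr>"

definition indet :: "nat \<Rightarrow> 'k::field mpoly" where
  "indet i = Poly_Mapping.single (Poly_Mapping.single i 1) 1"

definition homog_part :: "nat \<Rightarrow> int \<Rightarrow> 'k::field mpoly set" where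
  "homog_part n d =
     {p \<in> carrier (poly_ring n). \<forall>t\<in>Poly_Mapping.keys p.
        int (\<Sum>i\<in>Poly_Mapping.keys t. Poly_Mapping.lookup t i) = d}"

definition homogeneous_ideal :: "nat \<Rightarrow> 'k::field mpoly set \<Rightarrow> bool" where
  "homogeneous_ideal n J \<longleftrightarrow> ideal J (poly_ring n) \<and>
     J = genideal (poly_ring n) {f \<in> J. \<exists>d. f \<in> homog_part n d}"

definition saturated :: "nat \<Rightarrow> 'k::field mpoly set \<Rightarrow> bool" where
  "saturated n I \<longleftrightarrow>
     (\<forall>f\<in>carrier (poly_ring n). (\<forall>i\<le>n. \<exists>k. indet i ^ k * f \<in> I) \<longrightarrow> f \<in> I)"

text \<open>The underlying set of \<open>Proj (S/I)\<close>: homogeneous primes of \<open>S\<close> containing \<open>I\<close> but not the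
  irrelevant ideal \<open>(X\<^sub>0, \<dots>, X\<^sub>n)\<close>. The point \<open>P\<close> lies on the hyperplane \<open>X\<^sub>i = 0\<close> iff
  \<open>X\<^sub>i \<in> P\<close>.\<close>

definition scheme_points :: "nat \<Rightarrow> 'k::field mpoly set \<Rightarrow> 'k mpoly set set" where
  "scheme_points n I =
     {P. primeideal P (poly_ring n) \<and> homogeneous_ideal n P \<and> I \<subseteq> P \<and> \<not> (\<forall>i\<le>n. indet i \<in> P)}"

text \<open>Closed subschemes of projective \<open>n\<close>-space are represented by their saturated homogeneous
  vanishing ideals. Dimension \<open>0\<close> means that the space is nonempty and that there are no proper
  specializations among its points.\<close>

definition zero_dim_scheme :: "nat \<Rightarrow> 'k::field mpoly set \<Rightarrow> bool" where
  "zero_dim_scheme n I \<longleftrightarrow> homogeneous_ideal n I \<and> saturated n I \<and> scheme_points n I \<noteq> {} \<and>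
     (\<forall>P\<in>scheme_points n I. \<forall>Q\<in>scheme_points n I. P \<subseteq> Q \<longrightarrow> P = Q)"

abbreviation base_field :: "'k::field ring" where
  "base_field \<equiv> class_ring"

definition coord_ring :: "nat \<Rightarrow> 'k::field mpoly set \<Rightarrow> 'k mpoly set ring" where
  "coord_ring n I = poly_ring n Quot I"

definition coord_map :: "nat \<Rightarrow> 'k::field mpoly set \<Rightarrow> 'k \<Rightarrow> 'k mpoly set" where
  "coord_map n I c = I +>\<^bsub>poly_ring n\<^esub> Poly_Mapping.single 0 c"

definition coord_grading :: "nat \<Rightarrow> 'k::field mpoly set \<Rightarrow> int \<Rightarrow> 'k mpoly set set" where
  "coord_grading n I d = (\<lambda>f. I +>\<^bsub>poly_ring n\<^esub> f) ` homog_part n d"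

definition Omega1 where
  "Omega1 n I = kaehler base_field (coord_map n I) (coord_ring n I)"

definition Omega1_grading where
  "Omega1_grading n I =
     kaehler_grading base_field (coord_map n I) (coord_ring n I) (coord_grading n I)"

definition Omega where
  "Omega n I m = exterior_power (coord_ring n I) m (Omega1 n I)"

definition Omega_grading where
  "Omega_grading n I m =
     exterior_grading base_field (coord_map n I) (coord_ring n I) (coord_grading n I) m
       (Omega1 n I) (Omega1_grading n I)"

definition ri_coord_ring :: "nat \<Rightarrow> 'k::field mpoly set \<Rightarrow> int extended" where
  "ri_coord_ring n I = regularity_index
     (hilbert_function base_field (coord_map n I) (regular_module (coord_ring n I))
       (coord_grading n I))"

definition ri_Omega1 :: "nat \<Rightarrow> 'k::field mpoly set \<Rightarrow> int extended" where
  "ri_Omega1 n I = regularity_index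
     (hilbert_function base_field (coord_map n I) (Omega1 n I) (Omega1_grading n I))"

definition ri_Omega :: "nat \<Rightarrow> 'k::field mpoly set \<Rightarrow> nat \<Rightarrow> int extended" where
  "ri_Omega n I m = regularity_index
     (hilbert_function base_field (coord_map n I) (Omega n I m) (Omega_grading n I m))"

end

theory Submission
  imports Defs
begin

text \<open>Write \<open>x\<^sub>0\<close> for the class of \<open>X\<^sub>0\<close> in \<open>R = S/I\<close>. Since no point lies on \<open>X\<^sub>0 = 0\<close>, every \<open>X\<^sub>i\<close> has
  a power in \<open>I + (X\<^sub>0)\<close>, so multiplication by \<open>x\<^sub>0\<close> is onto in large degrees; the Hilbert function of
  \<open>R\<close> is then eventually constant, so that multiplication by \<open>x\<^sub>0\<close> is injective in large degrees, and
  by saturation \<open>x\<^sub>0\<close> is a nonzerodivisor. Hence \<open>R\<^sub>e\<^sub>+\<^sub>1 = x\<^sub>0 R\<^sub>e\<close> for all \<open>e\<close> from \<open>r = ri(R)\<close> on.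

  Let \<open>G\<close> be the kernel of \<open>R\<^sup>n\<^sup>+\<^sup>1 \<rightarrow> \<Omega>\<^sup>1\<close>. Then \<open>\<Omega>\<^sup>m\<close> is the quotient of the free module on the index
  tuples of length \<open>m\<close> by the submodule \<open>U\<close> generated by the tensors symmetric in two slots and by those
  with an element of \<open>G\<close> in one slot. If \<open>A \<ge> r + 1\<close> bounds \<open>ri(\<Omega>\<^sup>1)\<close>, then \<open>x\<^sub>0\<close> acts bijectively on \<open>\<Omega>\<^sup>1\<close>
  in degrees from \<open>A\<close> on, so elements of \<open>G\<close> of degree greater than \<open>A\<close> are divisible by \<open>x\<^sub>0\<close> inside
  \<open>G\<close>, and therefore elements of \<open>U\<close> of degree at least \<open>A + m\<close> are divisible by \<open>x\<^sub>0\<close> inside \<open>U\<close>. So \<open>x\<^sub>0\<close> acts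
  bijectively on \<open>\<Omega>\<^sup>m\<close> in degrees from \<open>A + m - 1\<close> on, where the Hilbert function is thus constant.\<close>

section \<open>Homogeneous components of polynomials\<close>

text \<open>Surjectivity of x_0 on Omega^m is inherited from R, so the work lies in injectivity. If
  x_0 c is in the kernel U for a coefficient vector c, divisibility inside U gives v in U with x_0 c
  = x_0 v, and c = v as x_0 is a nonzerodivisor.

  The obstacle: a tensor with the same arbitrary factor in two slots is not homogeneous and cannot
  be divided by itself. Symmetry survives when each coefficient is replaced by its component of a
  fixed degree and divided by one fixed choice function, and such tensors still map to 0, since
  their terms cancel in pairs without any division by 2.

  That U is the whole kernel, and that G is graded, is shown by a map backwards from the free module
  on all symbols, computed on chosen polynomial representatives and linear only modulo I.

  Degrees are counted on coefficients. The generators have degree 1 in Omega^1 and m in Omega^m, so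
  one coefficient degree E = max(r, ri(Omega^1) - 1) governs both and yields the bound E +
  m.\<close>

abbreviation "polys n \<equiv> carrier (poly_ring n)"

lemma poly_ring_simps [simp]:
  "mult (poly_ring n) = (*)" "one (poly_ring n) = 1"
  "zero (poly_ring n) = 0" "add (poly_ring n) = (+)"
  by (simp_all add: poly_ring_def)

lemma polys_iff: "p \<in> polys n \<longleftrightarrow> (\<forall>t\<in>Poly_Mapping.keys p. Poly_Mapping.keys t \<subseteq> {..n})"
  by (simp add: poly_ring_def)

lemma polys_0 [simp]: "0 \<in> polys n"
  and polys_1 [simp]: "1 \<in> polys n"
  by (simp_all add: polys_iff)

lemma polys_add [simp]: "p \<in> polys n \<Longrightarrow> q \<in> polys n \<Longrightarrow> p + q \<in> polys n"
  using Poly_Mapping.keys_add[of p q] unfolding polys_iff by blast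

lemma keys_uminus_poly [simp]: "Poly_Mapping.keys (- p :: 'k::field mpoly) = Poly_Mapping.keys p"
  by (auto simp: in_keys_iff)

lemma polys_uminus [simp]: "p \<in> polys n \<Longrightarrow> - p \<in> polys n"
  unfolding polys_iff by simp

lemma polys_diff [simp]: "p \<in> polys n \<Longrightarrow> q \<in> polys n \<Longrightarrow> p - q \<in> polys n"
  using polys_add[of p n "- q"] by simp

lemma polys_mult [simp]: 
  assumes "p \<in> polys n" "q \<in> polys n" shows "p * q \<in> polys n"
  unfolding polys_iff
proof
  fix t assume "t \<in> Poly_Mapping.keys (p * q)"
  then obtain a b where "t = a + b" "a \<in> Poly_Mapping.keys p" "b \<in> Poly_Mapping.keys q"
    using Poly_Mapping.keys_mult[of p q] by blast
  then show "Poly_Mapping.keys t \<subseteq> {..n}"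
    using assms Poly_Mapping.keys_add[of a b] unfolding polys_iff by blast
qed

lemma polys_power [simp]: "p \<in> polys n \<Longrightarrow> p ^ k \<in> polys n"
  by (induction k) auto

lemma polys_sum [simp]: "(\<And>a. a \<in> A \<Longrightarrow> f a \<in> polys n) \<Longrightarrow> sum f A \<in> polys n"
  by (induction A rule: infinite_finite_induct) auto

lemma polys_prod [simp]: "(\<And>a. a \<in> A \<Longrightarrow> f a \<in> polys n) \<Longrightarrow> prod f A \<in> polys n"
  by (induction A rule: infinite_finite_induct) auto

lemma polys_const [simp]: "Poly_Mapping.single 0 c \<in> polys n"
  by (simp add: polys_iff)

lemma polys_single: "Poly_Mapping.keys t \<subseteq> {..n} \<Longrightarrow> Poly_Mapping.single t c \<in> polys n"
  by (simp add: polys_iff)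

lemma polys_indet [simp]: "i \<le> n \<Longrightarrow> indet i \<in> polys n"
  unfolding indet_def by (rule polys_single) simp

lemma single_decomp: "p = (\<Sum>t\<in>Poly_Mapping.keys p. Poly_Mapping.single t (Poly_Mapping.lookup p t))"
  by (rule poly_mapping_eqI) 
    (auto simp: lookup_sum lookup_single when_def in_keys_iff)

lemma cring_poly_ring: "cring (poly_ring n :: 'k::field mpoly ring)" (is "cring ?R")
proof (rule cringI)
  show "abelian_group ?R"
  proof (rule abelian_groupI)
    fix x :: "'k mpoly" assume "x \<in> carrier ?R"
    then show "\<exists>y\<in>carrier ?R. y \<oplus>\<^bsub>?R\<^esub> x = \<zero>\<^bsub>?R\<^esub>"
      by (intro bexI[of _ "- x"]) auto
  qed (auto simp: algebra_simps)
  show "comm_monoid ?R"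
    by (rule comm_monoidI) (auto simp: algebra_simps)
qed (auto simp: algebra_simps)

lemma a_inv_poly_ring [simp]: 
  assumes "p \<in> polys n" shows "\<ominus>\<^bsub>poly_ring n\<^esub> p = - p"
proof -
  interpret cring "poly_ring n" by (rule cring_poly_ring)
  show ?thesis using assms minus_equality[of "- p" p] by simp
qed

lemma ideal_poly_ringI:
  assumes "J \<subseteq> polys n" "0 \<in> J" "\<And>p q. p \<in> J \<Longrightarrow> q \<in> J \<Longrightarrow> p + q \<in> J"
    "\<And>p q. p \<in> polys n \<Longrightarrow> q \<in> J \<Longrightarrow> p * q \<in> J"
  shows "ideal J (poly_ring n)"
proof (rule idealI)
  interpret cring "poly_ring n" by (rule cring_poly_ring)
  show "ring (poly_ring n)" by (rule ring_axioms)
  show "subgroup J (add_monoid (poly_ring n))"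
  proof (rule group.subgroupI[OF a_group])
    show "J \<subseteq> carrier (add_monoid (poly_ring n))" using assms by auto
    show "J \<noteq> {}" using assms by auto
    fix a b assume "a \<in> J" "b \<in> J"
    then show "a \<otimes>\<^bsub>add_monoid (poly_ring n)\<^esub> b \<in> J" using assms by auto
  next
    fix a assume a: "a \<in> J"
    then have "inv\<^bsub>add_monoid (poly_ring n)\<^esub> a = - a"
      using assms(1) a_inv_poly_ring[of a n] by (auto simp: a_inv_def)
    then show "inv\<^bsub>add_monoid (poly_ring n)\<^esub> a \<in> J" using assms(4)[of "-1" a] a by simp
  qed
next
  fix a x :: "'a mpoly" assume "a \<in> J" "x \<in> polys n"
  then show "x \<otimes>\<^bsub>poly_ring n\<^esub> a \<in> J" "a \<otimes>\<^bsub>poly_ring n\<^esub> x \<in> J"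
    using assms(4)[of x a] by (simp_all add: mult.commute)
qed

section \<open>Total degree and homogeneous polynomials\<close>

definition tdeg :: "(nat \<Rightarrow>\<^sub>0 nat) \<Rightarrow> nat" where
  "tdeg t = (\<Sum>i\<in>Poly_Mapping.keys t. Poly_Mapping.lookup t i)"

lemma tdeg_superset:
  assumes "finite A" "Poly_Mapping.keys t \<subseteq> A"
  shows "tdeg t = (\<Sum>i\<in>A. Poly_Mapping.lookup t i)"
  unfolding tdeg_def using assms by (intro sum.mono_neutral_left) (auto simp: in_keys_iff)

lemma tdeg_add [simp]: "tdeg (s + t) = tdeg s + tdeg t"
proof -
  let ?A = "Poly_Mapping.keys s \<union> Poly_Mapping.keys t"
  have "Poly_Mapping.keys (s + t) \<subseteq> ?A" by (rule Poly_Mapping.keys_add)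
  then show ?thesis
    by (simp add: tdeg_superset[of ?A] lookup_add sum.distrib)
qed

lemma tdeg_0 [simp]: "tdeg 0 = 0"
  by (simp add: tdeg_def)

lemma tdeg_single [simp]: "tdeg (Poly_Mapping.single i k) = k"
  by (simp add: tdeg_def)

definition homog :: "int \<Rightarrow> 'k::field mpoly \<Rightarrow> bool" where
  "homog d p \<longleftrightarrow> (\<forall>t\<in>Poly_Mapping.keys p. int (tdeg t) = d)"

lemma homog_part_iff: "p \<in> homog_part n d \<longleftrightarrow> p \<in> polys n \<and> homog d p"
  by (simp add: homog_part_def homog_def tdeg_def)

lemma homog_0 [simp]: "homog d 0"
  by (simp add: homog_def)

lemma homog_add [simp]: "homog d p \<Longrightarrow> homog d q \<Longrightarrow> homog d (p + q)"
  using Poly_Mapping.keys_add[of p q] unfolding homog_def by blast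

lemma homog_uminus [simp]: "homog d p \<Longrightarrow> homog d (- p)"
  unfolding homog_def by simp

lemma homog_diff [simp]: "homog d p \<Longrightarrow> homog d q \<Longrightarrow> homog d (p - q)"
  using homog_add[of d p "- q"] by simp

lemma homog_sum [simp]: "(\<And>a. a \<in> A \<Longrightarrow> homog d (f a)) \<Longrightarrow> homog d (sum f A)"
  by (induction A rule: infinite_finite_induct) auto

lemma homog_mult:
  assumes "homog d p" "homog e q" shows "homog (d + e) (p * q)"
  unfolding homog_def
proof
  fix t assume "t \<in> Poly_Mapping.keys (p * q)"
  then obtain a b where "t = a + b" "a \<in> Poly_Mapping.keys p" "b \<in> Poly_Mapping.keys q"
    using Poly_Mapping.keys_mult[of p q] by blast
  then show "int (tdeg t) = d + e"
    using assms unfolding homog_def by auto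
qed

lemma homog_mult': "homog d p \<Longrightarrow> homog e q \<Longrightarrow> d + e = c \<Longrightarrow> homog c (p * q)"
  using homog_mult by blast

lemma homog_single: "homog d (Poly_Mapping.single t c) \<longleftrightarrow> c = 0 \<or> int (tdeg t) = d"
  by (simp add: homog_def)

lemma homog_const [simp]: "homog 0 (Poly_Mapping.single 0 c)"
  by (simp add: homog_single)

lemma homog_1 [simp]: "homog 0 1"
  by (simp add: homog_def)

lemma homog_indet [simp]: "homog 1 (indet i)"
  by (simp add: indet_def homog_single)

lemma homog_power: "homog d p \<Longrightarrow> homog (int k * d) (p ^ k)"
  by (induction k) (auto simp: algebra_simps intro: homog_mult')

text \<open>Later rules out that 1 is a multiple of X_0 modulo I, and with it the value
  \<open>Minf\<close> for the regularity index of the coordinate ring.\<close>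

lemma homog_neg: "homog d p \<Longrightarrow> d < 0 \<Longrightarrow> p = 0"
  by (metis homog_def in_keys_iff poly_mapping_eqI lookup_zero of_nat_less_0_iff)

text \<open>Integer degrees let \<open>hcomp (d - e)\<close> be written without a case distinction;
  in negative degrees it is 0.\<close>

definition hcomp :: "int \<Rightarrow> 'k::field mpoly \<Rightarrow> 'k mpoly" where
  "hcomp d p = (\<Sum>t\<in>Poly_Mapping.keys p.
     if int (tdeg t) = d then Poly_Mapping.single t (Poly_Mapping.lookup p t) else 0)"

lemma lookup_hcomp:
  "Poly_Mapping.lookup (hcomp d p) t = (if int (tdeg t) = d then Poly_Mapping.lookup p t else 0)"
proof -
  have "Poly_Mapping.lookup (hcomp d p) t = (\<Sum>s\<in>Poly_Mapping.keys p.
      if s = t then (if int (tdeg t) = d then Poly_Mapping.lookup p t else 0) else 0)"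
    unfolding hcomp_def lookup_sum by (intro sum.cong) (auto simp: lookup_single when_def)
  then show ?thesis by (simp add: in_keys_iff)
qed

lemma hcomp_0 [simp]: "hcomp d 0 = 0"
  by (rule poly_mapping_eqI) (simp add: lookup_hcomp)

lemma hcomp_add: "hcomp d (p + q) = hcomp d p + hcomp d q"
  by (rule poly_mapping_eqI) (simp add: lookup_hcomp lookup_add)

lemma hcomp_diff: "hcomp d (p - q) = hcomp d p - hcomp d q"
  by (rule poly_mapping_eqI) (simp add: lookup_hcomp lookup_minus)

lemma hcomp_sum: "hcomp d (sum f A) = (\<Sum>a\<in>A. hcomp d (f a))"
  by (induction A rule: infinite_finite_induct) (auto simp: hcomp_add)

lemma polys_hcomp [simp]: "p \<in> polys n \<Longrightarrow> hcomp d p \<in> polys n"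
  unfolding polys_iff by (auto simp: in_keys_iff lookup_hcomp split: if_splits)

lemma homog_hcomp [simp]: "homog d (hcomp d p)"
  unfolding homog_def by (auto simp: in_keys_iff lookup_hcomp split: if_splits)

lemma hcomp_homog: "homog d p \<Longrightarrow> hcomp e p = (if e = d then p else 0)"
  by (rule poly_mapping_eqI) (auto simp: lookup_hcomp homog_def in_keys_iff)

definition degs :: "'k::field mpoly \<Rightarrow> int set" where
  "degs p = (\<lambda>t. int (tdeg t)) ` Poly_Mapping.keys p"

lemma finite_degs [simp]: "finite (degs p)"
  by (simp add: degs_def)

lemma hcomp_eq_0: "d \<notin> degs p \<Longrightarrow> hcomp d p = 0"
  by (rule poly_mapping_eqI) (auto simp: lookup_hcomp degs_def in_keys_iff)

lemma sum_hcomp: 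
  assumes "finite D" "degs p \<subseteq> D" shows "(\<Sum>d\<in>D. hcomp d p) = p"
proof (rule poly_mapping_eqI)
  fix t
  have "int (tdeg t) \<in> D" if "Poly_Mapping.lookup p t \<noteq> 0"
    using that assms by (auto simp: degs_def in_keys_iff)
  then show "Poly_Mapping.lookup (\<Sum>d\<in>D. hcomp d p) t = Poly_Mapping.lookup p t"
    using assms(1) by (auto simp: lookup_sum lookup_hcomp)
qed

lemma hcomp_mult_homog:
  assumes "homog e p" shows "hcomp d (p * q) = p * hcomp (d - e) q"
proof -
  have "hcomp d (p * q) = (\<Sum>c\<in>insert (d - e) (degs q). hcomp d (p * hcomp c q))"
    by (subst sum_hcomp[of "insert (d - e) (degs q)" q, symmetric]) 
      (auto simp: sum_distrib_left hcomp_sum)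
  also have "\<dots> = (\<Sum>c\<in>insert (d - e) (degs q). if c = d - e then p * hcomp (d - e) q else 0)"
    by (intro sum.cong refl) 
      (subst hcomp_homog[OF homog_mult[OF assms homog_hcomp]], auto)
  finally show ?thesis by simp
qed

lemma hcomp_mult:
  assumes "finite D" "degs p \<subseteq> D"
  shows "hcomp d (p * q) = (\<Sum>e\<in>D. hcomp e p * hcomp (d - e) q)"
  by (subst sum_hcomp[OF assms, symmetric]) 
    (simp add: sum_distrib_right hcomp_sum hcomp_mult_homog[OF homog_hcomp])

text \<open>The elements of \<open>J\<close> all of whose components lie in \<open>J\<close> form an
  ideal. It contains the homogeneous generators of \<open>J\<close>, hence all of \<open>J\<close>
  by minimality of \<open>genideal\<close>.\<close>

lemma homogeneous_ideal_hcomp: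
  assumes "homogeneous_ideal n J" "f \<in> J" shows "hcomp d f \<in> J"
proof -
  interpret cring "poly_ring n" by (rule cring_poly_ring)
  let ?H = "{f \<in> J. \<exists>d. f \<in> homog_part n d}"
  let ?C = "{f \<in> J. \<forall>d. hcomp d f \<in> J}"
  interpret J: ideal J "poly_ring n" using assms by (simp add: homogeneous_ideal_def)
  have "J \<subseteq> polys n" using J.a_subset by auto
  have mul: "p * q \<in> J" if "p \<in> polys n" "q \<in> J" for p q
    using J.I_l_closed that by simp
  have add: "p + q \<in> J" if "p \<in> J" "q \<in> J" for p q
    using J.a_closed that by simp
  have z: "0 \<in> J" using J.zero_closed by simp
  have sm: "sum g A \<in> J" if "\<And>a. a \<in> A \<Longrightarrow> g a \<in> J" for g A
    using that by (induction A rule: infinite_finite_induct) (auto intro: add z)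
  have "ideal ?C (poly_ring n)"
  proof (rule ideal_poly_ringI)
    fix p q :: "'a mpoly" assume "p \<in> polys n" "q \<in> ?C"
    then show "p * q \<in> ?C" by (auto simp: hcomp_mult[OF finite_degs subset_refl] intro!: sm mul)
  qed (use \<open>J \<subseteq> polys n\<close> in \<open>auto simp: hcomp_add intro: add z\<close>)
  moreover have "?H \<subseteq> ?C"
    by (auto simp: homog_part_iff hcomp_homog z)
  ultimately have "genideal (poly_ring n) ?H \<subseteq> ?C"
    by (rule genideal_minimal)
  then show ?thesis using assms unfolding homogeneous_ideal_def by blast
qed

lemma homogeneous_idealI:
  assumes "ideal J (poly_ring n)" "\<And>f d. f \<in> J \<Longrightarrow> hcomp d f \<in> J" 
  shows "homogeneous_ideal n J"
proof -
  interpret cring "poly_ring n" by (rule cring_poly_ring)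
  let ?H = "{f \<in> J. \<exists>d. f \<in> homog_part n d}"
  interpret J: ideal J "poly_ring n" by fact
  have sub: "J \<subseteq> polys n" using J.a_subset by auto
  then have H: "?H \<subseteq> polys n" by auto
  interpret G: ideal "genideal (poly_ring n) ?H" "poly_ring n"
    by (rule genideal_ideal[OF H])
  have "f \<in> genideal (poly_ring n) ?H" if "f \<in> J" for f
  proof -
    have mem: "hcomp d f \<in> genideal (poly_ring n) ?H" for d
    proof -
      have "hcomp d f \<in> homog_part n d"
        using that sub by (auto simp: homog_part_iff)
      then have "hcomp d f \<in> ?H" using assms(2)[OF that] by blast
      then show ?thesis using genideal_self[OF H] by blast
    qed
    have "(\<Sum>d\<in>A. hcomp d f) \<in> genideal (poly_ring n) ?H" for A
    proof (induction A rule: infinite_finite_induct)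
      case (insert d A)
      then show ?case using G.a_closed[OF mem insert.IH] by simp
    qed (use G.zero_closed in simp_all)
    from this[of "degs f"] show ?thesis by (simp only: sum_hcomp[OF finite_degs subset_refl])
  qed
  moreover have "genideal (poly_ring n) ?H \<subseteq> J"
    by (rule genideal_minimal) (use assms in auto)
  ultimately show ?thesis using assms unfolding homogeneous_ideal_def by blast
qed

section \<open>Graded prime ideals\<close>

locale poly_ideal =
  fixes n :: nat and J :: "'k::field mpoly set"
  assumes ideal_J: "ideal J (poly_ring n)"
begin

lemma J_polys: "p \<in> J \<Longrightarrow> p \<in> polys n"
  using ideal.axioms(1)[OF ideal_J] additive_subgroup.a_subset by blast

lemma J_0 [simp]: "0 \<in> J"
  using additive_subgroup.zero_closed[OF ideal.axioms(1)[OF ideal_J]] by simp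

lemma J_add: "p \<in> J \<Longrightarrow> q \<in> J \<Longrightarrow> p + q \<in> J"
  using additive_subgroup.a_closed[OF ideal.axioms(1)[OF ideal_J]] by simp

lemma J_mult: "p \<in> polys n \<Longrightarrow> q \<in> J \<Longrightarrow> p * q \<in> J"
  using ideal.I_l_closed[OF ideal_J] by simp

lemma J_mult': "p \<in> J \<Longrightarrow> q \<in> polys n \<Longrightarrow> p * q \<in> J"
  using J_mult[of q p] by (simp add: mult.commute)

lemma J_uminus: "p \<in> J \<Longrightarrow> - p \<in> J"
  using J_mult[of "-1" p] by simp

lemma J_diff: "p \<in> J \<Longrightarrow> q \<in> J \<Longrightarrow> p - q \<in> J"
  using J_add[of p "- q"] J_uminus by simp

lemma J_sum: "(\<And>a. a \<in> A \<Longrightarrow> f a \<in> J) \<Longrightarrow> sum f A \<in> J"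
  by (induction A rule: infinite_finite_induct) (auto intro: J_add)

end

text \<open>Equivalent to \<open>homogeneous_ideal\<close>; in this form the property passes
  directly to sums with a principal ideal and to unions of chains.\<close>

definition graded_ideal :: "nat \<Rightarrow> 'k::field mpoly set \<Rightarrow> bool" where
  "graded_ideal n J \<longleftrightarrow> ideal J (poly_ring n) \<and> (\<forall>f\<in>J. \<forall>d. hcomp d f \<in> J)"

lemma graded_ideal_iff: "graded_ideal n J \<longleftrightarrow> homogeneous_ideal n J"
  using homogeneous_idealI homogeneous_ideal_hcomp
  unfolding graded_ideal_def homogeneous_ideal_def by blast

text \<open>Multiplication by the homogeneous \<open>a\<close> only shifts degrees, so the
  components of \<open>j + p * a\<close> have the same shape. The ideal J + (a) serves twice: as I +
  (X_0), and to enlarge a maximal graded ideal.\<close>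

lemma graded_ideal_add_principal:
  fixes J :: "'k::field mpoly set"
  assumes "graded_ideal n J" "a \<in> polys n" "homog e a"
  shows "graded_ideal n {j + p * a | j p. j \<in> J \<and> p \<in> polys n}" (is "graded_ideal n ?L")
proof -
  interpret poly_ideal n J using assms by (intro poly_ideal.intro) (simp add: graded_ideal_def)
  have "ideal ?L (poly_ring n)"
  proof (rule ideal_poly_ringI)
    show "?L \<subseteq> polys n" using assms J_polys by auto
    show "0 \<in> ?L" using J_0 polys_0[of n] by (metis (mono_tags, lifting) add_0 mem_Collect_eq mult_zero_left)
  next
    fix x y assume "x \<in> ?L" "y \<in> ?L"
    then obtain j p j' p' where "x = j + p * a" "y = j' + p' * a" "j \<in> J" "j' \<in> J" 
      "p \<in> polys n" "p' \<in> polys n" by blast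
    then have "x + y = (j + j') + (p + p') * a" "j + j' \<in> J" "p + p' \<in> polys n"
      by (auto simp: algebra_simps J_add)
    then show "x + y \<in> ?L" by blast
  next
    fix x y :: "'k mpoly" assume x: "x \<in> polys n" and "y \<in> ?L"
    then obtain j p where "y = j + p * a" "j \<in> J" "p \<in> polys n" by blast
    then have "x * y = x * j + (x * p) * a" 
      by (simp add: algebra_simps)
    moreover have "x * j \<in> J" "x * p \<in> polys n"
      using x \<open>j \<in> J\<close> \<open>p \<in> polys n\<close> by (simp_all add: J_mult)
    ultimately
    show "x * y \<in> ?L" by blast
  qed
  moreover have "hcomp d f \<in> ?L" if f: "f \<in> ?L" for f d
  proof -
    from f obtain j p where "f = j + p * a" "j \<in> J" "p \<in> polys n" by blast
    then have "hcomp d f = hcomp d j + hcomp (d - e) p * a" "hcomp d j \<in> J" "hcomp (d - e) p \<in> polys n"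
      using assms hcomp_mult_homog[of e a d p] 
      by (auto simp: hcomp_add mult.commute graded_ideal_def)
    then show ?thesis by blast
  qed
  ultimately show ?thesis unfolding graded_ideal_def by blast
qed

lemma graded_ideal_Union_chain:
  fixes C :: "'k::field mpoly set set"
  assumes "C \<noteq> {}" "subset.chain (Collect (graded_ideal n)) C"
  shows "graded_ideal n (\<Union>C)"
proof -
  have C: "graded_ideal n J" if "J \<in> C" for J
    using that assms(2) by (auto simp: subset.chain_def)
  have pI: "poly_ideal n J" if "J \<in> C" for J
    using C[OF that] by (intro poly_ideal.intro) (simp add: graded_ideal_def)
  have "ideal (\<Union>C) (poly_ring n)"
  proof (rule ideal_poly_ringI)
    show "\<Union>C \<subseteq> polys n" using poly_ideal.J_polys[OF pI] by blast
    show "0 \<in> \<Union>C" using assms(1) poly_ideal.J_0[OF pI] by blast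
  next
    fix p q assume "p \<in> \<Union>C" "q \<in> \<Union>C"
    then obtain A B where "A \<in> C" "B \<in> C" "p \<in> A" "q \<in> B" by blast
    moreover have "A \<subseteq> B \<or> B \<subseteq> A" 
      using assms(2) \<open>A \<in> C\<close> \<open>B \<in> C\<close> unfolding subset.chain_def by blast
    ultimately show "p + q \<in> \<Union>C"
      using poly_ideal.J_add[OF pI] by blast
  next
    fix p q :: "'k mpoly" assume "p \<in> polys n" "q \<in> \<Union>C"
    then show "p * q \<in> \<Union>C" using poly_ideal.J_mult[OF pI] by blast
  qed
  then show ?thesis using C unfolding graded_ideal_def by blast
qed

text \<open>A graded ideal that is maximal among those avoiding the powers of \<open>x\<close> is prime; this gives
  a point of the scheme on \<open>X\<^sub>0 = 0\<close> outside \<open>X\<^sub>i = 0\<close> if no power of \<open>X\<^sub>i\<close> is in \<open>I + (X\<^sub>0)\<close>.\<close>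

lemma graded_prime_avoiding_powers:
  fixes L :: "'k::field mpoly set"
  assumes L: "graded_ideal n L" and x: "x \<in> polys n" "\<And>k. x ^ k \<notin> L"
  obtains P where "primeideal P (poly_ring n)" "homogeneous_ideal n P" "L \<subseteq> P" "x \<notin> P"
proof -
  let ?A = "{J. graded_ideal n J \<and> L \<subseteq> J \<and> (\<forall>k. x ^ k \<notin> J)}"
  have "\<exists>M\<in>?A. \<forall>X\<in>?A. M \<subseteq> X \<longrightarrow> X = M"
  proof (rule subset_Zorn_nonempty)
    show "?A \<noteq> {}" using assms by blast
    fix C assume C: "C \<noteq> {}" "subset.chain ?A C"
    then have "subset.chain (Collect (graded_ideal n)) C"
      unfolding subset.chain_def by blast
    then have "graded_ideal n (\<Union>C)" by (rule graded_ideal_Union_chain[OF C(1)])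
    moreover have mem: "L \<subseteq> J \<and> (\<forall>k. x ^ k \<notin> J)" if "J \<in> C" for J
      using that C(2) unfolding subset.chain_def by blast
    have "L \<subseteq> \<Union>C" using C(1) mem by blast
    moreover have "\<forall>k. x ^ k \<notin> \<Union>C" using mem by blast
    ultimately show "\<Union>C \<in> ?A" by blast
  qed
  then obtain M where "M \<in> ?A" and MX: "\<forall>X\<in>?A. M \<subseteq> X \<longrightarrow> X = M" by (elim bexE)
  then have M: "graded_ideal n M" "L \<subseteq> M" "x ^ k \<notin> M" for k by simp_all
  have max: "X = M" if "graded_ideal n X" "M \<subseteq> X" "\<forall>k. x ^ k \<notin> X" for X
    using MX that M(2) by simp
  interpret poly_ideal n M using M by (intro poly_ideal.intro) (simp add: graded_ideal_def)
  have hc: "hcomp d f \<in> M" if "f \<in> M" for f d using M(1) that by (simp add: graded_ideal_def)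
  \<comment> \<open>A homogeneous \<open>a\<close> outside \<open>M\<close> makes the graded ideal M
    + (a) strictly larger, so by maximality it contains a power of \<open>x\<close>.\<close>
  have ext: "\<exists>k j p. x ^ k = j + p * a \<and> j \<in> M \<and> p \<in> polys n"
    if a: "a \<in> polys n" "homog e a" "a \<notin> M" for a e
  proof (rule ccontr)
    let ?X = "{j + p * a | j p. j \<in> M \<and> p \<in> polys n}"
    assume "\<not> ?thesis"
    then have "\<forall>k. x ^ k \<notin> ?X" by blast
    moreover have "graded_ideal n ?X" by (rule graded_ideal_add_principal[OF M(1) a(1,2)])
    moreover have "M \<subseteq> ?X"
    proof
      fix j assume "j \<in> M"
      then have "j = j + 0 * a" "0 \<in> polys n" by auto
      then show "j \<in> ?X" using \<open>j \<in> M\<close> by blast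
    qed
    ultimately have "?X = M" using max by blast
    moreover have "a = 0 + 1 * a" "1 \<in> polys n" by auto
    ultimately have "a \<in> M" using J_0 by blast
    with a show False by blast
  qed
  \<comment> \<open>If \<open>a * b\<close> were in \<open>M\<close>, multiplying the two
    expressions from \<open>ext\<close> would put a power of \<open>x\<close> into
    \<open>M\<close>.\<close>
  have hprime: "a * b \<notin> M" 
    if a: "a \<in> polys n" "homog d a" "a \<notin> M" and b: "b \<in> polys n" "homog e b" "b \<notin> M" for a b d e
  proof
    assume ab: "a * b \<in> M"
    from ext[OF a] obtain k j p where 1: "x ^ k = j + p * a" "j \<in> M" "p \<in> polys n" by blast
    from ext[OF b] obtain l i q where 2: "x ^ l = i + q * b" "i \<in> M" "q \<in> polys n" by blast
    have "x ^ (k + l) = j * x ^ l + (p * a) * i + (p * q) * (a * b)"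
      by (simp add: power_add 1(1) 2(1) algebra_simps)
    also have "\<dots> \<in> M"
    proof (intro J_add)
      show "j * x ^ l \<in> M" using J_mult'[OF 1(2)] x(1) by simp
      show "(p * a) * i \<in> M" using J_mult[OF _ 2(2)] 1(3) a(1) by simp
      show "(p * q) * (a * b) \<in> M" using J_mult[OF _ ab] 1(3) 2(3) by simp
    qed
    finally show False using M(3) by blast
  qed
  \<comment> \<open>An element is the sum of its components, so one outside \<open>M\<close> has a
    component outside \<open>M\<close>; the highest such degree is taken.\<close>
  have top: "\<exists>d. hcomp d f \<notin> M \<and> (\<forall>e>d. hcomp e f \<in> M)" if "f \<notin> M" for f
  proof -
    let ?D = "{d \<in> degs f. hcomp d f \<notin> M}"
    have "?D \<noteq> {}"
    proof
      assume e: "?D = {}"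
      have "(\<Sum>d\<in>degs f. hcomp d f) \<in> M" using e by (intro J_sum) auto
      then show False using that by (simp add: sum_hcomp)
    qed
    then have "Max ?D \<in> ?D" by (intro Max_in) auto
    moreover have "hcomp e f \<in> M" if "e > Max ?D" for e
    proof (rule ccontr)
      assume ne: "hcomp e f \<notin> M"
      then have "e \<in> ?D" using hcomp_eq_0[of e f] J_0 by force
      then have "e \<le> Max ?D" by (intro Max_ge) auto
      then show False using that by simp
    qed
    ultimately show ?thesis by blast
  qed
  \<comment> \<open>Degree \<open>d + e\<close> of \<open>a * b\<close> isolates the product of the
    highest components outside \<open>M\<close>, which reduces primality to homogeneous
    elements.\<close>
  have prime: "a \<in> M \<or> b \<in> M" if ab: "a \<in> polys n" "b \<in> polys n" "a * b \<in> M" for a b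
  proof (rule ccontr)
    assume *: "\<not> ?thesis"
    then have "a \<notin> M" "b \<notin> M" by simp_all
    from top[OF this(1)] obtain d where "hcomp d a \<notin> M \<and> (\<forall>i>d. hcomp i a \<in> M)" ..
    then have d: "hcomp d a \<notin> M" "\<And>i. i > d \<Longrightarrow> hcomp i a \<in> M" by simp_all
    from top[OF \<open>b \<notin> M\<close>] obtain e where "hcomp e b \<notin> M \<and> (\<forall>i>e. hcomp i b \<in> M)" ..
    then have e: "hcomp e b \<notin> M" "\<And>i. i > e \<Longrightarrow> hcomp i b \<in> M" by simp_all
    have "d \<in> degs a" using d(1) hcomp_eq_0 J_0 by metis
    \<comment> \<open>Every other term has \<open>i > d\<close>, or else \<open>i < d\<close> and a
      component of \<open>b\<close> of degree above \<open>e\<close>; in both cases one factor is in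
      \<open>M\<close>.\<close>
    define S where "S = (\<Sum>i\<in>degs a - {d}. hcomp i a * hcomp (d + e - i) b)"
    have "hcomp (d + e) (a * b) = hcomp d a * hcomp e b + S"
      using \<open>d \<in> degs a\<close> by (simp add: hcomp_mult[OF finite_degs subset_refl] sum.remove S_def)
    then have "hcomp d a * hcomp e b = hcomp (d + e) (a * b) - S" by simp
    also have "S \<in> M" unfolding S_def
    proof (rule J_sum)
      fix i assume "i \<in> degs a - {d}"
      then consider "i > d" | "d + e - i > e" by force
      then show "hcomp i a * hcomp (d + e - i) b \<in> M"
        using d(2) e(2) ab by cases (auto intro: J_mult J_mult')
    qed
    then have "hcomp (d + e) (a * b) - S \<in> M" by (rule J_diff[OF hc[OF ab(3)]])
    finally have "hcomp d a * hcomp e b \<in> M" .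
    moreover have "hcomp d a * hcomp e b \<notin> M"
      by (rule hprime[OF _ homog_hcomp d(1) _ homog_hcomp e(1)]) (simp_all add: ab)
    ultimately show False by blast
  qed
  have "primeideal M (poly_ring n)"
  proof (rule primeidealI[OF ideal_J cring_poly_ring])
    show "polys n \<noteq> M" using M(3)[of 0] by auto
  qed (use prime in auto)
  moreover have "x \<notin> M" using M(3)[of 1] by simp
  ultimately show ?thesis using that M graded_ideal_iff by blast
qed

section \<open>Divisibility by X_0 in large degrees\<close>

locale zero_dim =
  fixes n :: nat and I :: "'k::field mpoly set"
  assumes zero_dim: "zero_dim_scheme n I"
    and no_points: "\<forall>P\<in>scheme_points n I. indet 0 \<notin> P"

sublocale zero_dim \<subseteq> poly_ideal n I
  using zero_dim by (intro poly_ideal.intro) (simp add: zero_dim_scheme_def homogeneous_ideal_def)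

context zero_dim
begin

abbreviation "X0 \<equiv> (indet 0 :: 'k mpoly)"

lemma hcomp_I: "f \<in> I \<Longrightarrow> hcomp d f \<in> I"
  using zero_dim homogeneous_ideal_hcomp unfolding zero_dim_scheme_def by blast

lemma saturated_I: "f \<in> polys n \<Longrightarrow> (\<And>i. i \<le> n \<Longrightarrow> \<exists>k. indet i ^ k * f \<in> I) \<Longrightarrow> f \<in> I"
  using zero_dim unfolding zero_dim_scheme_def saturated_def by blast

lemma one_notin_I: "1 \<notin> I"
proof
  assume "1 \<in> I"
  obtain P where P: "P \<in> scheme_points n I" 
    using zero_dim unfolding zero_dim_scheme_def by blast
  then have "primeideal P (poly_ring n)" "1 \<in> P" 
    using \<open>1 \<in> I\<close> unfolding scheme_points_def by auto
  then interpret P: primeideal P "poly_ring n" by simp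
  show False using P.one_imp_carrier \<open>1 \<in> P\<close> P.I_notcarr by simp
qed

text \<open>\<open>no_points\<close> enters here: if I + (X_0) contained no power of X_i, a graded
  prime over it that misses X_i would be a point of the scheme, and it contains X_0.\<close>

lemma power_in_sum:
  assumes "i \<le> n" 
  shows "\<exists>k j p. indet i ^ k = j + p * X0 \<and> j \<in> I \<and> p \<in> polys n"
proof (rule ccontr)
  let ?L = "{j + p * X0 | j p. j \<in> I \<and> p \<in> polys n}"
  assume "\<not> ?thesis"
  then have ni: "indet i ^ k \<notin> ?L" for k by blast
  have "graded_ideal n I" 
    using zero_dim by (simp add: graded_ideal_iff zero_dim_scheme_def)
  then have "graded_ideal n ?L" by (rule graded_ideal_add_principal[where e = 1]) simp_all
  then obtain P where P: "primeideal P (poly_ring n)" "homogeneous_ideal n P" "?L \<subseteq> P" "indet i \<notin> P"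
    using graded_prime_avoiding_powers[OF _ polys_indet[OF assms] ni] by blast
  have "I \<subseteq> ?L"
  proof
    fix j assume "j \<in> I"
    then have "j = j + 0 * X0" "0 \<in> polys n" by auto
    then show "j \<in> ?L" using \<open>j \<in> I\<close> by blast
  qed
  moreover have "X0 = 0 + 1 * X0" "1 \<in> polys n" by auto
  then have "X0 \<in> ?L" using J_0 by blast
  ultimately have "P \<in> scheme_points n I" "X0 \<in> P"
    using P assms unfolding scheme_points_def by blast+
  then show False using no_points by blast
qed

text \<open>By pigeonhole, a monomial of large degree is divisible by a power of some X_i that can
  be traded modulo I for a multiple of X_0.\<close>

lemma high_degree_divisible:
  "\<exists>N\<ge>0. \<forall>d\<ge>N. \<forall>p\<in>homog_part n d. \<exists>q\<in>homog_part n (d - 1). p - X0 * q \<in> I"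
proof -
  have "\<exists>k. \<forall>i\<le>n. \<exists>j p. indet i ^ k i = j + p * X0 \<and> j \<in> I \<and> p \<in> polys n"
    using power_in_sum by metis
  then obtain k where k: "\<And>i. i \<le> n \<Longrightarrow> \<exists>j p. indet i ^ k i = j + p * X0 \<and> j \<in> I \<and> p \<in> polys n"
    by blast
  \<comment> \<open>If every exponent were below its \<open>k i\<close>, the degree would be at most
    the sum, hence below \<open>N\<close>.\<close>
  define N where "N = (\<Sum>i\<le>n. k i) + 1"
  have mono: "\<exists>q\<in>polys n. Poly_Mapping.single t c - X0 * q \<in> I"
    if t: "Poly_Mapping.keys t \<subseteq> {..n}" "tdeg t \<ge> N" for t c
  proof -
    have "\<exists>i\<le>n. Poly_Mapping.lookup t i \<ge> k i"
    proof (rule ccontr)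
      assume "\<not> ?thesis"
      then have "tdeg t \<le> (\<Sum>i\<le>n. k i)"
        unfolding tdeg_superset[OF finite_atMost t(1)] by (intro sum_mono) (meson atMost_iff less_imp_le not_le)
      then show False using t(2) by (simp add: N_def)
    qed
    then obtain i where i: "i \<le> n" "Poly_Mapping.lookup t i \<ge> k i" by blast
    define s where "s = t - Poly_Mapping.single i (k i)"
    have ts: "t = Poly_Mapping.single i (k i) + s"
      using i by (intro poly_mapping_eqI) (auto simp: s_def lookup_add lookup_minus lookup_single when_def)
    have "Poly_Mapping.keys s \<subseteq> Poly_Mapping.keys t"
      by (auto simp: s_def in_keys_iff lookup_minus)
    then have s: "Poly_Mapping.single s c \<in> polys n" 
      using t by (intro polys_single) auto
    have pw: "indet i ^ m = Poly_Mapping.single (Poly_Mapping.single i m) (1::'k)" for m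
      by (induction m) (auto simp: indet_def mult_single single_add[symmetric])
    from k[OF i(1)] obtain j p where jp: "indet i ^ k i = j + p * X0" "j \<in> I" "p \<in> polys n" by blast
    have "Poly_Mapping.single t c = indet i ^ k i * Poly_Mapping.single s c"
      unfolding pw by (simp add: mult_single ts)
    also have "\<dots> = j * Poly_Mapping.single s c + X0 * (p * Poly_Mapping.single s c)"
      by (simp add: jp algebra_simps)
    finally have "Poly_Mapping.single t c - X0 * (p * Poly_Mapping.single s c) \<in> I"
      using jp s by (simp add: J_mult')
    then show ?thesis using jp s by (intro bexI[of _ "p * Poly_Mapping.single s c"]) auto
  qed
  have "\<exists>q\<in>homog_part n (d - 1). p - X0 * q \<in> I" 
    if d: "d \<ge> int N" and p: "p \<in> homog_part n d" for d p
  proof -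
    have p': "p \<in> polys n" "homog d p" using p by (auto simp: homog_part_iff)
    have "\<forall>t\<in>Poly_Mapping.keys p. \<exists>q\<in>polys n. Poly_Mapping.single t (Poly_Mapping.lookup p t) - X0 * q \<in> I"
      using p' d mono by (auto simp: polys_iff homog_def)
    then obtain q where q: "\<And>t. t \<in> Poly_Mapping.keys p \<Longrightarrow> q t \<in> polys n \<and> 
        Poly_Mapping.single t (Poly_Mapping.lookup p t) - X0 * q t \<in> I" by metis
    define r where "r = (\<Sum>t\<in>Poly_Mapping.keys p. q t)"
    have r: "r \<in> polys n" unfolding r_def using q by auto
    have "p - X0 * r = (\<Sum>t\<in>Poly_Mapping.keys p. Poly_Mapping.single t (Poly_Mapping.lookup p t) - X0 * q t)"
      by (subst single_decomp[of p]) (simp add: r_def sum_subtractf sum_distrib_left)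
    then have "p - X0 * r \<in> I" using q by (auto intro!: J_sum)
    \<comment> \<open>\<open>r\<close> need not be homogeneous. Since I is graded, its component of
      degree \<open>d - 1\<close> serves as well.\<close>
    then have "hcomp d (p - X0 * r) \<in> I" by (rule hcomp_I)
    also have "hcomp d (p - X0 * r) = p - X0 * hcomp (d - 1) r"
      using p' by (simp add: hcomp_diff hcomp_homog hcomp_mult_homog[OF homog_indet])
    finally show ?thesis using r by (intro bexI[of _ "hcomp (d - 1) r"]) (auto simp: homog_part_iff)
  qed
  then show ?thesis by (intro exI[of _ "int N"]) auto
qed

end

section \<open>Dimensions and regularity indices\<close>

lemma (in linear_map) inj_on_iff_trivial_kernel:
  "inj_on T (carrier V) \<longleftrightarrow> (\<forall>v\<in>carrier V. T v = \<zero>\<^bsub>W\<^esub> \<longrightarrow> v = \<zero>\<^bsub>V\<^esub>)"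
proof
  assume "inj_on T (carrier V)"
  then show "\<forall>v\<in>carrier V. T v = \<zero>\<^bsub>W\<^esub> \<longrightarrow> v = \<zero>\<^bsub>V\<^esub>"
    by (metis T0_is_0 V.module.M.zero_closed inj_onD)
next
  assume "\<forall>v\<in>carrier V. T v = \<zero>\<^bsub>W\<^esub> \<longrightarrow> v = \<zero>\<^bsub>V\<^esub>"
  then have "kerT = {\<zero>\<^bsub>V\<^esub>}" by (auto simp: ker_def)
  then show "inj_on T (carrier V)" using Ke0_imp_inj by simp
qed

lemma (in linear_map) surj_dim_le:
  assumes "V.fin_dim" "T ` carrier V = carrier W"
  shows "W.dim \<le> V.dim"
proof -
  have "imT = carrier W" using assms(2) by (rule surj_imp_imT_carrier)
  then have "vectorspace.dim K (W.vs imT) = W.dim" by simp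
  then show ?thesis using rank_nullity[OF assms(1)] by linarith
qed

text \<open>Rank-nullity leaves a kernel of dimension 0; it remains to conclude that the kernel is
  zero.\<close>

lemma (in linear_map) surj_dim_eq_imp_inj:
  assumes "V.fin_dim" "T ` carrier V = carrier W" "W.dim = V.dim"
  shows "inj_on T (carrier V)"
proof (rule Ke0_imp_inj)
  have "imT = carrier W" using assms(2) by (rule surj_imp_imT_carrier)
  then have "vectorspace.dim K (W.vs imT) = W.dim" by simp
  then have d0: "vectorspace.dim K (V.vs kerT) = 0"
    using rank_nullity[OF assms(1)] assms(3) by linarith
  interpret Kr: vectorspace K "V.vs kerT"
    by (rule V.subspace_is_vs[OF kerT_is_subspace])
  \<comment> \<open>\<open>dim\<close> is informative only on finite-dimensional spaces. Independent
    subsets of the kernel are independent in \<open>V\<close>, hence bounded in size, and a maximal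
    one is a basis.\<close>
  have "Kr.fin_dim" 
  proof -
    have sub: "submodule K kerT V" by (rule ker_is_submodule)
    have "finite A \<and> card A \<le> V.dim" if "A \<subseteq> carrier (V.vs kerT) \<and> Kr.module.lin_indpt A" for A
    proof -
      have "A \<subseteq> kerT" "A \<subseteq> carrier V" using that by (auto simp: ker_def)
      moreover have "\<not> V.module.lin_dep A"
        using V.module.span_li_not_depend(2)[OF \<open>A \<subseteq> kerT\<close> sub] that by simp
      ultimately show ?thesis using V.li_le_dim[OF assms(1)] by blast
    qed
    moreover have "{} \<subseteq> carrier (V.vs kerT) \<and> Kr.module.lin_indpt {}"
      by (simp add: Kr.module.lin_dep_def)
    ultimately obtain A where "finite A" "maximal A (\<lambda>A. A \<subseteq> carrier (V.vs kerT) \<and> Kr.module.lin_indpt A)"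
      using maximal_exists[of "\<lambda>A. A \<subseteq> carrier (V.vs kerT) \<and> Kr.module.lin_indpt A" "V.dim" "{}"] by blast
    then show ?thesis using Kr.max_li_is_basis unfolding Kr.basis_def Kr.fin_dim_def by blast
  qed
  then obtain B where B: "finite B" "Kr.basis B" using Kr.finite_basis_exists by blast
  then have "card B = 0" using Kr.dim_basis[of B] d0 by simp
  then have "B = {}" using B by simp
  then have "Kr.module.span {} = kerT" using B(2) unfolding Kr.basis_def by simp
  moreover have "Kr.module.span {} = {\<zero>\<^bsub>V\<^esub>}" 
    by (auto simp: Kr.module.span_def Kr.module.lincomb_def)
  ultimately show "carrier (V.vs kerT) = {\<zero>\<^bsub>V\<^esub>}" by simp
qed

text \<open>The image of a basis of \<open>V\<close> is independent in \<open>W\<close> and has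
  \<open>W.dim\<close> elements, so it is a basis of \<open>W\<close> inside the image.\<close>

lemma (in linear_map) inj_dim_eq_imp_surj:
  assumes "V.fin_dim" "W.fin_dim" "inj_on T (carrier V)" "W.dim = V.dim"
  shows "T ` carrier V = carrier W"
proof -
  obtain B where B: "finite B" "V.basis B" using V.finite_basis_exists[OF assms(1)] by blast
  then have BC: "B \<subseteq> carrier V" by (simp add: V.basis_def)
  have TB: "T ` B \<subseteq> carrier W" using BC by auto
  have sub: "submodule K (T ` carrier V) W"
    using im_is_submodule by (simp add: im_def)
  have "vectorspace K (W.vs imT)" 
    by (rule W.subspace_is_vs[OF imT_is_subspace])
  moreover have "T \<in> LinearCombinations.module_hom K V (W.vs imT)"
    using f_hom by (auto simp: LinearCombinations.module_hom_def im_def)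
  \<comment> \<open>Corestriction to the image makes the map onto, so that it carries bases to
    bases.\<close>
  ultimately interpret L: linear_map K V "W.vs imT" T
    by (intro linear_map.intro mod_hom.intro mod_hom_axioms.intro V.vectorspace_axioms) 
      (auto simp: vectorspace_def intro: V.module.module_axioms)
  have "L.W.basis (T ` B)"
    by (rule L.linear_inj_image_is_basis[OF assms(3) _ B(2) assms(1)]) (simp add: im_def)
  then have "\<not> L.W.module.lin_dep (T ` B)" by (simp add: L.W.basis_def)
  moreover have "T ` B \<subseteq> imT" using BC by (auto simp: im_def)
  ultimately have "\<not> W.module.lin_dep (T ` B)" 
    using W.module.span_li_not_depend(2)[OF _ im_is_submodule] by blast
  moreover have "card (T ` B) = W.dim"
    using V.dim_basis[OF B] assms(3,4) BC(1) by (metis card_image inj_on_subset)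
  ultimately have "W.basis (T ` B)"
    using W.dim_li_is_basis[OF assms(2) _ TB] B(1) by simp
  then have "W.module.span (T ` B) = carrier W" by (simp add: W.basis_def)
  moreover have "W.module.span (T ` B) \<subseteq> T ` carrier V"
    using BC sub by (intro W.module.span_is_subset) auto
  ultimately show ?thesis by auto
qed

section \<open>Regularity index of an eventually constant function\<close>

lemma hilbert_polynomial_eventually_const:
  assumes "\<And>i. i \<ge> N \<Longrightarrow> HF i = c"
  shows "hilbert_polynomial HF = [:of_nat c:]"
  unfolding hilbert_polynomial_def
proof (rule the_equality)
  show "\<forall>\<^sub>F i in at_top. rat_of_nat (HF i) = poly [:rat_of_nat c:] (rat_of_int i)"
    using eventually_ge_at_top[of N] by eventually_elim (simp add: assms)
next
  fix p :: "rat poly" assume "\<forall>\<^sub>F i in at_top. rat_of_nat (HF i) = poly p (rat_of_int i)"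
  then obtain M where M: "\<And>i. i \<ge> M \<Longrightarrow> rat_of_nat (HF i) = poly p (rat_of_int i)"
    by (auto simp: eventually_at_top_linorder)
  let ?q = "p - [:of_nat c:]"
  have "poly ?q (rat_of_int i) = 0" if "i \<ge> max M N" for i
    using that M[of i] assms[of i] by simp
  then have "rat_of_int ` {max M N..} \<subseteq> {x. poly ?q x = 0}" by auto
  moreover have "infinite (rat_of_int ` {max M N..})"
    by (subst finite_image_iff) (auto simp: inj_on_def infinite_Ici)
  ultimately have "?q = 0" using poly_roots_finite finite_subset by metis
  then show "p = [:of_nat c:]" by simp
qed

lemma regularity_index_eventually_const:
  assumes "\<And>i. i \<ge> N \<Longrightarrow> HF i = c"
  shows "regularity_index HF = 
    (if \<forall>j. HF j = c then Minf else Fin (LEAST i. \<forall>j\<ge>i. HF j = c))"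
proof -
  have "hilbert_polynomial HF = [:of_nat c:]"
    using hilbert_polynomial_eventually_const[of N HF c] assms by blast
  then show ?thesis by (simp add: regularity_index_def)
qed

text \<open>A degree \<open>j0\<close> where \<open>HF\<close> misses \<open>c\<close> bounds the
  admissible indices from below; only then is \<open>LEAST\<close> over the integers
  attained.\<close>

lemma regularity_index_le_iff:
  assumes "\<And>i. i \<ge> N \<Longrightarrow> HF i = c"
  shows "regularity_index HF \<le> Fin B \<longleftrightarrow> (\<forall>j\<ge>B. HF j = c)"
proof (cases "\<forall>j. HF j = c")
  case True
  then show ?thesis using regularity_index_eventually_const[of N HF c, OF assms] by simp
next
  case False
  then obtain j0 where j0: "HF j0 \<noteq> c" by blast
  let ?P = "\<lambda>i. \<forall>j\<ge>i. HF j = c"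
  have low: "i > j0" if "?P i" for i
    using that j0 by (meson not_le)
  \<comment> \<open>Distances from \<open>j0\<close> are natural numbers, so a smallest one exists;
    all admissible indices exceed \<open>j0\<close>, hence \<open>nat\<close> loses nothing.\<close>
  obtain i0 where i0: "?P i0" "\<And>i. ?P i \<Longrightarrow> nat (i0 - j0) \<le> nat (i - j0)"
    using ex_has_least_nat[of ?P N "\<lambda>i. nat (i - j0)"] assms by blast
  have "(LEAST i. ?P i) = i0"
  proof (rule Least_equality)
    fix i assume "?P i"
    then have "nat (i0 - j0) \<le> nat (i - j0)" "j0 < i" using i0(2) low by blast+
    then show "i0 \<le> i" by arith
  qed (rule i0(1))
  then have ri: "regularity_index HF = Fin i0"
    using regularity_index_eventually_const[of N HF c] assms False by simp
  show ?thesis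
  proof
    assume "\<forall>j\<ge>B. HF j = c"
    then have "?P B" .
    then have "nat (i0 - j0) \<le> nat (B - j0)" "j0 < B" using i0(2) low by blast+
    then have "i0 \<le> B" by arith
    then show "regularity_index HF \<le> Fin B" using ri by simp
  next
    assume "regularity_index HF \<le> Fin B"
    then show "\<forall>j\<ge>B. HF j = c" using i0(1) ri by auto
  qed
qed

text \<open>The smallest value taken from \<open>N\<close> on persists once it is reached.\<close>

lemma eventually_const_of_nonincreasing:
  fixes HF :: "int \<Rightarrow> nat"
  assumes "\<And>i. i \<ge> N \<Longrightarrow> HF (i + 1) \<le> HF i"
  obtains M c where "M \<ge> N" "\<And>i. i \<ge> M \<Longrightarrow> HF i = c"
proof -
  obtain M where M: "M \<ge> N" "\<And>i. i \<ge> N \<Longrightarrow> HF M \<le> HF i"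
    using ex_has_least_nat[of "\<lambda>i. i \<ge> N" N HF] by blast
  have "HF i \<le> HF M" if "i \<ge> M" for i
    using that by (induction i rule: int_ge_induct) 
      (use assms M(1) in \<open>auto intro: order.trans\<close>)
  then have "HF i = HF M" if "i \<ge> M" for i
    using that M by (simp add: order.antisym)
  then show ?thesis using that M(1) by blast
qed

section \<open>Graded modules with finitely many generators\<close>

context zero_dim
begin

abbreviation "R \<equiv> coord_ring n I"

definition cl :: "'k mpoly \<Rightarrow> 'k mpoly set" where
  "cl p = I +>\<^bsub>poly_ring n\<^esub> p"

lemma cring_R: "cring R"
  unfolding coord_ring_def by (rule ideal.quotient_is_cring[OF ideal_J cring_poly_ring])

lemma cl_hom: "cl \<in> Ring.ring_hom (poly_ring n) R"
  using ideal.rcos_ring_hom[OF ideal_J] unfolding coord_ring_def cl_def[abs_def] .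

lemma cl_closed [simp]: "p \<in> polys n \<Longrightarrow> cl p \<in> carrier R"
  using ring_hom_closed[OF cl_hom] by blast

lemma cl_add: "p \<in> polys n \<Longrightarrow> q \<in> polys n \<Longrightarrow> cl (p + q) = cl p \<oplus>\<^bsub>R\<^esub> cl q"
  using ring_hom_add[OF cl_hom] by simp

lemma cl_mult: "p \<in> polys n \<Longrightarrow> q \<in> polys n \<Longrightarrow> cl (p * q) = cl p \<otimes>\<^bsub>R\<^esub> cl q"
  using ring_hom_mult[OF cl_hom] by simp

lemma cl_1: "cl 1 = \<one>\<^bsub>R\<^esub>"
  using ring_hom_one[OF cl_hom] by simp

lemma cl_0: "cl 0 = \<zero>\<^bsub>R\<^esub>"
  using ring_hom_zero[OF cl_hom cring.axioms(1)[OF cring_poly_ring] cring.axioms(1)[OF cring_R]] by simp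

lemma cl_eq_iff: 
  assumes "p \<in> polys n" "q \<in> polys n" shows "cl p = cl q \<longleftrightarrow> p - q \<in> I"
proof -
  interpret P: cring "poly_ring n :: 'k mpoly ring" by (rule cring_poly_ring)
  show ?thesis using P.quotient_eq_iff_same_a_r_cos[OF ideal_J assms] assms
    by (simp add: cl_def a_minus_def)
qed

lemma cl_eq_0_iff: "p \<in> polys n \<Longrightarrow> cl p = \<zero>\<^bsub>R\<^esub> \<longleftrightarrow> p \<in> I"
  using cl_eq_iff[of p 0] by (simp add: cl_0)

lemma carrier_R: "carrier R = cl ` polys n"
  by (auto simp: coord_ring_def FactRing_def A_RCOSETS_def' cl_def)

definition rep :: "'k mpoly set \<Rightarrow> 'k mpoly" where
  "rep r = (SOME p. p \<in> polys n \<and> cl p = r)"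

lemma rep_polys [simp]: "r \<in> carrier R \<Longrightarrow> rep r \<in> polys n"
  and cl_rep [simp]: "r \<in> carrier R \<Longrightarrow> cl (rep r) = r"
proof -
  assume "r \<in> carrier R"
  then have "\<exists>p. p \<in> polys n \<and> cl p = r" by (auto simp: carrier_R)
  from someI_ex[OF this] show "rep r \<in> polys n" "cl (rep r) = r" by (simp_all add: rep_def)
qed

lemma coord_map_cl: "coord_map n I c = cl (Poly_Mapping.single 0 c)"
  by (simp add: coord_map_def cl_def)

lemma cl_const_add: "cl (Poly_Mapping.single 0 (a + b)) = 
    cl (Poly_Mapping.single 0 a) \<oplus>\<^bsub>R\<^esub> cl (Poly_Mapping.single 0 b)"
  by (simp add: cl_add[symmetric] single_add)

lemma cl_const_mult: "cl (Poly_Mapping.single 0 (a * b)) = 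
    cl (Poly_Mapping.single 0 a) \<otimes>\<^bsub>R\<^esub> cl (Poly_Mapping.single 0 b)"
  by (simp add: cl_mult[symmetric] mult_single)

lemma coord_grading_cl: "coord_grading n I d = cl ` homog_part n d"
  by (simp add: coord_grading_def cl_def[abs_def])

definition monoms :: "int \<Rightarrow> (nat \<Rightarrow>\<^sub>0 nat) set" where
  "monoms e = {t. Poly_Mapping.keys t \<subseteq> {..n} \<and> int (tdeg t) = e}"

lemma finite_monoms: "finite (monoms e)"
proof -
  let ?f = "\<lambda>t. restrict (Poly_Mapping.lookup t) {..n}"
  have "?f ` monoms e \<subseteq> PiE {..n} (\<lambda>_. {..nat e})"
  proof
    fix g assume "g \<in> ?f ` monoms e"
    then obtain t where t: "g = ?f t" "t \<in> monoms e" by blast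
    have "Poly_Mapping.lookup t i \<le> nat e" if "i \<le> n" for i
    proof -
      have "Poly_Mapping.lookup t i \<le> (\<Sum>i\<le>n. Poly_Mapping.lookup t i)"
        using that by (intro member_le_sum) auto
      also have "\<dots> = tdeg t" 
        using t by (subst tdeg_superset[of "{..n}"]) (auto simp: monoms_def)
      also have "\<dots> = nat e" using t by (auto simp: monoms_def)
      finally show ?thesis .
    qed
    then show "g \<in> PiE {..n} (\<lambda>_. {..nat e})" using t by auto
  qed
  moreover have "inj_on ?f (monoms e)"
  proof (rule inj_onI)
    fix s t assume st: "s \<in> monoms e" "t \<in> monoms e" "?f s = ?f t"
    show "s = t"
    proof (rule poly_mapping_eqI)
      fix i
      show "Poly_Mapping.lookup s i = Poly_Mapping.lookup t i"
      proof (cases "i \<le> n")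
        case True
        then show ?thesis using fun_cong[OF st(3), of i] by simp
      next
        case False
        then have "i \<notin> Poly_Mapping.keys s" "i \<notin> Poly_Mapping.keys t"
          using st by (auto simp: monoms_def)
        then show ?thesis by (simp add: in_keys_iff)
      qed
    qed
  qed
  ultimately show ?thesis
    by (meson finite_PiE finite_atMost finite_imageD finite_subset)
qed

lemma homog_part_monoms: "p \<in> homog_part n e \<longleftrightarrow> Poly_Mapping.keys p \<subseteq> monoms e"
  by (auto simp: homog_part_iff polys_iff homog_def monoms_def)

lemma homog_part_0 [simp]: "0 \<in> homog_part n e"
  by (simp add: homog_part_iff)

end

section \<open>Multiplication by x_0 on the graded pieces of a module\<close>

locale fg_module = zero_dim n I + M?: Module.module "coord_ring n I" M
  for n and I :: "'k::field mpoly set" and M :: "('k mpoly set, 'm) module" +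
  fixes Js :: "'j set" and b :: "'j \<Rightarrow> 'm"
  assumes finite_Js: "finite Js" and b_closed [simp]: "j \<in> Js \<Longrightarrow> b j \<in> carrier M"
begin

definition mu :: "('j \<Rightarrow> 'k mpoly) \<Rightarrow> 'm" where
  "mu c = (\<Oplus>\<^bsub>M\<^esub>j\<in>Js. cl (c j) \<odot>\<^bsub>M\<^esub> b j)"

text \<open>The index \<open>e\<close> is the degree of the coefficients, as if every
  \<open>b j\<close> had degree 0. The true degree is recovered by a shift: 0 for R, 1 for Omega^1,
  m for Omega^m.\<close>

definition comp :: "int \<Rightarrow> 'm set" where
  "comp e = mu ` {c. \<forall>j\<in>Js. c j \<in> homog_part n e}"

lemma mu_closed [simp]: "(\<And>j. j \<in> Js \<Longrightarrow> c j \<in> polys n) \<Longrightarrow> mu c \<in> carrier M"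
  unfolding mu_def by (intro M.finsum_closed) auto

lemma mu_cong:
  assumes "\<And>j. j \<in> Js \<Longrightarrow> c j \<in> polys n" "\<And>j. j \<in> Js \<Longrightarrow> c' j \<in> polys n"
    "\<And>j. j \<in> Js \<Longrightarrow> c j - c' j \<in> I"
  shows "mu c = mu c'"
proof -
  have "cl (c j) = cl (c' j)" if "j \<in> Js" for j
    using assms[OF that] cl_eq_iff by blast
  then show ?thesis unfolding mu_def using assms(2) by (intro M.finsum_cong') auto
qed

lemma mu_add:
  assumes "\<And>j. j \<in> Js \<Longrightarrow> c j \<in> polys n" "\<And>j. j \<in> Js \<Longrightarrow> c' j \<in> polys n"
  shows "mu (\<lambda>j. c j + c' j) = mu c \<oplus>\<^bsub>M\<^esub> mu c'"
proof -
  have "mu (\<lambda>j. c j + c' j) = (\<Oplus>\<^bsub>M\<^esub>j\<in>Js. cl (c j) \<odot>\<^bsub>M\<^esub> b j \<oplus>\<^bsub>M\<^esub> cl (c' j) \<odot>\<^bsub>M\<^esub> b j)"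
    unfolding mu_def using assms
    by (intro M.finsum_cong') (auto simp: cl_add M.smult_l_distr)
  also have "\<dots> = mu c \<oplus>\<^bsub>M\<^esub> mu c'"
    unfolding mu_def using assms by (intro M.finsum_addf) auto
  finally show ?thesis .
qed

lemma mu_smult:
  assumes "\<And>j. j \<in> Js \<Longrightarrow> c j \<in> polys n" "p \<in> polys n"
  shows "mu (\<lambda>j. p * c j) = cl p \<odot>\<^bsub>M\<^esub> mu c"
proof -
  have "cl p \<odot>\<^bsub>M\<^esub> mu c = (\<Oplus>\<^bsub>M\<^esub>j\<in>Js. cl p \<odot>\<^bsub>M\<^esub> (cl (c j) \<odot>\<^bsub>M\<^esub> b j))"
    unfolding mu_def using assms by (intro M.finsum_smult_ldistr[OF finite_Js]) auto
  also have "\<dots> = mu (\<lambda>j. p * c j)"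
    unfolding mu_def using assms
    by (intro M.finsum_cong') (auto simp: cl_mult M.smult_assoc1)
  finally show ?thesis by simp
qed

lemma mu_0 [simp]: "mu (\<lambda>_. 0) = \<zero>\<^bsub>M\<^esub>"
  unfolding mu_def by (intro M.finsum_all0) (auto simp: cl_0)

lemma mu_eq_0I: "(\<And>j. j \<in> Js \<Longrightarrow> c j \<in> I) \<Longrightarrow> mu c = \<zero>\<^bsub>M\<^esub>"
  using mu_cong[of c "\<lambda>_. 0"] J_polys by simp

lemma mu_diff:
  assumes "\<And>j. j \<in> Js \<Longrightarrow> c j \<in> polys n" "\<And>j. j \<in> Js \<Longrightarrow> c' j \<in> polys n"
  shows "mu (\<lambda>j. c j - c' j) = mu c \<ominus>\<^bsub>M\<^esub> mu c'"
proof -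
  have "mu (\<lambda>j. c j - c' j) \<oplus>\<^bsub>M\<^esub> mu c' = mu c"
    using mu_add[of "\<lambda>j. c j - c' j" c'] assms by simp
  then show ?thesis using assms mu_closed
    by (metis (no_types, lifting) M.add.inv_solve_right' M.minus_eq polys_diff)
qed

lemma mu_single:
  assumes "j \<in> Js" "p \<in> polys n" 
  shows "mu (\<lambda>i. if i = j then p else 0) = cl p \<odot>\<^bsub>M\<^esub> b j"
proof -
  have "mu (\<lambda>i. if i = j then p else 0) = (\<Oplus>\<^bsub>M\<^esub>i\<in>Js. if j = i then cl p \<odot>\<^bsub>M\<^esub> b i else \<zero>\<^bsub>M\<^esub>)"
    unfolding mu_def using assms by (intro M.finsum_cong') (auto simp: cl_0)
  also have "\<dots> = cl p \<odot>\<^bsub>M\<^esub> b j"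
    using assms finite_Js by (intro M.finsum_singleton) auto
  finally show ?thesis .
qed

lemma compI: "(\<And>j. j \<in> Js \<Longrightarrow> c j \<in> homog_part n e) \<Longrightarrow> mu c \<in> comp e"
  unfolding comp_def by blast

lemma comp_closed: "w \<in> comp e \<Longrightarrow> w \<in> carrier M"
  unfolding comp_def by (auto simp: homog_part_iff)

lemma comp_0 [simp]: "\<zero>\<^bsub>M\<^esub> \<in> comp e"
  using compI[of "\<lambda>_. 0"] by simp

lemma comp_add: 
  assumes "v \<in> comp e" "w \<in> comp e" shows "v \<oplus>\<^bsub>M\<^esub> w \<in> comp e"
proof -
  obtain c c' where "v = mu c" "w = mu c'" "\<forall>j\<in>Js. c j \<in> homog_part n e" "\<forall>j\<in>Js. c' j \<in> homog_part n e"
    using assms unfolding comp_def by blast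
  then show ?thesis
    by (auto simp: mu_add[symmetric] homog_part_iff intro!: compI)
qed

lemma comp_smult: 
  assumes "p \<in> homog_part n d" "w \<in> comp e" "d + e = f" shows "cl p \<odot>\<^bsub>M\<^esub> w \<in> comp f"
proof -
  obtain c where "w = mu c" "\<forall>j\<in>Js. c j \<in> homog_part n e"
    using assms unfolding comp_def by blast
  then show ?thesis using assms
    by (auto simp: mu_smult[symmetric] homog_part_iff homog_mult intro!: compI)
qed

abbreviation "W \<equiv> restrict_scalars (coord_map n I) M"

lemma W_module: "Module.module (class_ring :: 'k ring) W"
proof (rule Module.moduleI)
  show "cring (class_ring :: 'k ring)" ..
  show "abelian_group W"
  proof (rule abelian_groupI)
    fix x assume "x \<in> carrier W"
    then show "\<exists>y\<in>carrier W. y \<oplus>\<^bsub>W\<^esub> x = \<zero>\<^bsub>W\<^esub>"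
      by (intro bexI[of _ "\<ominus>\<^bsub>M\<^esub> x"]) (simp_all add: restrict_scalars_def M.l_neg)
  qed (auto simp: restrict_scalars_def M.a_ac)
qed (auto simp: restrict_scalars_def coord_map_cl M.smult_l_distr M.smult_r_distr
    cl_const_add cl_const_mult M.smult_assoc1 cl_1)

sublocale W: vectorspace "class_ring :: 'k ring" W
  by (intro vectorspace.intro W_module class_field)

lemma W_simps [simp]:
  "carrier W = carrier M" "zero W = zero M" "add W = add M" 
  "smult W c x = cl (Poly_Mapping.single 0 c) \<odot>\<^bsub>M\<^esub> x"
  by (simp_all add: restrict_scalars_def coord_map_cl)

lemma comp_submodule: "submodule class_ring (comp e) W"
proof (rule LinearCombinations.submodule.intro[OF W_module])
  show "comp e \<subseteq> carrier W" using comp_closed by auto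
  fix c :: 'k and v assume "v \<in> comp e"
  then have "cl (Poly_Mapping.single 0 c) \<odot>\<^bsub>M\<^esub> v \<in> comp e"
    by (rule comp_smult[where d = 0, rotated]) (auto simp: homog_part_iff)
  then show "c \<odot>\<^bsub>W\<^esub> v \<in> comp e" by simp
qed (auto intro: comp_add)

abbreviation "V e \<equiv> W\<lparr>carrier := comp e\<rparr>"

lemma V_vectorspace: "vectorspace (class_ring :: 'k ring) (V e)"
  by (rule W.subspace_is_vs) (simp add: subspace_def comp_submodule W.vectorspace_axioms)

lemma submodule_finsum:
  assumes N: "submodule class_ring N W" and "finite A" "\<And>a. a \<in> A \<Longrightarrow> f a \<in> N"
  shows "(\<Oplus>\<^bsub>M\<^esub>a\<in>A. f a) \<in> N"
  using assms(2,3)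
proof (induction A rule: finite_induct)
  case empty
  then show ?case using LinearCombinations.submodule.zero_closed[OF N] by simp
next
  case (insert a A)
  have "f x \<in> carrier M" if "x \<in> insert a A" for x
    using LinearCombinations.submodule.subset[OF N] insert.prems[OF that] by auto
  then show ?case using insert LinearCombinations.submodule.m_closed[OF N]
    by (subst M.finsum_insert) auto
qed

text \<open>The finitely many products of a monomial of degree \<open>e\<close> with a generator
  span the piece.\<close>

lemma V_fin_dim: "vectorspace.fin_dim (class_ring :: 'k ring) (V e)"
proof -
  let ?A = "(\<lambda>(t, j). cl (Poly_Mapping.single t 1) \<odot>\<^bsub>M\<^esub> b j) ` (monoms e \<times> Js)"
  have fin: "finite ?A" using finite_monoms finite_Js by blast
  have AV: "?A \<subseteq> comp e"
  proof
    fix a assume "a \<in> ?A"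
    then obtain t j where tj: "t \<in> monoms e" "j \<in> Js" "a = cl (Poly_Mapping.single t 1) \<odot>\<^bsub>M\<^esub> b j" by auto
    then have "Poly_Mapping.single t (1::'k) \<in> homog_part n e"
      by (simp add: homog_part_monoms)
    then show "a \<in> comp e" 
      unfolding tj(3) using tj(2) by (subst mu_single[symmetric]) (auto simp: homog_part_iff intro!: compI)
  qed
  then have AW: "?A \<subseteq> carrier W" using comp_closed by auto
  have sp: "submodule class_ring (W.span ?A) W" by (rule W.module.span_is_submodule[OF AW])
  have 1: "cl (\<Sum>t\<in>T. Poly_Mapping.single t (f t)) \<odot>\<^bsub>M\<^esub> b j \<in> W.span ?A" 
    if "finite T" "T \<subseteq> monoms e" "j \<in> Js" for T f j
    using that(1,2)
  proof (induction T rule: finite_induct)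
    case empty
    then show ?case using LinearCombinations.submodule.zero_closed[OF sp] that(3) by (simp add: cl_0)
  next
    case (insert t T)
    have pt: "Poly_Mapping.single s c \<in> polys n" if "s \<in> insert t T" for s and c :: 'k
      using that insert.prems by (intro polys_single) (auto simp: monoms_def)
    have "f t \<odot>\<^bsub>W\<^esub> (cl (Poly_Mapping.single t 1) \<odot>\<^bsub>M\<^esub> b j) \<in> W.span ?A"
    proof (rule LinearCombinations.submodule.smult_closed[OF sp])
      show "cl (Poly_Mapping.single t 1) \<odot>\<^bsub>M\<^esub> b j \<in> W.span ?A"
        using W.module.in_own_span[OF AW] insert.prems that(3) by blast
    qed simp
    also have "f t \<odot>\<^bsub>W\<^esub> (cl (Poly_Mapping.single t 1) \<odot>\<^bsub>M\<^esub> b j) = cl (Poly_Mapping.single t (f t)) \<odot>\<^bsub>M\<^esub> b j"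
      using that(3) pt by (simp add: M.smult_assoc1[symmetric] cl_mult[symmetric] mult_single)
    finally have "cl (Poly_Mapping.single t (f t)) \<odot>\<^bsub>M\<^esub> b j \<oplus>\<^bsub>W\<^esub> cl (\<Sum>t\<in>T. Poly_Mapping.single t (f t)) \<odot>\<^bsub>M\<^esub> b j \<in> W.span ?A"
      using insert by (intro LinearCombinations.submodule.m_closed[OF sp]) auto
    then show ?case using insert pt that(3) by (simp add: cl_add M.smult_l_distr)
  qed
  have "comp e \<subseteq> W.span ?A"
  proof
    fix w assume "w \<in> comp e"
    then obtain c where c: "w = mu c" "\<And>j. j \<in> Js \<Longrightarrow> c j \<in> homog_part n e"
      unfolding comp_def by blast
    have "cl (c j) \<odot>\<^bsub>M\<^esub> b j \<in> W.span ?A" if "j \<in> Js" for j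
    proof -
      have "Poly_Mapping.keys (c j) \<subseteq> monoms e" using c(2)[OF that] by (simp add: homog_part_monoms)
      from 1[OF finite_keys this that, of "Poly_Mapping.lookup (c j)"] show ?thesis 
        unfolding single_decomp[symmetric] .
    qed
    then show "w \<in> W.span ?A" 
      unfolding c(1) mu_def by (intro submodule_finsum[OF sp finite_Js]) auto
  qed
  moreover have "W.span ?A \<subseteq> comp e"
    by (rule W.module.span_is_subset[OF AV comp_submodule])
  moreover have "LinearCombinations.module.span class_ring (V e) ?A = W.span ?A"
    by (rule W.module.span_li_not_depend(1)[OF AV comp_submodule])
  ultimately show ?thesis 
    unfolding vectorspace.fin_dim_def[OF V_vectorspace] using fin AV by auto
qed

lemma X0_linear_map: "linear_map (class_ring :: 'k ring) (V e) (V (e + 1)) (\<lambda>w. cl X0 \<odot>\<^bsub>M\<^esub> w)"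
proof (intro linear_map.intro mod_hom.intro mod_hom_axioms.intro V_vectorspace)
  have "Module.module (class_ring :: 'k ring) (V d)" for d
    using V_vectorspace by (simp add: vectorspace_def)
  then show "Module.module (class_ring :: 'k ring) (V e)" 
    "Module.module (class_ring :: 'k ring) (V (e + 1))" by blast+
  have X: "X0 \<in> homog_part n 1" by (simp add: homog_part_iff)
  show "(\<lambda>w. cl X0 \<odot>\<^bsub>M\<^esub> w) \<in> LinearCombinations.module_hom class_ring (V e) (V (e + 1))"
    unfolding LinearCombinations.module_hom_def
    using comp_closed comp_smult[OF X]
    by (auto simp: M.smult_r_distr M.smult_assoc1[symmetric] cl_mult[symmetric] mult.commute)
qed

definition hf :: "int \<Rightarrow> nat" where
  "hf e = vectorspace.dim (class_ring :: 'k ring) (V e)"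

text \<open>If R_{e+1} = x_0 R_e, the coefficients of an element can be divided by x_0 one by
  one.\<close>

lemma X0_surj:
  assumes "\<forall>p\<in>homog_part n (e + 1). \<exists>q\<in>homog_part n e. p - X0 * q \<in> I"
  shows "(\<lambda>w. cl X0 \<odot>\<^bsub>M\<^esub> w) ` comp e = comp (e + 1)"
proof
  have X: "X0 \<in> homog_part n 1" by (simp add: homog_part_iff)
  show "(\<lambda>w. cl X0 \<odot>\<^bsub>M\<^esub> w) ` comp e \<subseteq> comp (e + 1)"
    using comp_smult[OF X] by auto
  show "comp (e + 1) \<subseteq> (\<lambda>w. cl X0 \<odot>\<^bsub>M\<^esub> w) ` comp e"
  proof
    fix w assume "w \<in> comp (e + 1)"
    then obtain c where c: "w = mu c" "\<And>j. j \<in> Js \<Longrightarrow> c j \<in> homog_part n (e + 1)"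
      unfolding comp_def by blast
    then have "\<forall>j\<in>Js. \<exists>q. q \<in> homog_part n e \<and> c j - X0 * q \<in> I"
      using assms by blast
    then obtain q where q: "\<And>j. j \<in> Js \<Longrightarrow> q j \<in> homog_part n e \<and> c j - X0 * q j \<in> I"
      using bchoice[of Js] by meson
    have "w = mu (\<lambda>j. X0 * q j)"
      unfolding c(1) using c(2) q by (intro mu_cong) (auto simp: homog_part_iff)
    also have "\<dots> = cl X0 \<odot>\<^bsub>M\<^esub> mu q"
      using q by (intro mu_smult) (auto simp: homog_part_iff)
    finally show "w \<in> (\<lambda>w. cl X0 \<odot>\<^bsub>M\<^esub> w) ` comp e"
      using compI[of q e] q by blast
  qed
qed

text \<open>Multiplication by x_0 from degree \<open>e\<close> to \<open>e + 1\<close> is onto here,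
  so dimensions cannot grow, and equality of dimensions amounts to injectivity.\<close>

lemma
  assumes "\<forall>p\<in>homog_part n (e + 1). \<exists>q\<in>homog_part n e. p - X0 * q \<in> I"
  shows hf_nonincreasing: "hf (e + 1) \<le> hf e"
    and X0_inj: "hf (e + 1) = hf e \<Longrightarrow> w \<in> comp e \<Longrightarrow> cl X0 \<odot>\<^bsub>M\<^esub> w = \<zero>\<^bsub>M\<^esub> \<Longrightarrow> w = \<zero>\<^bsub>M\<^esub>"
    and hf_eq_of_inj: "(\<And>w. w \<in> comp e \<Longrightarrow> cl X0 \<odot>\<^bsub>M\<^esub> w = \<zero>\<^bsub>M\<^esub> \<Longrightarrow> w = \<zero>\<^bsub>M\<^esub>) \<Longrightarrow> hf (e + 1) = hf e"
proof -
  interpret L: linear_map "class_ring :: 'k ring" "V e" "V (e + 1)" "\<lambda>w. cl X0 \<odot>\<^bsub>M\<^esub> w"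
    by (rule X0_linear_map)
  have surj: "(\<lambda>w. cl X0 \<odot>\<^bsub>M\<^esub> w) ` carrier (V e) = carrier (V (e + 1))"
    using X0_surj[OF assms] by simp
  show "hf (e + 1) \<le> hf e"
    unfolding hf_def by (rule L.surj_dim_le[OF V_fin_dim surj])
  show "w = \<zero>\<^bsub>M\<^esub>" if "hf (e + 1) = hf e" "w \<in> comp e" "cl X0 \<odot>\<^bsub>M\<^esub> w = \<zero>\<^bsub>M\<^esub>"
    using L.surj_dim_eq_imp_inj[OF V_fin_dim surj] that 
    unfolding L.inj_on_iff_trivial_kernel hf_def by simp
  show "hf (e + 1) = hf e" if "\<And>w. w \<in> comp e \<Longrightarrow> cl X0 \<odot>\<^bsub>M\<^esub> w = \<zero>\<^bsub>M\<^esub> \<Longrightarrow> w = \<zero>\<^bsub>M\<^esub>"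
  proof -
    have "inj_on (\<lambda>w. cl X0 \<odot>\<^bsub>M\<^esub> w) (carrier (V e))"
      unfolding L.inj_on_iff_trivial_kernel using that by simp
    then show ?thesis unfolding hf_def by (rule L.dim_eq[OF V_fin_dim _ surj, symmetric])
  qed
qed

text \<open>The opposite direction, for R itself: there injectivity is known in all degrees and
  divisibility is wanted.\<close>

lemma X0_surj_of_inj:
  assumes "\<And>w. w \<in> comp e \<Longrightarrow> cl X0 \<odot>\<^bsub>M\<^esub> w = \<zero>\<^bsub>M\<^esub> \<Longrightarrow> w = \<zero>\<^bsub>M\<^esub>" "hf (e + 1) = hf e" 
  shows "(\<lambda>w. cl X0 \<odot>\<^bsub>M\<^esub> w) ` comp e = comp (e + 1)"
proof -
  interpret L: linear_map "class_ring :: 'k ring" "V e" "V (e + 1)" "\<lambda>w. cl X0 \<odot>\<^bsub>M\<^esub> w"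
    by (rule X0_linear_map)
  show ?thesis
    using L.inj_dim_eq_imp_surj[OF V_fin_dim V_fin_dim] assms
    unfolding L.inj_on_iff_trivial_kernel hf_def by simp
qed

lemma hilbert_function_hf: "hilbert_function base_field (coord_map n I) M (\<lambda>d. comp (d - m)) = (\<lambda>d. hf (d - m))"
  by (simp add: hilbert_function_def hf_def fun_eq_iff)

end

section \<open>The coordinate ring\<close>

sublocale zero_dim \<subseteq> R: cring "coord_ring n I"
  by (rule cring_R)

context zero_dim
begin

lemma regular_module_module: "Module.module R (regular_module R)"
proof -
  show ?thesis
  proof (rule Module.moduleI)
    show "abelian_group (regular_module R)"
    proof (rule abelian_groupI)
      fix x assume "x \<in> carrier (regular_module R)"
      then show "\<exists>y\<in>carrier (regular_module R). y \<oplus>\<^bsub>regular_module R\<^esub> x = \<zero>\<^bsub>regular_module R\<^esub>"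
        by (intro bexI[of _ "\<ominus>\<^bsub>R\<^esub> x"]) (simp_all add: regular_module_def R.l_neg)
    qed (auto simp: regular_module_def R.a_ac)
  qed (auto simp: regular_module_def R.l_distr R.r_distr R.m_assoc intro: cring_R)
qed

sublocale Rm: fg_module n I "regular_module R" "{()}" "\<lambda>_. \<one>\<^bsub>R\<^esub>"
proof -
  show "fg_module n I (regular_module R) {()} (\<lambda>_. \<one>\<^bsub>R\<^esub>)"
    by (intro fg_module.intro zero_dim_axioms regular_module_module fg_module_axioms.intro)
      (auto simp: regular_module_def)
qed

lemma regular_simps [simp]:
  "carrier (regular_module R) = carrier R" "zero (regular_module R) = zero R" 
  "add (regular_module R) = add R" "smult (regular_module R) = mult R"
  by (simp_all add: regular_module_def)

lemma Rm_mu: "p \<in> polys n \<Longrightarrow> Rm.mu (\<lambda>_. p) = cl p"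
proof -
  assume p: "p \<in> polys n"
  have "Rm.mu (\<lambda>_. p) = Rm.mu (\<lambda>i. if i = () then p else 0)" by simp
  also have "\<dots> = cl p" using p by (subst Rm.mu_single) auto
  finally show ?thesis .
qed

lemma Rm_comp: "Rm.comp e = cl ` homog_part n e"
proof -
  have "Rm.mu c = cl (c ())" if "c () \<in> homog_part n e" for c
  proof -
    have "(\<lambda>_. c ()) = c" by (simp add: fun_eq_iff)
    then show ?thesis using Rm_mu[of "c ()"] that by (simp add: homog_part_iff)
  qed
  then show ?thesis unfolding Rm.comp_def by force
qed

lemma ri_coord_ring_hf: "ri_coord_ring n I = regularity_index Rm.hf"
proof -
  have "coord_grading n I = Rm.comp" by (simp add: fun_eq_iff coord_grading_cl Rm_comp)
  then show ?thesis using Rm.hilbert_function_hf[of 0] by (simp add: ri_coord_ring_def)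
qed

lemma X0_cancel_cl: 
  assumes "\<And>p. p \<in> homog_part n e \<Longrightarrow> X0 * p \<in> I \<Longrightarrow> p \<in> I" 
    "w \<in> Rm.comp e" "cl X0 \<odot>\<^bsub>regular_module R\<^esub> w = \<zero>\<^bsub>regular_module R\<^esub>" 
  shows "w = \<zero>\<^bsub>regular_module R\<^esub>"
proof -
  obtain p where p: "p \<in> homog_part n e" "w = cl p" using assms(2) by (auto simp: Rm_comp)
  then have "X0 * p \<in> I" 
    using assms(3) by (simp add: homog_part_iff cl_mult[symmetric] cl_eq_0_iff)
  then show ?thesis using assms(1) p by (simp add: cl_eq_0_iff homog_part_iff)
qed

lemma X0_eventually_cancel:
  obtains M c where "\<And>e p. e \<ge> M \<Longrightarrow> p \<in> homog_part n e \<Longrightarrow> X0 * p \<in> I \<Longrightarrow> p \<in> I"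
    "\<And>e. e \<ge> M \<Longrightarrow> Rm.hf e = c"
proof -
  obtain N where N: "\<And>d p. d \<ge> N \<Longrightarrow> p \<in> homog_part n d \<Longrightarrow> \<exists>q\<in>homog_part n (d - 1). p - X0 * q \<in> I"
    using high_degree_divisible by blast
  have div: "\<forall>p\<in>homog_part n (e + 1). \<exists>q\<in>homog_part n e. p - X0 * q \<in> I" if "e \<ge> N" for e
    using N[of "e + 1"] that by simp
  obtain M c where M: "M \<ge> N" "\<And>e. e \<ge> M \<Longrightarrow> Rm.hf e = c"
    using eventually_const_of_nonincreasing[of N Rm.hf] Rm.hf_nonincreasing[OF div] by blast
  have "p \<in> I" if "e \<ge> M" "p \<in> homog_part n e" "X0 * p \<in> I" for e p
  proof -
    have "e \<ge> N" using that M by simp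
    have "cl X0 \<odot>\<^bsub>regular_module R\<^esub> cl p = \<zero>\<^bsub>regular_module R\<^esub>"
      using that by (simp add: homog_part_iff cl_mult[symmetric] cl_eq_0_iff)
    then have "cl p = \<zero>\<^bsub>regular_module R\<^esub>"
      using Rm.X0_inj[OF div[OF \<open>e \<ge> N\<close>], of "cl p"] that M by (simp add: Rm_comp)
    then show ?thesis using that by (simp add: cl_eq_0_iff homog_part_iff)
  qed
  then show ?thesis using that M by blast
qed

text \<open>Multiplied by a suitable power of any X_i, \<open>f\<close> reaches the degrees where
  cancellation is known; saturation then brings \<open>f\<close> itself into I.\<close>

lemma X0_cancel: 
  assumes f: "f \<in> homog_part n d" "X0 * f \<in> I" 
  shows "f \<in> I"
proof -
  obtain M c where M: "\<And>e p. e \<ge> M \<Longrightarrow> p \<in> homog_part n e \<Longrightarrow> X0 * p \<in> I \<Longrightarrow> p \<in> I"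
    using X0_eventually_cancel by metis
  have "\<exists>k. indet i ^ k * f \<in> I" if "i \<le> n" for i
  proof (intro exI)
    \<comment> \<open>This exponent lifts the degree of \<open>f\<close> to at least
      \<open>M\<close>; \<open>nat\<close> truncates to 0 when \<open>d\<close> is already
      there.\<close>
    let ?k = "nat (M - d)"
    have "homog (int ?k) (indet i ^ ?k :: 'k mpoly)" 
      using homog_power[OF homog_indet[of i], where k = ?k] by simp
    then have "homog (int ?k + d) (indet i ^ ?k * f)"
      by (rule homog_mult) (use f in \<open>simp add: homog_part_iff\<close>)
    then have "indet i ^ ?k * f \<in> homog_part n (int ?k + d)"
      using f that by (simp add: homog_part_iff)
    moreover have "indet i ^ ?k * (X0 * f) \<in> I"
      by (rule J_mult[OF _ f(2)]) (use that in simp)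
    then have "X0 * (indet i ^ ?k * f) \<in> I" by (simp only: mult.left_commute)
    ultimately show "indet i ^ ?k * f \<in> I" using M[of "int ?k + d"] by auto
  qed
  then show ?thesis using saturated_I f by (simp add: homog_part_iff)
qed

text \<open>Multiplication by x_0 is injective on R in every degree, so equal consecutive values of
  the Hilbert function already give R_{e+1} = x_0 R_e, not only in large degrees.\<close>

lemma ri_coord_ring_divisible:
  obtains r where "ri_coord_ring n I = Fin r"
    "\<And>e. e \<ge> r \<Longrightarrow> \<forall>p\<in>homog_part n (e + 1). \<exists>q\<in>homog_part n e. p - X0 * q \<in> I"
proof -
  obtain M c where M: "\<And>e. e \<ge> M \<Longrightarrow> Rm.hf e = c" using X0_eventually_cancel by metis
  have div: "\<forall>p\<in>homog_part n (e + 1). \<exists>q\<in>homog_part n e. p - X0 * q \<in> I" 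
    if "Rm.hf (e + 1) = Rm.hf e" for e
  proof
    fix p :: "'k mpoly" assume p: "p \<in> homog_part n (e + 1)"
    have "(\<lambda>w. cl X0 \<odot>\<^bsub>regular_module R\<^esub> w) ` Rm.comp e = Rm.comp (e + 1)"
      by (rule Rm.X0_surj_of_inj[OF X0_cancel_cl that]) (auto intro: X0_cancel)
    moreover have "cl p \<in> Rm.comp (e + 1)" using p by (simp add: Rm_comp)
    ultimately obtain w where "w \<in> Rm.comp e" "cl p = cl X0 \<odot>\<^bsub>regular_module R\<^esub> w" by blast
    then obtain q where "q \<in> homog_part n e" "cl p = cl (X0 * q)"
      by (auto simp: Rm_comp homog_part_iff cl_mult)
    then show "\<exists>q\<in>homog_part n e. p - X0 * q \<in> I" 
      using p by (auto simp: homog_part_iff cl_eq_iff)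
  qed
  \<comment> \<open>A Hilbert function constant in all degrees would give R_0 = x_0 R_{-1} = 0,
    contrary to 1 not being in I. So the regularity index is finite.\<close>
  have "\<exists>j. Rm.hf j \<noteq> c"
  proof (rule ccontr)
    assume "\<not> ?thesis"
    then have "Rm.hf (-1 + 1) = Rm.hf (-1)" by simp
    from div[OF this] have "\<exists>q\<in>homog_part n (-1). 1 - X0 * q \<in> I" by (simp add: homog_part_iff)
    then obtain q where "homog (-1) q" "1 - X0 * q \<in> I" by (auto simp: homog_part_iff)
    then have "1 \<in> I" using homog_neg[of "-1" q] by simp
    then show False using one_notin_I by blast
  qed
  then obtain r where r: "ri_coord_ring n I = Fin r"
    using regularity_index_eventually_const[of M Rm.hf c] M unfolding ri_coord_ring_hf by auto
  then have "\<forall>j\<ge>r. Rm.hf j = c"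
    using regularity_index_le_iff[of M Rm.hf c r] M unfolding ri_coord_ring_hf by auto
  then have "Rm.hf (e + 1) = Rm.hf e" if "e \<ge> r" for e using that by simp
  then show ?thesis using that r div by blast
qed

end

section \<open>Free modules and quotients\<close>

context cring
begin

lemma free_module_simps:
  "carrier (free_module R B) = {f \<in> B \<rightarrow>\<^sub>E carrier R. finite {b \<in> B. f b \<noteq> \<zero>}}"
  "f \<oplus>\<^bsub>free_module R B\<^esub> g = (\<lambda>v\<in>B. f v \<oplus> g v)"
  "r \<odot>\<^bsub>free_module R B\<^esub> f = (\<lambda>v\<in>B. r \<otimes> f v)"
  "\<zero>\<^bsub>free_module R B\<^esub> = (\<lambda>v\<in>B. \<zero>)"
  by (simp_all add: free_module_def func_space_def)

lemma free_module_module: "Module.module R (free_module R B)"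
proof -
  interpret F: Module.module R "func_space B" by (rule func_space_is_module)
  let ?N = "{f \<in> B \<rightarrow>\<^sub>E carrier R. finite {b \<in> B. f b \<noteq> \<zero>}}"
  have "submodule R ?N (func_space B)"
  proof (rule LinearCombinations.submodule.intro)
    show "Module.module R (func_space B)" by (rule F.module_axioms)
    fix v w assume vw: "v \<in> ?N" "w \<in> ?N"
    then have "{b \<in> B. v b \<oplus> w b \<noteq> \<zero>} \<subseteq> {b \<in> B. v b \<noteq> \<zero>} \<union> {b \<in> B. w b \<noteq> \<zero>}" by auto
    with vw have "finite {b \<in> B. v b \<oplus> w b \<noteq> \<zero>}" by (auto intro: finite_subset)
    then show "v \<oplus>\<^bsub>func_space B\<^esub> w \<in> ?N" using vw
      by (auto simp: func_space_def PiE_iff cong: conj_cong)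
  next
    fix c v assume cv: "c \<in> carrier R" "v \<in> ?N"
    then have "{b \<in> B. c \<otimes> v b \<noteq> \<zero>} \<subseteq> {b \<in> B. v b \<noteq> \<zero>}" by auto
    with cv have "finite {b \<in> B. c \<otimes> v b \<noteq> \<zero>}" by (auto intro: finite_subset)
    then show "c \<odot>\<^bsub>func_space B\<^esub> v \<in> ?N" using cv
      by (auto simp: func_space_def PiE_iff cong: conj_cong)
  qed (auto simp: func_space_def cong: conj_cong)
  then show ?thesis unfolding free_module_def by (rule F.submodule_is_module)
qed

lemma free_gen_closed: "b \<in> B \<Longrightarrow> free_gen R B b \<in> carrier (free_module R B)"
proof -
  have "finite {x \<in> B. (if x = b then \<one> else \<zero>) \<noteq> \<zero>}"
    by (rule finite_subset[of _ "{b}"]) (auto split: if_splits)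
  then show ?thesis by (auto simp: free_module_simps free_gen_def cong: conj_cong)
qed

lemma free_module_induct [consumes 1, case_names zero add gen]:
  assumes f: "f \<in> carrier (free_module R B)"
    and zero: "P \<zero>\<^bsub>free_module R B\<^esub>"
    and add: "\<And>f g. f \<in> carrier (free_module R B) \<Longrightarrow> g \<in> carrier (free_module R B) \<Longrightarrow> P f \<Longrightarrow> P g \<Longrightarrow>
      P (f \<oplus>\<^bsub>free_module R B\<^esub> g)"
    and gen: "\<And>r b. r \<in> carrier R \<Longrightarrow> b \<in> B \<Longrightarrow> P (r \<odot>\<^bsub>free_module R B\<^esub> free_gen R B b)"
  shows "P f"
proof -
  interpret F: Module.module R "free_module R B" by (rule free_module_module)
  have "P f" if "finite A" "A \<subseteq> B" "f \<in> carrier (free_module R B)" "{b \<in> B. f b \<noteq> \<zero>} \<subseteq> A" for A f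
    using that
  proof (induction A arbitrary: f rule: finite_induct)
    case empty
    then have "f = \<zero>\<^bsub>free_module R B\<^esub>"
      by (intro ext) (auto simp: free_module_simps PiE_iff extensional_def)
    then show ?case using zero by simp
  next
    case (insert a A)
    let ?g = "\<lambda>x\<in>B. if x = a then \<zero> else f x"
    have fB: "f x \<in> carrier R" if "x \<in> B" for x using that insert.prems by (auto simp: free_module_simps)
    have "{b \<in> B. ?g b \<noteq> \<zero>} \<subseteq> {b \<in> B. f b \<noteq> \<zero>}" by auto
    then have "finite {b \<in> B. ?g b \<noteq> \<zero>}" 
      by (rule finite_subset) (use insert.prems in \<open>simp add: free_module_simps\<close>)
    then have g: "?g \<in> carrier (free_module R B)"
      unfolding free_module_simps using fB by simp
    have "{b \<in> B. ?g b \<noteq> \<zero>} \<subseteq> A" using insert.prems by auto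
    then have "P ?g" using insert.IH insert.prems g by blast
    have a: "a \<in> B" using insert.prems by simp
    have "f = f a \<odot>\<^bsub>free_module R B\<^esub> free_gen R B a \<oplus>\<^bsub>free_module R B\<^esub> ?g"
    proof
      fix x
      show "f x = (f a \<odot>\<^bsub>free_module R B\<^esub> free_gen R B a \<oplus>\<^bsub>free_module R B\<^esub> ?g) x"
        using insert.prems(2) fB a
        by (cases "x \<in> B") (auto simp: free_module_simps free_gen_def PiE_iff extensional_def)
    qed
    moreover have "P (f a \<odot>\<^bsub>free_module R B\<^esub> free_gen R B a \<oplus>\<^bsub>free_module R B\<^esub> ?g)"
      using a fB gen g \<open>P ?g\<close> by (intro add) (auto intro: free_gen_closed)
    ultimately show ?case by simp
  qed
  from this[of "{b \<in> B. f b \<noteq> \<zero>}" f] f show ?thesis by (auto simp: free_module_simps)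
qed

end

section \<open>Quotient modules\<close>

locale quot_mod = M?: Module.module R M for R (structure) and M (structure) +
  fixes N
  assumes N: "submodule R N M"
begin

definition proj where "proj x = N +>\<^bsub>M\<^esub> x"

lemma N_closed: "x \<in> N \<Longrightarrow> x \<in> carrier M"
  using LinearCombinations.submodule.subset[OF N] by blast

lemma N_uminus: "x \<in> N \<Longrightarrow> \<ominus>\<^bsub>M\<^esub> x \<in> N"
  using LinearCombinations.submodule.smult_closed[OF N, of "\<ominus>\<^bsub>R\<^esub> \<one>\<^bsub>R\<^esub>" x] M.smult_l_minus[of "\<one>\<^bsub>R\<^esub>" x] N_closed
  by simp

lemma N_subgroup: "abelian_subgroup N M"
proof (rule abelian_subgroupI3)
  show "abelian_group M" by (rule M.abelian_group_axioms)
  show "additive_subgroup N M"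
  proof (rule additive_subgroup.intro, rule group.subgroupI[OF M.a_group])
    show "N \<subseteq> carrier (add_monoid M)" using N_closed by auto
    show "N \<noteq> {}" using LinearCombinations.submodule.zero_closed[OF N] by blast
    fix a assume "a \<in> N"
    then show "inv\<^bsub>add_monoid M\<^esub> a \<in> N" using N_uminus by (simp add: a_inv_def)
  next
    fix a b assume "a \<in> N" "b \<in> N"
    then show "a \<otimes>\<^bsub>add_monoid M\<^esub> b \<in> N" using LinearCombinations.submodule.m_closed[OF N] by simp
  qed
qed

interpretation NS: abelian_subgroup N M by (rule N_subgroup)

lemma mem_proj: "y \<in> proj x \<longleftrightarrow> (\<exists>h\<in>N. y = h \<oplus>\<^bsub>M\<^esub> x)"
  by (auto simp: proj_def a_r_coset_def')

lemma proj_eqI: 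
  assumes "x \<in> carrier M" "y \<in> carrier M" "y \<ominus>\<^bsub>M\<^esub> x \<in> N" shows "proj y = proj x"
proof -
  have "y = (y \<ominus>\<^bsub>M\<^esub> x) \<oplus>\<^bsub>M\<^esub> x" using assms by (simp add: M.minus_eq M.a_assoc M.l_neg)
  then have "y \<in> proj x" using assms(3) mem_proj by blast
  then show ?thesis using NS.a_repr_independence'[of y x] assms(1) by (simp add: proj_def)
qed

lemma proj_eqD: 
  assumes "x \<in> carrier M" "y \<in> carrier M" "proj y = proj x" shows "y \<ominus>\<^bsub>M\<^esub> x \<in> N"
proof -
  have "y \<in> proj y" using NS.a_rcos_self[OF assms(2)] by (simp only: proj_def)
  then obtain h where h: "h \<in> N" "y = h \<oplus>\<^bsub>M\<^esub> x" using assms(3) mem_proj by auto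
  then have "y \<ominus>\<^bsub>M\<^esub> x = h" 
    using assms N_closed by (simp add: M.minus_eq M.a_assoc M.r_neg)
  then show ?thesis using h by simp
qed

lemma proj_eq_iff: "x \<in> carrier M \<Longrightarrow> y \<in> carrier M \<Longrightarrow> proj y = proj x \<longleftrightarrow> y \<ominus>\<^bsub>M\<^esub> x \<in> N"
  using proj_eqI proj_eqD by blast

abbreviation "Q \<equiv> quot_module M N"

lemma carrier_quot: "carrier Q = proj ` carrier M"
  by (auto simp: quot_module_def A_RCOSETS_def' proj_def)

lemma zero_quot: "\<zero>\<^bsub>Q\<^esub> = proj \<zero>\<^bsub>M\<^esub>"
proof -
  have "proj \<zero>\<^bsub>M\<^esub> = N" using N_closed by (auto simp: mem_proj) 
  then show ?thesis by (simp add: quot_module_def)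
qed

lemma add_quot: "x \<in> carrier M \<Longrightarrow> y \<in> carrier M \<Longrightarrow> proj x \<oplus>\<^bsub>Q\<^esub> proj y = proj (x \<oplus>\<^bsub>M\<^esub> y)"
  using NS.a_rcos_sum by (simp add: quot_module_def proj_def)

text \<open>The scalar action is a union over all representatives of a coset; the cosets united
  coincide because \<open>N\<close> is closed under scalars.\<close>

lemma smult_quot: 
  assumes "r \<in> carrier R" "x \<in> carrier M" shows "r \<odot>\<^bsub>Q\<^esub> proj x = proj (r \<odot>\<^bsub>M\<^esub> x)"
proof -
  have "proj (r \<odot>\<^bsub>M\<^esub> y) = proj (r \<odot>\<^bsub>M\<^esub> x)" if "y \<in> proj x" for y
  proof -
    from that[unfolded mem_proj] obtain h where h: "h \<in> N" "y = h \<oplus>\<^bsub>M\<^esub> x" ..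
    have "r \<odot>\<^bsub>M\<^esub> h \<in> N"
      by (rule LinearCombinations.submodule.smult_closed[OF N assms(1) h(1)])
    moreover have "r \<odot>\<^bsub>M\<^esub> y = r \<odot>\<^bsub>M\<^esub> h \<oplus>\<^bsub>M\<^esub> r \<odot>\<^bsub>M\<^esub> x" 
      unfolding h(2) using assms N_closed[OF h(1)] by (simp add: M.smult_r_distr)
    ultimately have "r \<odot>\<^bsub>M\<^esub> y \<in> proj (r \<odot>\<^bsub>M\<^esub> x)" unfolding mem_proj by (rule bexI[rotated])
    then show ?thesis using NS.a_repr_independence'[of "r \<odot>\<^bsub>M\<^esub> y" "r \<odot>\<^bsub>M\<^esub> x"] assms by (simp add: proj_def)
  qed
  moreover have "proj x \<noteq> {}" 
    using NS.a_rcos_self[OF assms(2)] unfolding proj_def by blast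
  ultimately have "(\<Union>y\<in>proj x. proj (r \<odot>\<^bsub>M\<^esub> y)) = proj (r \<odot>\<^bsub>M\<^esub> x)" 
    by (intro SUP_eq_const)
  then show ?thesis by (simp add: quot_module_def proj_def)
qed

lemma quot_module_module: "Module.module R Q"
proof (rule Module.moduleI)
  show "cring R" ..
  show "abelian_group Q"
  proof (rule abelian_groupI)
    fix x assume "x \<in> carrier Q"
    then obtain x' where x': "x = proj x'" "x' \<in> carrier M" by (auto simp: carrier_quot)
    then show "\<exists>y\<in>carrier Q. y \<oplus>\<^bsub>Q\<^esub> x = \<zero>\<^bsub>Q\<^esub>"
      by (intro bexI[of _ "proj (\<ominus>\<^bsub>M\<^esub> x')"]) (auto simp: add_quot zero_quot carrier_quot M.l_neg)
  next
    fix x y z assume "x \<in> carrier Q" "y \<in> carrier Q" "z \<in> carrier Q"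
    then obtain x' y' z' where "x = proj x'" "x' \<in> carrier M" "y = proj y'" "y' \<in> carrier M" 
      "z = proj z'" "z' \<in> carrier M" by (auto simp: carrier_quot)
    then show "x \<oplus>\<^bsub>Q\<^esub> y \<oplus>\<^bsub>Q\<^esub> z = x \<oplus>\<^bsub>Q\<^esub> (y \<oplus>\<^bsub>Q\<^esub> z)" "x \<oplus>\<^bsub>Q\<^esub> y = y \<oplus>\<^bsub>Q\<^esub> x"
      by (simp_all add: add_quot M.a_ac)
  qed (auto simp: carrier_quot add_quot zero_quot)
qed (auto simp: carrier_quot add_quot smult_quot M.smult_l_distr M.smult_r_distr M.smult_assoc1)

lemma proj_closed [simp]: "x \<in> carrier M \<Longrightarrow> proj x \<in> carrier Q"
  by (simp add: carrier_quot)

lemma proj_eq_0_iff: "x \<in> carrier M \<Longrightarrow> proj x = \<zero>\<^bsub>Q\<^esub> \<longleftrightarrow> x \<in> N"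
proof -
  assume x: "x \<in> carrier M"
  have "\<ominus>\<^bsub>M\<^esub> \<zero>\<^bsub>M\<^esub> = \<zero>\<^bsub>M\<^esub>" using M.l_neg[of "\<zero>\<^bsub>M\<^esub>"] by simp
  then have "x \<ominus>\<^bsub>M\<^esub> \<zero>\<^bsub>M\<^esub> = x" using x by (simp add: M.minus_eq)
  then show ?thesis unfolding zero_quot using x by (subst proj_eq_iff) simp_all
qed

end

section \<open>Maps out of free modules, computed on representatives modulo I\<close>

context zero_dim
begin

text \<open>Representatives are chosen arbitrarily, so \<open>Phi\<close> is linear in \<open>f\<close> only modulo \<open>I\<close>.\<close>

definition Phi :: "'b set \<Rightarrow> ('b \<Rightarrow> 'j \<Rightarrow> 'k mpoly) \<Rightarrow> ('b \<Rightarrow> 'k mpoly set) \<Rightarrow> 'j \<Rightarrow> 'k mpoly" where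
  "Phi B h f j = (\<Sum>b\<in>{b \<in> B. f b \<noteq> \<zero>\<^bsub>R\<^esub>}. rep (f b) * h b j)"

definition cong_I :: "'k mpoly \<Rightarrow> 'k mpoly \<Rightarrow> bool" where
  "cong_I p q \<longleftrightarrow> p - q \<in> I"

lemma cong_I_refl [simp]: "cong_I p p"
  by (simp add: cong_I_def)

lemma cong_I_sym: "cong_I p q \<Longrightarrow> cong_I q p"
  using J_uminus[of "p - q"] by (simp add: cong_I_def)

lemma cong_I_trans [trans]: "cong_I p q \<Longrightarrow> cong_I q r \<Longrightarrow> cong_I p r"
  using J_add[of "p - q" "q - r"] by (simp add: cong_I_def)

lemma cong_I_add: "cong_I p q \<Longrightarrow> cong_I p' q' \<Longrightarrow> cong_I (p + p') (q + q')"
  using J_add[of "p - q" "p' - q'"] by (simp add: cong_I_def algebra_simps)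

lemma cong_I_diff: "cong_I p q \<Longrightarrow> cong_I p' q' \<Longrightarrow> cong_I (p - p') (q - q')"
  using J_diff[of "p - q" "p' - q'"] by (simp add: cong_I_def algebra_simps)

lemma cong_I_mult_right: "cong_I p q \<Longrightarrow> r \<in> polys n \<Longrightarrow> cong_I (p * r) (q * r)"
  using J_mult'[of "p - q" r] by (simp add: cong_I_def algebra_simps)

lemma cong_I_mult_left: "cong_I p q \<Longrightarrow> r \<in> polys n \<Longrightarrow> cong_I (r * p) (r * q)"
  using J_mult[of r "p - q"] by (simp add: cong_I_def algebra_simps)

lemma cong_I_sum: "(\<And>a. a \<in> A \<Longrightarrow> cong_I (f a) (g a)) \<Longrightarrow> cong_I (sum f A) (sum g A)"
  unfolding cong_I_def by (subst sum_subtractf[symmetric]) (rule J_sum)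

lemma cong_I_rep_cl: "p \<in> polys n \<Longrightarrow> cong_I (rep (cl p)) p"
  using cl_eq_iff[of "rep (cl p)" p] by (simp add: cong_I_def)

lemma cong_I_rep_zero: "cong_I (rep \<zero>\<^bsub>R\<^esub>) 0"
  using cong_I_rep_cl[of 0] by (simp add: cl_0)

lemma cong_I_rep_add: "r \<in> carrier R \<Longrightarrow> s \<in> carrier R \<Longrightarrow> cong_I (rep (r \<oplus>\<^bsub>R\<^esub> s)) (rep r + rep s)"
  using cong_I_rep_cl[of "rep r + rep s"] by (simp add: cl_add)

lemma cong_I_rep_mult: "r \<in> carrier R \<Longrightarrow> s \<in> carrier R \<Longrightarrow> cong_I (rep (r \<otimes>\<^bsub>R\<^esub> s)) (rep r * rep s)"
  using cong_I_rep_cl[of "rep r * rep s"] by (simp add: cl_mult)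


context
  fixes B :: "'b set" and h :: "'b \<Rightarrow> 'j \<Rightarrow> 'k mpoly"
  assumes h: "\<And>b j. b \<in> B \<Longrightarrow> h b j \<in> polys n"
begin

abbreviation "F \<equiv> free_module R B"

interpretation F: Module.module R F by (rule R.free_module_module)

lemma Phi_polys: "f \<in> carrier F \<Longrightarrow> Phi B h f j \<in> polys n"
  unfolding Phi_def by (intro polys_sum polys_mult rep_polys h) (auto simp: R.free_module_simps)

text \<open>\<open>rep\<close> of zero lies in I but need not be the polynomial 0, so summing over a
  larger index set changes the value by an element of I.\<close>

lemma Phi_superset:
  assumes "f \<in> carrier F" "finite A" "A \<subseteq> B" "{b \<in> B. f b \<noteq> \<zero>\<^bsub>R\<^esub>} \<subseteq> A"
  shows "cong_I (Phi B h f j) (\<Sum>b\<in>A. rep (f b) * h b j)"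
proof -
  have "(\<Sum>b\<in>A. rep (f b) * h b j) = Phi B h f j + (\<Sum>b\<in>A - {b \<in> B. f b \<noteq> \<zero>\<^bsub>R\<^esub>}. rep (f b) * h b j)"
    unfolding Phi_def using sum.subset_diff[OF assms(4,2)] by (simp add: add.commute)
  moreover have "cong_I (\<Sum>b\<in>A - {b \<in> B. f b \<noteq> \<zero>\<^bsub>R\<^esub>}. rep (f b) * h b j) 
      (\<Sum>b\<in>A - {b \<in> B. f b \<noteq> \<zero>\<^bsub>R\<^esub>}. 0 * h b j)"
    using assms(3) h by (intro cong_I_sum cong_I_mult_right) (auto simp: cong_I_rep_zero)
  ultimately show ?thesis
    using cong_I_add[OF cong_I_refl[of "Phi B h f j"]] cong_I_sym by fastforce
qed

lemma Phi_add:
  assumes "f \<in> carrier F" "g \<in> carrier F"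
  shows "cong_I (Phi B h (f \<oplus>\<^bsub>F\<^esub> g) j) (Phi B h f j + Phi B h g j)"
proof -
  let ?A = "{b \<in> B. f b \<noteq> \<zero>\<^bsub>R\<^esub>} \<union> {b \<in> B. g b \<noteq> \<zero>\<^bsub>R\<^esub>}"
  have fin: "finite ?A" using assms by (simp add: R.free_module_simps)
  have fg: "f b \<in> carrier R" "g b \<in> carrier R" if "b \<in> B" for b
    using that assms by (auto simp: R.free_module_simps)
  have "{b \<in> B. (f \<oplus>\<^bsub>F\<^esub> g) b \<noteq> \<zero>\<^bsub>R\<^esub>} \<subseteq> ?A" by (auto simp: R.free_module_simps(2))
  then have "cong_I (Phi B h (f \<oplus>\<^bsub>F\<^esub> g) j) (\<Sum>b\<in>?A. rep ((f \<oplus>\<^bsub>F\<^esub> g) b) * h b j)"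
    using assms fin by (intro Phi_superset F.a_closed) auto
  also have "cong_I (\<Sum>b\<in>?A. rep ((f \<oplus>\<^bsub>F\<^esub> g) b) * h b j) (\<Sum>b\<in>?A. (rep (f b) + rep (g b)) * h b j)"
    using h fg cong_I_rep_add by (intro cong_I_sum cong_I_mult_right) (auto simp: R.free_module_simps)
  also have "(\<Sum>b\<in>?A. (rep (f b) + rep (g b)) * h b j) = (\<Sum>b\<in>?A. rep (f b) * h b j) + (\<Sum>b\<in>?A. rep (g b) * h b j)"
    by (simp add: algebra_simps sum.distrib)
  also have "cong_I \<dots> (Phi B h f j + Phi B h g j)"
    using assms fin by (intro cong_I_add cong_I_sym[OF Phi_superset]) auto
  finally show ?thesis .
qed

lemma Phi_smult:
  assumes "r \<in> carrier R" "f \<in> carrier F"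
  shows "cong_I (Phi B h (r \<odot>\<^bsub>F\<^esub> f) j) (rep r * Phi B h f j)"
proof -
  let ?A = "{b \<in> B. f b \<noteq> \<zero>\<^bsub>R\<^esub>}"
  have fin: "finite ?A" using assms by (simp add: R.free_module_simps)
  have fg: "f b \<in> carrier R" if "b \<in> B" for b
    using that assms by (auto simp: R.free_module_simps)
  have "{b \<in> B. (r \<odot>\<^bsub>F\<^esub> f) b \<noteq> \<zero>\<^bsub>R\<^esub>} \<subseteq> ?A" using assms(1) by (auto simp: R.free_module_simps(3))
  then have "cong_I (Phi B h (r \<odot>\<^bsub>F\<^esub> f) j) (\<Sum>b\<in>?A. rep ((r \<odot>\<^bsub>F\<^esub> f) b) * h b j)"
    using assms fin by (intro Phi_superset F.smult_closed) auto
  also have "cong_I (\<Sum>b\<in>?A. rep ((r \<odot>\<^bsub>F\<^esub> f) b) * h b j) (\<Sum>b\<in>?A. (rep r * rep (f b)) * h b j)"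
    using h fg assms cong_I_rep_mult by (intro cong_I_sum cong_I_mult_right) (auto simp: R.free_module_simps)
  also have "(\<Sum>b\<in>?A. (rep r * rep (f b)) * h b j) = rep r * Phi B h f j"
    by (simp add: Phi_def sum_distrib_left mult.assoc)
  finally show ?thesis .
qed

lemma Phi_gen:
  assumes "b \<in> B" shows "cong_I (Phi B h (free_gen R B b) j) (h b j)"
proof -
  have "cong_I (Phi B h (free_gen R B b) j) (\<Sum>c\<in>{b}. rep (free_gen R B b c) * h c j)"
    using assms by (intro Phi_superset R.free_gen_closed) (auto simp: free_gen_def)
  also have "(\<Sum>c\<in>{b}. rep (free_gen R B b c) * h c j) = rep (cl 1) * h b j"
    using assms by (simp add: free_gen_def cl_1)
  also have "cong_I \<dots> (1 * h b j)" using assms h by (intro cong_I_mult_right cong_I_rep_cl) auto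
  finally show ?thesis by simp
qed

lemma Phi_zero: "cong_I (Phi B h \<zero>\<^bsub>F\<^esub> j) 0"
  using Phi_superset[of "\<zero>\<^bsub>F\<^esub>" "{}" j] by (auto simp: R.free_module_simps)

lemma Phi_minus:
  assumes "f \<in> carrier F" "g \<in> carrier F"
  shows "cong_I (Phi B h (f \<ominus>\<^bsub>F\<^esub> g) j) (Phi B h f j - Phi B h g j)"
proof -
  have "(f \<ominus>\<^bsub>F\<^esub> g) \<oplus>\<^bsub>F\<^esub> g = f" 
    using assms by (simp add: F.minus_eq F.a_assoc F.l_neg)
  then have "cong_I (Phi B h f j) (Phi B h (f \<ominus>\<^bsub>F\<^esub> g) j + Phi B h g j)"
    using Phi_add[of "f \<ominus>\<^bsub>F\<^esub> g" g j] assms by simp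
  from cong_I_diff[OF cong_I_sym[OF this] cong_I_refl[of "Phi B h g j"]] show ?thesis by simp
qed

end

end

text \<open>A submodule of the free R-module on \<open>Js\<close>, pulled back to polynomial
  vectors: by \<open>U_I\<close>, membership depends only on the entries at \<open>Js\<close>,
  modulo I.\<close>

locale poly_submodule = zero_dim n I for n and I :: "'k::field mpoly set" +
  fixes Js :: "'j set" and U :: "('j \<Rightarrow> 'k mpoly) set"
  assumes U_I: "(\<And>j. j \<in> Js \<Longrightarrow> c j \<in> I) \<Longrightarrow> c \<in> U"
    and U_add: "u \<in> U \<Longrightarrow> v \<in> U \<Longrightarrow> (\<lambda>j. u j + v j) \<in> U"
    and U_smult: "p \<in> polys n \<Longrightarrow> u \<in> U \<Longrightarrow> (\<lambda>j. p * u j) \<in> U"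
begin

lemma U_cong: 
  assumes "u \<in> U" "\<And>j. j \<in> Js \<Longrightarrow> cong_I (v j) (u j)" shows "v \<in> U"
proof -
  have "(\<lambda>j. v j - u j) \<in> U" using assms(2) by (intro U_I) (simp add: cong_I_def)
  from U_add[OF this assms(1)] show ?thesis by simp
qed

lemma U_diff: "u \<in> U \<Longrightarrow> v \<in> U \<Longrightarrow> (\<lambda>j. u j - v j) \<in> U"
  using U_add[of u "\<lambda>j. (-1) * v j"] U_smult[of "-1" v] by simp

lemma U_sum: "(\<And>a. a \<in> A \<Longrightarrow> u a \<in> U) \<Longrightarrow> (\<lambda>j. \<Sum>a\<in>A. u a j) \<in> U"
  by (induction A rule: infinite_finite_induct) (auto intro: U_add U_I)


text \<open>\<open>Phi\<close> is linear modulo I, hence modulo \<open>U\<close>, so the preimage of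
  \<open>U\<close> is a submodule; it contains the span once it contains
  \<open>rels\<close>.\<close>

lemma Phi_span:
  assumes h: "\<And>b j. b \<in> B \<Longrightarrow> h b j \<in> polys n"
    and rels: "rels \<subseteq> carrier (free_module R B)" "\<And>\<rho>. \<rho> \<in> rels \<Longrightarrow> Phi B h \<rho> \<in> U"
    and f: "f \<in> module_span R (free_module R B) rels"
  shows "Phi B h f \<in> U"
proof -
  interpret F: Module.module R "free_module R B" by (rule R.free_module_module)
  let ?Q = "{f \<in> carrier (free_module R B). Phi B h f \<in> U}"
  have "submodule R ?Q (free_module R B)"
  proof (rule LinearCombinations.submodule.intro[OF R.free_module_module])
    have "Phi B h \<zero>\<^bsub>free_module R B\<^esub> \<in> U"
      by (rule U_cong[OF U_I[of "\<lambda>_. 0"]]) (use Phi_zero[OF h] in auto)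
    then show "\<zero>\<^bsub>free_module R B\<^esub> \<in> ?Q" by simp
  next
    fix v w assume vw: "v \<in> ?Q" "w \<in> ?Q"
    then have "(\<lambda>j. Phi B h v j + Phi B h w j) \<in> U" using U_add by simp
    then have "Phi B h (v \<oplus>\<^bsub>free_module R B\<^esub> w) \<in> U"
      by (rule U_cong[OF _ Phi_add[OF h]]) (use vw in auto)
    then show "v \<oplus>\<^bsub>free_module R B\<^esub> w \<in> ?Q" using vw by simp
  next
    fix c v assume cv: "c \<in> carrier R" "v \<in> ?Q"
    then have "(\<lambda>j. rep c * Phi B h v j) \<in> U" using U_smult by simp
    then have "Phi B h (c \<odot>\<^bsub>free_module R B\<^esub> v) \<in> U"
      by (rule U_cong[OF _ Phi_smult[OF h]]) (use cv in auto)
    then show "c \<odot>\<^bsub>free_module R B\<^esub> v \<in> ?Q" using cv by simp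
  qed auto
  then have "module_span R (free_module R B) rels \<subseteq> ?Q"
    using rels by (intro F.span_is_subset) auto
  then show ?thesis using f by blast
qed

text \<open>\<open>Phi\<close> induces a linear map from the quotient by the relations to vectors
  modulo \<open>U\<close>, which carries a vanishing combination of generators into
  \<open>U\<close>. This determines the kernels of the presentations of Omega^1 and of
  Omega^m.\<close>

lemma relation_in_U:
  assumes h: "\<And>b j. b \<in> B \<Longrightarrow> h b j \<in> polys n"
    and rels: "rels \<subseteq> carrier (free_module R B)" "\<And>\<rho>. \<rho> \<in> rels \<Longrightarrow> Phi B h \<rho> \<in> U"
    and A: "finite A" "\<And>a. a \<in> A \<Longrightarrow> p a \<in> polys n" "\<And>a. a \<in> A \<Longrightarrow> g a \<in> B"
    and N: "N = module_span R (free_module R B) rels"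
    and zero: "(\<Oplus>\<^bsub>quot_module (free_module R B) N\<^esub>a\<in>A. cl (p a) \<odot>\<^bsub>quot_module (free_module R B) N\<^esub> 
      (N +>\<^bsub>free_module R B\<^esub> free_gen R B (g a))) = \<zero>\<^bsub>quot_module (free_module R B) N\<^esub>"
  shows "(\<lambda>j. \<Sum>a\<in>A. p a * h (g a) j) \<in> U"
proof -
  interpret F: Module.module R "free_module R B" by (rule R.free_module_module)
  have "submodule R N (free_module R B)"
    unfolding N by (rule F.span_is_submodule[OF rels(1)])
  then interpret QM: quot_mod R "free_module R B" N
    by (intro quot_mod.intro quot_mod_axioms.intro R.free_module_module)
  let ?Q = "quot_module (free_module R B) N"
  interpret Q: Module.module R ?Q by (rule QM.quot_module_module)
  let ?f = "\<lambda>A. \<Oplus>\<^bsub>free_module R B\<^esub>a\<in>A. cl (p a) \<odot>\<^bsub>free_module R B\<^esub> free_gen R B (g a)"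
  have gen: "cl (p a) \<odot>\<^bsub>free_module R B\<^esub> free_gen R B (g a) \<in> carrier (free_module R B)" if "a \<in> A" for a
    using that A by (intro F.smult_closed R.free_gen_closed cl_closed)
  \<comment> \<open>One induction follows both images of the partial sum: its class in the quotient,
    and modulo I its value under \<open>Phi\<close>.\<close>
  have "QM.proj (?f A') = (\<Oplus>\<^bsub>?Q\<^esub>a\<in>A'. cl (p a) \<odot>\<^bsub>?Q\<^esub> QM.proj (free_gen R B (g a))) \<and>
    (\<forall>j. cong_I (Phi B h (?f A') j) (\<Sum>a\<in>A'. p a * h (g a) j))" if "A' \<subseteq> A" for A'
    using finite_subset[OF that A(1)] that
  proof (induction A' rule: finite_induct)
    case empty
    then show ?case using Phi_zero[OF h] by (auto simp: QM.zero_quot)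
  next
    case (insert a A')
    have a: "a \<in> A" using insert by simp
    have fA: "?f A' \<in> carrier (free_module R B)" using gen insert by (intro F.finsum_closed) auto
    have i1: "?f (insert a A') = cl (p a) \<odot>\<^bsub>free_module R B\<^esub> free_gen R B (g a) \<oplus>\<^bsub>free_module R B\<^esub> ?f A'"
      using gen insert by (intro F.finsum_insert) auto
    have i2: "(\<Oplus>\<^bsub>?Q\<^esub>a\<in>insert a A'. cl (p a) \<odot>\<^bsub>?Q\<^esub> QM.proj (free_gen R B (g a))) = 
      cl (p a) \<odot>\<^bsub>?Q\<^esub> QM.proj (free_gen R B (g a)) \<oplus>\<^bsub>?Q\<^esub> (\<Oplus>\<^bsub>?Q\<^esub>a\<in>A'. cl (p a) \<odot>\<^bsub>?Q\<^esub> QM.proj (free_gen R B (g a)))"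
      using A insert by (intro Q.finsum_insert) (auto intro!: Q.smult_closed QM.proj_closed R.free_gen_closed)
    have "QM.proj (?f (insert a A')) = (\<Oplus>\<^bsub>?Q\<^esub>a\<in>insert a A'. cl (p a) \<odot>\<^bsub>?Q\<^esub> QM.proj (free_gen R B (g a)))"
      unfolding i1 i2 using insert a A fA gen
      by (simp add: QM.add_quot[symmetric] QM.smult_quot[symmetric] R.free_gen_closed)
    moreover have "cong_I (Phi B h (?f (insert a A')) j) (\<Sum>a\<in>insert a A'. p a * h (g a) j)" for j
    proof -
      have "cong_I (Phi B h (?f (insert a A')) j) 
        (Phi B h (cl (p a) \<odot>\<^bsub>free_module R B\<^esub> free_gen R B (g a)) j + Phi B h (?f A') j)"
        unfolding i1 using gen[OF a] fA by (intro Phi_add h)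
      also have "cong_I \<dots> (rep (cl (p a)) * Phi B h (free_gen R B (g a)) j + (\<Sum>a\<in>A'. p a * h (g a) j))"
        using insert a A by (intro cong_I_add Phi_smult h R.free_gen_closed cl_closed) auto
      also have "cong_I \<dots> (p a * Phi B h (free_gen R B (g a)) j + (\<Sum>a\<in>A'. p a * h (g a) j))"
        using a A by (intro cong_I_add cong_I_refl cong_I_mult_right cong_I_rep_cl Phi_polys h R.free_gen_closed) auto
      also have "cong_I \<dots> (p a * h (g a) j + (\<Sum>a\<in>A'. p a * h (g a) j))"
        using a A by (intro cong_I_add cong_I_refl cong_I_mult_left Phi_gen h) auto
      finally show ?thesis using insert by simp
    qed
    ultimately show ?case by blast
  qed
  from this[of A] zero have "QM.proj (?f A) = \<zero>\<^bsub>?Q\<^esub>" 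
    and 1: "\<And>j. cong_I (Phi B h (?f A) j) (\<Sum>a\<in>A. p a * h (g a) j)" by (auto simp: QM.proj_def)
  moreover have "?f A \<in> carrier (free_module R B)" using gen by (intro F.finsum_closed) auto
  ultimately have "?f A \<in> module_span R (free_module R B) rels" using QM.proj_eq_0_iff N by blast
  then have "Phi B h (?f A) \<in> U" using Phi_span[OF h rels] by blast
  then show ?thesis by (rule U_cong) (use 1 cong_I_sym in blast)
qed

end

section \<open>Kaehler differentials\<close>

definition pder :: "nat \<Rightarrow> 'k::field mpoly \<Rightarrow> 'k mpoly" where
  "pder j p = (\<Sum>t\<in>Poly_Mapping.keys p. Poly_Mapping.single (t - Poly_Mapping.single j 1)
     (of_nat (Poly_Mapping.lookup t j) * Poly_Mapping.lookup p t))"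

lemma pder_superset:
  assumes "finite A" "Poly_Mapping.keys p \<subseteq> A"
  shows "pder j p = (\<Sum>t\<in>A. Poly_Mapping.single (t - Poly_Mapping.single j 1)
     (of_nat (Poly_Mapping.lookup t j) * Poly_Mapping.lookup p t))"
  unfolding pder_def using assms by (intro sum.mono_neutral_left) (auto simp: in_keys_iff)

lemma pder_0 [simp]: "pder j 0 = 0"
  by (simp add: pder_def)

lemma pder_add: "pder j (p + q) = pder j p + pder j q"
proof -
  let ?A = "Poly_Mapping.keys p \<union> Poly_Mapping.keys q"
  have "Poly_Mapping.keys (p + q) \<subseteq> ?A" by (rule Poly_Mapping.keys_add)
  then show ?thesis
    by (simp add: pder_superset[of ?A] lookup_add algebra_simps single_add sum.distrib)
qed

lemma pder_sum: "pder j (sum f A) = (\<Sum>a\<in>A. pder j (f a))"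
  by (induction A rule: infinite_finite_induct) (auto simp: pder_add)

lemma pder_diff: "pder j (p - q) = pder j p - pder j q"
  using pder_add[of j "p - q" q] by simp

lemma pder_single:
  "pder j (Poly_Mapping.single t c) = 
    Poly_Mapping.single (t - Poly_Mapping.single j 1) (of_nat (Poly_Mapping.lookup t j) * c)"
  by (subst pder_superset[of "{t}"]) auto

lemma pder_const [simp]: "pder j (Poly_Mapping.single 0 c) = 0"
  by (simp add: pder_single)

lemma pder_indet: "pder j (indet i) = (if j = i then 1 else 0)"
  by (simp add: indet_def pder_single lookup_single)

lemma monomial_shift:
  assumes "Poly_Mapping.lookup t j \<noteq> 0"
  shows "(t :: nat \<Rightarrow>\<^sub>0 nat) = Poly_Mapping.single j 1 + (t - Poly_Mapping.single j 1)"
  using assms by (intro poly_mapping_eqI) (auto simp: lookup_add lookup_minus lookup_single when_def)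

text \<open>Both Leibniz terms are multiples of the same monomial. Where X_j is missing from a
  factor, the subtraction of exponents truncates, but the coefficient is then 0.\<close>

lemma pder_mult_single:
  fixes c d :: "'k::field"
  shows "pder j (Poly_Mapping.single s c * Poly_Mapping.single t d) = 
    Poly_Mapping.single s c * pder j (Poly_Mapping.single t d) + 
    Poly_Mapping.single t d * pder j (Poly_Mapping.single s c)"
proof -
  let ?\<delta> = "Poly_Mapping.single j (1::nat)"
  have shift: "Poly_Mapping.single (s + (t - ?\<delta>)) (c * (of_nat (Poly_Mapping.lookup t j) * d)) = 
      Poly_Mapping.single ((s + t) - ?\<delta>) (of_nat (Poly_Mapping.lookup t j) * (c * d))" for s t and c d :: 'k
  proof (cases "Poly_Mapping.lookup t j = 0")
    case False
    then have "s + (t - ?\<delta>) = (s + t) - ?\<delta>"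
      by (intro poly_mapping_eqI) (auto simp: lookup_add lookup_minus lookup_single when_def)
    then show ?thesis by (simp only: mult.left_commute)
  qed simp
  have "pder j (Poly_Mapping.single s c * Poly_Mapping.single t d) =
      Poly_Mapping.single (s + t - ?\<delta>) (of_nat (Poly_Mapping.lookup t j) * (c * d))
      + Poly_Mapping.single (s + t - ?\<delta>) (of_nat (Poly_Mapping.lookup s j) * (c * d))"
    by (simp add: mult_single pder_single lookup_add single_add[symmetric] algebra_simps)
  moreover have "Poly_Mapping.single s c * pder j (Poly_Mapping.single t d) = 
      Poly_Mapping.single (s + t - ?\<delta>) (of_nat (Poly_Mapping.lookup t j) * (c * d))"
    by (simp only: pder_single mult_single shift)
  moreover have "Poly_Mapping.single t d * pder j (Poly_Mapping.single s c) = 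
      Poly_Mapping.single (t + s - ?\<delta>) (of_nat (Poly_Mapping.lookup s j) * (d * c))"
    by (simp only: pder_single mult_single shift)
  ultimately show ?thesis by (simp only: add.commute[of t s] mult.commute[of d c])
qed

lemma pder_mult: "pder j (p * q) = p * pder j q + q * pder j p"
proof -
  have single: "pder j (Poly_Mapping.single s c * q) = 
    Poly_Mapping.single s c * pder j q + q * pder j (Poly_Mapping.single s c)" for s c
  proof -
    define A where "A = Poly_Mapping.keys q"
    have q: "q = (\<Sum>t\<in>A. Poly_Mapping.single t (Poly_Mapping.lookup q t))"
      unfolding A_def by (rule single_decomp)
    show ?thesis
      by (subst (1 2 3) q) (simp add: sum_distrib_left sum_distrib_right pder_sum pder_mult_single sum.distrib)
  qed
  define A where "A = Poly_Mapping.keys p"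
  have p: "p = (\<Sum>t\<in>A. Poly_Mapping.single t (Poly_Mapping.lookup p t))"
    unfolding A_def by (rule single_decomp)
  show ?thesis
    by (subst (1 2 3) p) (simp add: sum_distrib_left sum_distrib_right pder_sum single sum.distrib)
qed

lemma polys_pder [simp]: "p \<in> polys n \<Longrightarrow> pder j p \<in> polys n"
  unfolding pder_def
proof (intro polys_sum polys_single)
  fix t assume p: "p \<in> polys n" "t \<in> Poly_Mapping.keys p"
  have "Poly_Mapping.keys (t - Poly_Mapping.single j 1) \<subseteq> Poly_Mapping.keys t"
    by (auto simp: in_keys_iff lookup_minus)
  then show "Poly_Mapping.keys (t - Poly_Mapping.single j 1) \<subseteq> {..n}"
    using p by (auto simp: polys_iff)
qed

lemma homog_pder: 
  assumes "homog d p" shows "homog (d - 1) (pder j p)"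
  unfolding pder_def
proof (rule homog_sum)
  fix t assume t: "t \<in> Poly_Mapping.keys p"
  show "homog (d - 1) (Poly_Mapping.single (t - Poly_Mapping.single j 1) 
      (of_nat (Poly_Mapping.lookup t j) * Poly_Mapping.lookup p t))"
  proof (cases "Poly_Mapping.lookup t j = 0")
    case False
    have "tdeg t = 1 + tdeg (t - Poly_Mapping.single j 1)"
      using arg_cong[OF monomial_shift[OF False], of tdeg] by simp
    then show ?thesis using assms t by (auto simp: homog_single homog_def)
  qed simp
qed

lemma hcomp_pder: "hcomp d (pder j p) = pder j (hcomp (d + 1) p)"
proof -
  let ?D = "insert (d + 1) (degs p)"
  have "hcomp d (pder j p) = (\<Sum>e\<in>?D. hcomp d (pder j (hcomp e p)))"
    by (subst sum_hcomp[of ?D p, symmetric]) (auto simp: pder_sum hcomp_sum)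
  also have "\<dots> = (\<Sum>e\<in>?D. if e = d + 1 then pder j (hcomp (d + 1) p) else 0)"
    by (intro sum.cong refl) (subst hcomp_homog[OF homog_pder[OF homog_hcomp]], auto)
  finally show ?thesis by simp
qed

text \<open>The product case is there so that maps obeying the Leibniz rule can be compared on
  constants and indeterminates only.\<close>

lemma polys_induct [consumes 1, case_names const indet add mult]:
  fixes p :: "'k::field mpoly"
  assumes p: "p \<in> polys n"
    and const: "\<And>c. P (Poly_Mapping.single 0 c)" and indet: "\<And>i. i \<le> n \<Longrightarrow> P (indet i)"
    and add: "\<And>p q. p \<in> polys n \<Longrightarrow> q \<in> polys n \<Longrightarrow> P p \<Longrightarrow> P q \<Longrightarrow> P (p + q)"
    and mult: "\<And>p q. p \<in> polys n \<Longrightarrow> q \<in> polys n \<Longrightarrow> P p \<Longrightarrow> P q \<Longrightarrow> P (p * q)"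
  shows "P p"
proof -
  have mono: "P (Poly_Mapping.single t c)" if "Poly_Mapping.keys t \<subseteq> {..n}" for t c
    using that
  proof (induction "tdeg t" arbitrary: t rule: less_induct)
    case less
    show ?case
    proof (cases "t = 0")
      case True
      then show ?thesis using const by simp
    next
      case False
      then obtain i where i: "i \<in> Poly_Mapping.keys t" by (metis all_not_in_conv keys_eq_empty)
      define s where "s = t - Poly_Mapping.single i 1"
      have t: "t = Poly_Mapping.single i 1 + s"
        unfolding s_def using i by (intro monomial_shift) (simp add: in_keys_iff)
      have "Poly_Mapping.keys s \<subseteq> Poly_Mapping.keys t"
        by (auto simp: s_def in_keys_iff lookup_minus)
      then have s: "Poly_Mapping.keys s \<subseteq> {..n}" using less.prems by blast
      have "tdeg s < tdeg t" unfolding t by simp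
      then have "P (Poly_Mapping.single s c)" using less.hyps s by blast
      then have "P (indet i * Poly_Mapping.single s c)"
        using i less.prems s by (intro mult indet polys_indet polys_single) auto
      then show ?thesis by (simp add: indet_def mult_single t)
    qed
  qed
  have "P (\<Sum>t\<in>A. Poly_Mapping.single t (f t))" if "finite A" "\<And>t. t \<in> A \<Longrightarrow> Poly_Mapping.keys t \<subseteq> {..n}" for A f
    using that
  proof (induction A rule: finite_induct)
    case empty
    then show ?case using const[of 0] by simp
  next
    case (insert t A)
    then have "P (Poly_Mapping.single t (f t) + (\<Sum>t\<in>A. Poly_Mapping.single t (f t)))"
      by (intro add polys_single polys_sum mono) auto
    then show ?case using insert by simp
  qed
  from this[of "Poly_Mapping.keys p" "Poly_Mapping.lookup p"] show ?thesis
    using p single_decomp[of p] by (simp add: polys_iff)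
qed

lemma (in fg_module) mu_sum_eq_0:
  assumes "\<And>a. a \<in> A \<Longrightarrow> mu (c a) = \<zero>\<^bsub>M\<^esub>" "\<And>a j. a \<in> A \<Longrightarrow> j \<in> Js \<Longrightarrow> c a j \<in> polys n"
  shows "mu (\<lambda>j. \<Sum>a\<in>A. c a j) = \<zero>\<^bsub>M\<^esub>"
  using assms
proof (induction A rule: infinite_finite_induct)
  case (insert a A)
  then have "mu (\<lambda>j. c a j + (\<Sum>a\<in>A. c a j)) = mu (c a) \<oplus>\<^bsub>M\<^esub> mu (\<lambda>j. \<Sum>a\<in>A. c a j)"
    by (intro mu_add polys_sum) auto
  then show ?case using insert by simp
qed simp_all

context zero_dim
begin

section \<open>The module of differentials and its generators dX_j\<close>

abbreviation "KF \<equiv> free_module R (carrier R)"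
abbreviation "Krels \<equiv> kaehler_rels (base_field :: 'k ring) (coord_map n I) R"
abbreviation "KN \<equiv> kaehler_rel_submodule (base_field :: 'k ring) (coord_map n I) R"
abbreviation "O1 \<equiv> Omega1 n I"
abbreviation "dd \<equiv> kaehler_d (base_field :: 'k ring) (coord_map n I) R"

interpretation KF: Module.module R KF by (rule R.free_module_module)

lemma Krels_closed: "Krels \<subseteq> carrier KF"
  by (auto simp: kaehler_rels_def Let_def coord_map_cl intro!: KF.minus_closed KF.a_closed KF.smult_closed R.free_gen_closed)

lemma kaehler_quot_mod: "quot_mod R KF KN"
  by (intro quot_mod.intro quot_mod_axioms.intro R.free_module_module)
    (simp add: kaehler_rel_submodule_def KF.span_is_submodule[OF Krels_closed])

interpretation KQ: quot_mod R KF KN by (rule kaehler_quot_mod)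

lemma Omega1_quot: "O1 = quot_module KF KN"
  by (simp add: Omega1_def kaehler_def)

lemma Omega1_module: "Module.module R O1"
  unfolding Omega1_quot by (rule KQ.quot_module_module)

interpretation O: Module.module R O1 by (rule Omega1_module)

lemma dd_proj: "dd s = KQ.proj (free_gen R (carrier R) s)"
  by (simp add: kaehler_d_def KQ.proj_def)

lemma dd_closed [simp]: "s \<in> carrier R \<Longrightarrow> dd s \<in> carrier O1"
  unfolding dd_proj Omega1_quot by (intro KQ.proj_closed R.free_gen_closed)

lemma Krels_KN: "\<rho> \<in> Krels \<Longrightarrow> \<rho> \<in> KN"
  unfolding kaehler_rel_submodule_def using KF.in_own_span[OF Krels_closed] by blast

lemma dd_add: 
  assumes "r \<in> carrier R" "s \<in> carrier R" shows "dd (r \<oplus>\<^bsub>R\<^esub> s) = dd r \<oplus>\<^bsub>O1\<^esub> dd s"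
proof -
  let ?e = "free_gen R (carrier R)"
  have "?e (r \<oplus>\<^bsub>R\<^esub> s) \<ominus>\<^bsub>KF\<^esub> (?e r \<oplus>\<^bsub>KF\<^esub> ?e s) \<in> Krels"
    using assms by (auto simp: kaehler_rels_def Let_def)
  then have "KQ.proj (?e (r \<oplus>\<^bsub>R\<^esub> s)) = KQ.proj (?e r \<oplus>\<^bsub>KF\<^esub> ?e s)"
    using assms by (intro KQ.proj_eqI Krels_KN) (auto intro!: KF.a_closed R.free_gen_closed)
  then show ?thesis using assms
    by (simp add: dd_proj Omega1_quot KQ.add_quot R.free_gen_closed)
qed

lemma dd_mult: 
  assumes "r \<in> carrier R" "s \<in> carrier R" 
  shows "dd (r \<otimes>\<^bsub>R\<^esub> s) = r \<odot>\<^bsub>O1\<^esub> dd s \<oplus>\<^bsub>O1\<^esub> s \<odot>\<^bsub>O1\<^esub> dd r"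
proof -
  let ?e = "free_gen R (carrier R)"
  have "?e (r \<otimes>\<^bsub>R\<^esub> s) \<ominus>\<^bsub>KF\<^esub> (r \<odot>\<^bsub>KF\<^esub> ?e s \<oplus>\<^bsub>KF\<^esub> s \<odot>\<^bsub>KF\<^esub> ?e r) \<in> Krels"
    using assms by (auto simp: kaehler_rels_def Let_def)
  then have "KQ.proj (?e (r \<otimes>\<^bsub>R\<^esub> s)) = KQ.proj (r \<odot>\<^bsub>KF\<^esub> ?e s \<oplus>\<^bsub>KF\<^esub> s \<odot>\<^bsub>KF\<^esub> ?e r)"
    using assms by (intro KQ.proj_eqI Krels_KN) (auto intro!: KF.a_closed KF.smult_closed R.free_gen_closed)
  then show ?thesis using assms
    by (simp add: dd_proj Omega1_quot KQ.add_quot KQ.smult_quot R.free_gen_closed)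
qed

lemma dd_const: "dd (cl (Poly_Mapping.single 0 c)) = \<zero>\<^bsub>O1\<^esub>"
proof -
  have "free_gen R (carrier R) (coord_map n I c) \<in> Krels"
    by (auto simp: kaehler_rels_def Let_def)
  then show ?thesis unfolding dd_proj Omega1_quot
    by (subst KQ.proj_eq_0_iff) (auto simp: coord_map_cl intro!: R.free_gen_closed Krels_KN)
qed

lemma Omega1_induct [consumes 1, case_names zero add gen]:
  assumes w: "w \<in> carrier O1" and zero: "P \<zero>\<^bsub>O1\<^esub>"
    and add: "\<And>v w. v \<in> carrier O1 \<Longrightarrow> w \<in> carrier O1 \<Longrightarrow> P v \<Longrightarrow> P w \<Longrightarrow> P (v \<oplus>\<^bsub>O1\<^esub> w)"
    and gen: "\<And>r s. r \<in> carrier R \<Longrightarrow> s \<in> carrier R \<Longrightarrow> P (r \<odot>\<^bsub>O1\<^esub> dd s)"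
  shows "P w"
proof -
  obtain f where f: "f \<in> carrier KF" "w = KQ.proj f"
    using w by (auto simp: Omega1_quot KQ.carrier_quot)
  from f(1) have "P (KQ.proj f)"
  proof (induction f rule: R.free_module_induct)
    case zero
    then show ?case using assms(2) by (simp add: Omega1_quot KQ.zero_quot)
  next
    case (add f g)
    then show ?case using assms(3)[of "KQ.proj f" "KQ.proj g"] by (simp add: Omega1_quot KQ.add_quot)
  next
    case (gen r b)
    then show ?case using assms(4)[of r b] 
      by (simp add: Omega1_quot KQ.smult_quot dd_proj R.free_gen_closed)
  qed
  then show ?thesis using f by simp
qed

end

sublocale zero_dim \<subseteq> O1: fg_module n I "Omega1 n I" "{..n}" 
  "\<lambda>j. kaehler_d (base_field :: 'k ring) (coord_map n I) (coord_ring n I) (cl (indet j))"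
  by (intro fg_module.intro zero_dim_axioms Omega1_module fg_module_axioms.intro) auto

context zero_dim
begin

text \<open>Both sides are additive, obey the Leibniz rule, vanish on constants and agree on the
  indeterminates.\<close>

lemma dd_pder: 
  assumes "g \<in> polys n" shows "dd (cl g) = O1.mu (\<lambda>j. pder j g)"
  using assms
proof (induction g rule: polys_induct)
  case (const c)
  then show ?case by (simp add: dd_const)
next
  case (indet i)
  then show ?case using O1.mu_single[of i 1] by (simp add: pder_indet cl_1)
next
  case (add p q)
  then show ?case using O1.mu_add[of "\<lambda>j. pder j p" "\<lambda>j. pder j q"] 
    by (simp add: cl_add dd_add pder_add)
next
  case (mult p q)
  have "O1.mu (\<lambda>j. pder j (p * q)) = O1.mu (\<lambda>j. p * pder j q) \<oplus>\<^bsub>O1\<^esub> O1.mu (\<lambda>j. q * pder j p)"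
    unfolding pder_mult using mult by (intro O1.mu_add) auto
  also have "\<dots> = cl p \<odot>\<^bsub>O1\<^esub> dd (cl q) \<oplus>\<^bsub>O1\<^esub> cl q \<odot>\<^bsub>O1\<^esub> dd (cl p)"
    using mult by (simp add: O1.mu_smult)
  finally show ?case using mult by (simp add: cl_mult dd_mult)
qed

lemma O1_mu_surj:
  assumes "w \<in> carrier O1"
  obtains p where "\<And>j. p j \<in> polys n" "O1.mu p = w"
proof -
  from assms have "\<exists>p. (\<forall>j. p j \<in> polys n) \<and> O1.mu p = w"
  proof (induction w rule: Omega1_induct)
    case zero
    show ?case by (intro exI[of _ "\<lambda>_. 0"]) simp
  next
    case (add v w)
    then obtain p q where "\<forall>j. p j \<in> polys n" "O1.mu p = v" "\<forall>j. q j \<in> polys n" "O1.mu q = w" by blast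
    then show ?case by (intro exI[of _ "\<lambda>j. p j + q j"]) (simp add: O1.mu_add)
  next
    case (gen r s)
    then show ?case
      by (intro exI[of _ "\<lambda>j. rep r * pder j (rep s)"]) (simp add: O1.mu_smult dd_pder[symmetric])
  qed
  then show ?thesis using that by blast
qed

text \<open>This set is clearly contained in the kernel \<open>G\<close>; that it is all of \<open>G\<close> says that \<open>G\<close> is graded.\<close>

definition O1_relations :: "(nat \<Rightarrow> 'k mpoly) set" where
  "O1_relations = {p. (\<forall>j\<le>n. p j \<in> polys n) \<and> (\<forall>e. O1.mu (\<lambda>j. hcomp e (p j)) = \<zero>\<^bsub>O1\<^esub>)}"

text \<open>A component of \<open>p * u\<close> is a convolution of components of \<open>p\<close>
  with components of \<open>u\<close>, and \<open>mu\<close> kills each of its terms.\<close>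

lemma poly_submodule_O1_relations: "poly_submodule n I {..n} O1_relations"
proof (intro poly_submodule.intro zero_dim_axioms poly_submodule_axioms.intro)
  fix c :: "nat \<Rightarrow> 'k mpoly" assume "\<And>j. j \<in> {..n} \<Longrightarrow> c j \<in> I"
  then show "c \<in> O1_relations" by (auto simp: O1_relations_def J_polys intro!: O1.mu_eq_0I hcomp_I)
next
  fix u v assume "u \<in> O1_relations" "v \<in> O1_relations"
  then have uv: "\<And>j. j \<in> {..n} \<Longrightarrow> u j \<in> polys n" "\<And>j. j \<in> {..n} \<Longrightarrow> v j \<in> polys n"
    "\<And>e. O1.mu (\<lambda>j. hcomp e (u j)) = \<zero>\<^bsub>O1\<^esub>" "\<And>e. O1.mu (\<lambda>j. hcomp e (v j)) = \<zero>\<^bsub>O1\<^esub>"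
    by (simp_all add: O1_relations_def)
  have "O1.mu (\<lambda>j. hcomp e (u j) + hcomp e (v j)) = \<zero>\<^bsub>O1\<^esub>" for e
    by (subst O1.mu_add) (simp_all add: uv)
  then show "(\<lambda>j. u j + v j) \<in> O1_relations" using uv by (simp add: O1_relations_def hcomp_add)
next
  fix p :: "'k mpoly" and u assume p: "p \<in> polys n" and u: "u \<in> O1_relations"
  have u': "\<And>j. j \<in> {..n} \<Longrightarrow> u j \<in> polys n" "\<And>e. O1.mu (\<lambda>j. hcomp e (u j)) = \<zero>\<^bsub>O1\<^esub>"
    using u by (simp_all add: O1_relations_def)
  have "O1.mu (\<lambda>j. hcomp a p * hcomp e (u j)) = \<zero>\<^bsub>O1\<^esub>" for a e
    using p by (subst O1.mu_smult) (simp_all add: u')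
  then have "O1.mu (\<lambda>j. hcomp e (p * u j)) = \<zero>\<^bsub>O1\<^esub>" for e
    unfolding hcomp_mult[OF finite_degs subset_refl]
    using p u' by (intro O1.mu_sum_eq_0) simp_all
  then show "(\<lambda>j. p * u j) \<in> O1_relations" using p u by (auto simp: O1_relations_def)
qed

interpretation O1_relations: poly_submodule n I "{..n}" O1_relations by (rule poly_submodule_O1_relations)

text \<open>The components of \<open>g\<close> are again in I, so their classes are 0 and have zero
  differential; the gradient expresses this differential in the generators.\<close>

lemma pder_I_O1_relations: 
  assumes "g \<in> I" shows "(\<lambda>j. pder j g) \<in> O1_relations"
proof -
  have "O1.mu (\<lambda>j. hcomp e (pder j g)) = \<zero>\<^bsub>O1\<^esub>" for e
  proof -
    have h: "hcomp (e + 1) g \<in> I" by (rule hcomp_I[OF assms])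
    then have "cl (hcomp (e + 1) g) = cl (Poly_Mapping.single 0 0)"
      by (subst cl_eq_iff) (auto simp: J_polys)
    then show ?thesis unfolding hcomp_pder using dd_pder[of "hcomp (e + 1) g"] h J_polys dd_const by metis
  qed
  then show ?thesis using assms J_polys by (auto simp: O1_relations_def)
qed

lemma pder_cong_I_O1_relations: "cong_I f g \<Longrightarrow> (\<lambda>j. pder j f - pder j g) \<in> O1_relations"
  using pder_I_O1_relations[of "f - g"] by (simp add: cong_I_def pder_diff)

text \<open>The backward map sends the symbol of \<open>s\<close> to the gradient of a
  representative. Representatives respect sums, products and constants only up to elements of I, and
  gradients of elements of I are graded relations.\<close>

lemma Phi_kaehler_rels:
  assumes "\<rho> \<in> Krels" shows "Phi (carrier R) (\<lambda>s j. pder j (rep s)) \<rho> \<in> O1_relations"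
proof -
  interpret KF: Module.module R KF by (rule R.free_module_module)
  let ?e = "free_gen R (carrier R)" and ?h = "\<lambda>s j. pder j (rep s)"
  let ?P = "Phi (carrier R) ?h"
  have h: "\<And>b j. b \<in> carrier R \<Longrightarrow> ?h b j \<in> polys n" by simp
  note e = R.free_gen_closed
  from assms consider 
    (add) r s where "r \<in> carrier R" "s \<in> carrier R" "\<rho> = ?e (r \<oplus>\<^bsub>R\<^esub> s) \<ominus>\<^bsub>KF\<^esub> (?e r \<oplus>\<^bsub>KF\<^esub> ?e s)"
  | (mult) r s where "r \<in> carrier R" "s \<in> carrier R" "\<rho> = ?e (r \<otimes>\<^bsub>R\<^esub> s) \<ominus>\<^bsub>KF\<^esub> (r \<odot>\<^bsub>KF\<^esub> ?e s \<oplus>\<^bsub>KF\<^esub> s \<odot>\<^bsub>KF\<^esub> ?e r)"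
  | (const) c where "\<rho> = ?e (coord_map n I c)"
    by (auto simp: kaehler_rels_def Let_def)
  then show ?thesis
  proof cases
    case add
    have "cong_I (?P \<rho> j) (?h (r \<oplus>\<^bsub>R\<^esub> s) j - (?h r j + ?h s j))" for j
    proof -
      have "cong_I (?P \<rho> j) (?P (?e (r \<oplus>\<^bsub>R\<^esub> s)) j - ?P (?e r \<oplus>\<^bsub>KF\<^esub> ?e s) j)"
        unfolding add(3) using add by (intro Phi_minus h) (auto intro!: e)
      also have "cong_I \<dots> (?h (r \<oplus>\<^bsub>R\<^esub> s) j - (?P (?e r) j + ?P (?e s) j))"
        using add by (intro cong_I_diff Phi_gen Phi_add h) (auto intro!: e)
      also have "cong_I \<dots> (?h (r \<oplus>\<^bsub>R\<^esub> s) j - (?h r j + ?h s j))"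
        using add by (intro cong_I_diff cong_I_refl cong_I_add Phi_gen h) auto
      finally show ?thesis .
    qed
    moreover have "(\<lambda>j. ?h (r \<oplus>\<^bsub>R\<^esub> s) j - (?h r j + ?h s j)) \<in> O1_relations"
      using pder_cong_I_O1_relations[OF cong_I_rep_add[OF add(1,2)]] by (simp add: pder_add)
    ultimately show ?thesis using O1_relations.U_cong by blast
  next
    case mult
    have "cong_I (?P \<rho> j) (?h (r \<otimes>\<^bsub>R\<^esub> s) j - (rep r * ?h s j + rep s * ?h r j))" for j
    proof -
      have "cong_I (?P \<rho> j) (?P (?e (r \<otimes>\<^bsub>R\<^esub> s)) j - ?P (r \<odot>\<^bsub>KF\<^esub> ?e s \<oplus>\<^bsub>KF\<^esub> s \<odot>\<^bsub>KF\<^esub> ?e r) j)"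
        unfolding mult(3) using mult by (intro Phi_minus h) (auto intro!: e)
      also have "cong_I \<dots> (?h (r \<otimes>\<^bsub>R\<^esub> s) j - (?P (r \<odot>\<^bsub>KF\<^esub> ?e s) j + ?P (s \<odot>\<^bsub>KF\<^esub> ?e r) j))"
        using mult by (intro cong_I_diff Phi_gen Phi_add h) (auto intro!: e)
      also have "cong_I \<dots> (?h (r \<otimes>\<^bsub>R\<^esub> s) j - (rep r * ?P (?e s) j + rep s * ?P (?e r) j))"
        using mult by (intro cong_I_diff cong_I_refl cong_I_add Phi_smult h) (auto intro!: e)
      also have "cong_I \<dots> (?h (r \<otimes>\<^bsub>R\<^esub> s) j - (rep r * ?h s j + rep s * ?h r j))"
        using mult by (intro cong_I_diff cong_I_refl cong_I_add cong_I_mult_left Phi_gen h) auto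
      finally show ?thesis .
    qed
    moreover have "(\<lambda>j. ?h (r \<otimes>\<^bsub>R\<^esub> s) j - (rep r * ?h s j + rep s * ?h r j)) \<in> O1_relations"
      using pder_cong_I_O1_relations[OF cong_I_rep_mult[OF mult(1,2)]] by (simp add: pder_mult)
    ultimately show ?thesis using O1_relations.U_cong by blast
  next
    case const
    have "cong_I (?P \<rho> j) (?h (coord_map n I c) j)" for j
      unfolding const by (intro Phi_gen h) (auto simp: coord_map_cl)
    moreover have "(\<lambda>j. ?h (coord_map n I c) j) \<in> O1_relations"
      using pder_cong_I_O1_relations[OF cong_I_rep_cl[OF polys_const[of c]]] by (simp add: coord_map_cl)
    ultimately show ?thesis using O1_relations.U_cong by blast
  qed
qed

text \<open>The backward map returns \<open>p\<close> itself, up to graded relations, from the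
  relation with coefficients \<open>p\<close>; hence \<open>p\<close> is a graded relation.\<close>

lemma O1_kernel_graded:
  assumes "\<And>j. j \<le> n \<Longrightarrow> p j \<in> polys n" "O1.mu p = \<zero>\<^bsub>O1\<^esub>"
  shows "O1.mu (\<lambda>j. hcomp e (p j)) = \<zero>\<^bsub>O1\<^esub>"
proof -
  let ?h = "\<lambda>s j. pder j (rep s)"
  have "(\<lambda>j. \<Sum>i\<le>n. p i * ?h (cl (indet i)) j) \<in> O1_relations"
  proof (rule O1_relations.relation_in_U[where B = "carrier R" and rels = Krels and N = KN and g = "\<lambda>i. cl (indet i)"])
    show "KN = module_span R KF Krels" by (simp add: kaehler_rel_submodule_def)
    show "(\<Oplus>\<^bsub>quot_module KF KN\<^esub>a\<in>{..n}. cl (p a) \<odot>\<^bsub>quot_module KF KN\<^esub> (KN +>\<^bsub>KF\<^esub> free_gen R (carrier R) (cl (indet a)))) 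
        = \<zero>\<^bsub>quot_module KF KN\<^esub>"
      using assms(2) unfolding O1.mu_def by (simp add: Omega1_quot kaehler_d_def)
  qed (use assms(1) Krels_closed Phi_kaehler_rels in auto)
  \<comment> \<open>The chosen representative of the class of X_i may differ from X_i by an element
    of I; its gradient is corrected here.\<close>
  moreover have "(\<lambda>j. \<Sum>i\<le>n. p i * (?h (cl (indet i)) j - pder j (indet i))) \<in> O1_relations"
    using assms(1) by (intro O1_relations.U_sum O1_relations.U_smult pder_cong_I_O1_relations cong_I_rep_cl) auto
  ultimately have "(\<lambda>j. (\<Sum>i\<le>n. p i * ?h (cl (indet i)) j) - (\<Sum>i\<le>n. p i * (?h (cl (indet i)) j - pder j (indet i)))) \<in> O1_relations"
    by (rule O1_relations.U_diff)
  then have "p \<in> O1_relations"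
  proof (rule O1_relations.U_cong)
    fix j assume j: "j \<in> {..n}"
    have "(\<Sum>i\<le>n. p i * ?h (cl (indet i)) j) - (\<Sum>i\<le>n. p i * (?h (cl (indet i)) j - pder j (indet i)))
        = (\<Sum>i\<le>n. if j = i then p i else 0)"
      by (subst sum_subtractf[symmetric]) (intro sum.cong, auto simp: right_diff_distrib pder_indet)
    also have "\<dots> = p j" using j by simp
    finally show "cong_I (p j) ((\<Sum>i\<le>n. p i * ?h (cl (indet i)) j) - (\<Sum>i\<le>n. p i * (?h (cl (indet i)) j - pder j (indet i))))"
      by simp
  qed
  then show ?thesis by (simp add: O1_relations_def)
qed

text \<open>The shift by 1 is the degree of dX_j: expanding r ds in the dX_j, differentiation lowers
  the degree of \<open>s\<close> by 1.\<close>

lemma Omega1_grading_comp: "Omega1_grading n I d = O1.comp (d - 1)"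
proof
  let ?S = "{r \<odot>\<^bsub>O1\<^esub> dd s | r s i j. r \<in> coord_grading n I i \<and> s \<in> coord_grading n I j \<and> i + j = d}"
  have gr: "Omega1_grading n I d = O1.W.span ?S"
    by (simp add: Omega1_grading_def kaehler_grading_def Omega1_def)
  have S: "?S \<subseteq> O1.comp (d - 1)"
  proof
    fix x assume "x \<in> ?S"
    then obtain r s i j where x: "x = r \<odot>\<^bsub>O1\<^esub> dd s" "r \<in> coord_grading n I i" "s \<in> coord_grading n I j" "i + j = d"
      by blast
    then obtain p g where pg: "r = cl p" "p \<in> homog_part n i" "s = cl g" "g \<in> homog_part n j"
      by (auto simp: coord_grading_cl)
    have "O1.mu (\<lambda>j. pder j g) \<in> O1.comp (j - 1)"
      using pg by (intro O1.compI) (auto simp: homog_part_iff homog_pder)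
    then show "x \<in> O1.comp (d - 1)"
      unfolding x(1) pg(1,3) using pg x(4) by (subst dd_pder) (auto simp: homog_part_iff intro!: O1.comp_smult)
  qed
  then show "Omega1_grading n I d \<subseteq> O1.comp (d - 1)"
    unfolding gr by (rule O1.W.module.span_is_subset[OF _ O1.comp_submodule])
  have "O1.comp (d - 1) \<subseteq> carrier O1.W" using O1.comp_closed by auto
  with S have SW: "?S \<subseteq> carrier O1.W" by (rule order.trans)
  show "O1.comp (d - 1) \<subseteq> Omega1_grading n I d"
  proof
    fix w assume "w \<in> O1.comp (d - 1)"
    then obtain c where c: "w = O1.mu c" "\<And>j. j \<in> {..n} \<Longrightarrow> c j \<in> homog_part n (d - 1)"
      by (auto simp: O1.comp_def)
    have "cl (c j) \<odot>\<^bsub>O1\<^esub> dd (cl (indet j)) \<in> O1.W.span ?S" if "j \<in> {..n}" for j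
    proof -
      have "cl (c j) \<in> coord_grading n I (d - 1)" "cl (indet j) \<in> coord_grading n I 1" "(d - 1) + 1 = d"
        using that c(2) by (auto simp: coord_grading_cl homog_part_iff)
      then have "cl (c j) \<odot>\<^bsub>O1\<^esub> dd (cl (indet j)) \<in> ?S" by blast
      then show ?thesis using O1.W.module.in_own_span[OF SW] by blast
    qed
    then show "w \<in> Omega1_grading n I d" unfolding gr c(1) O1.mu_def
      by (intro O1.submodule_finsum O1.W.module.span_is_submodule[OF SW]) auto
  qed
qed

lemma ri_Omega1_hf: "ri_Omega1 n I = regularity_index (\<lambda>d. O1.hf (d - 1))"
  unfolding ri_Omega1_def Omega1_grading_comp[abs_def] O1.hilbert_function_hf ..

end

section \<open>Exterior powers\<close>

lemma (in fg_module) mu_sum: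
  assumes "\<And>a j. a \<in> A \<Longrightarrow> j \<in> Js \<Longrightarrow> c a j \<in> polys n" "finite A"
  shows "mu (\<lambda>j. \<Sum>a\<in>A. c a j) = (\<Oplus>\<^bsub>M\<^esub>a\<in>A. mu (c a))"
  using assms(2,1)
proof (induction A rule: finite_induct)
  case (insert a A)
  have "mu (\<lambda>j. c a j + (\<Sum>a\<in>A. c a j)) = mu (c a) \<oplus>\<^bsub>M\<^esub> mu (\<lambda>j. \<Sum>a\<in>A. c a j)"
    using insert.prems by (intro mu_add polys_sum) auto
  also have "\<dots> = (\<Oplus>\<^bsub>M\<^esub>a\<in>insert a A. mu (c a))"
    using insert by (subst M.finsum_insert) auto
  finally show ?case using insert by simp
qed simp

text \<open>The comparison of \<open>p\<close> with \<open>q\<close> selects one term from each pair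
  exchanged by \<open>\<sigma>\<close>, so the terms cancel without any division by 2; those with
  \<open>p a = q a\<close> vanish by hypothesis.\<close>

lemma (in abelian_group) finsum_antisymmetric_involution:
  assumes "finite A" "g \<in> A \<rightarrow> carrier G" and \<sigma>: "\<And>a. a \<in> A \<Longrightarrow> \<sigma> a \<in> A" "\<And>a. a \<in> A \<Longrightarrow> \<sigma> (\<sigma> a) = a"
    and anti: "\<And>a. a \<in> A \<Longrightarrow> g (\<sigma> a) = \<ominus> g a" 
    and less: "\<And>a. a \<in> A \<Longrightarrow> p (\<sigma> a) < (q (\<sigma> a) :: nat) \<longleftrightarrow> q a < p a"
    and eq: "\<And>a. a \<in> A \<Longrightarrow> p a = q a \<Longrightarrow> g a = \<zero>"
  shows "(\<Oplus>a\<in>A. g a) = \<zero>"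
proof -
  let ?L = "{a \<in> A. p a < q a}" and ?G = "{a \<in> A. q a < p a}" and ?E = "{a \<in> A. p a = q a}"
  have G: "?G = \<sigma> ` ?L"
  proof
    show "\<sigma> ` ?L \<subseteq> ?G"
    proof
      fix b assume "b \<in> \<sigma> ` ?L"
      then obtain a where a: "a \<in> A" "p a < q a" "b = \<sigma> a" by blast
      then show "b \<in> ?G" using \<sigma>[OF a(1)] less[OF \<sigma>(1)[OF a(1)]] by simp
    qed
    show "?G \<subseteq> \<sigma> ` ?L"
    proof
      fix a assume a: "a \<in> ?G"
      then have "\<sigma> a \<in> ?L" "a = \<sigma> (\<sigma> a)" using \<sigma>[of a] less[of a] by simp_all
      then show "a \<in> \<sigma> ` ?L" by (rule rev_image_eqI)
    qed
  qed
  have inj: "inj_on \<sigma> ?L" by (rule inj_on_inverseI[where g = \<sigma>]) (simp add: \<sigma>)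
  have g: "g a \<in> carrier G" if "a \<in> A" for a using assms(2) that by blast
  have "(\<Oplus>a\<in>?G. g a) = (\<Oplus>a\<in>?L. g (\<sigma> a))"
    unfolding G by (rule finsum_reindex[OF _ inj]) (use g \<sigma> in auto)
  also have "\<dots> = (\<Oplus>a\<in>?L. \<ominus> g a)"
    using g anti by (intro finsum_cong') auto
  finally have "(\<Oplus>a\<in>?L. g a) \<oplus> (\<Oplus>a\<in>?G. g a) = (\<Oplus>a\<in>?L. g a \<oplus> \<ominus> g a)"
    using g by (subst finsum_addf) auto
  also have "\<dots> = \<zero>" using g by (intro finsum_all0) (auto simp: r_neg)
  finally have LG: "(\<Oplus>a\<in>?L. g a) \<oplus> (\<Oplus>a\<in>?G. g a) = \<zero>" .
  have "A = (?L \<union> ?G) \<union> ?E" by auto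
  then have "(\<Oplus>a\<in>A. g a) = (\<Oplus>a\<in>(?L \<union> ?G) \<union> ?E. g a)" by simp
  also have "\<dots> = (\<Oplus>a\<in>?L \<union> ?G. g a) \<oplus> (\<Oplus>a\<in>?E. g a)"
    using assms(1) g by (intro finsum_Un_disjoint) auto
  also have "(\<Oplus>a\<in>?L \<union> ?G. g a) = (\<Oplus>a\<in>?L. g a) \<oplus> (\<Oplus>a\<in>?G. g a)"
    using assms(1) g by (intro finsum_Un_disjoint) auto
  also have "(\<Oplus>a\<in>?E. g a) = \<zero>" using eq by (intro finsum_all0) auto
  finally show ?thesis using LG by simp
qed

section \<open>Wedge products\<close>

locale exterior = zero_dim n I for n and I :: "'k::field mpoly set" +
  fixes m :: nat
begin

text \<open>All index lists, not only the increasing ones: they index a basis of the m-fold tensor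
  power of R^{n+1}, and alternation is left to the relations.\<close>

definition idx :: "nat list set" where
  "idx = {J. set J \<subseteq> {..n} \<and> length J = m}"

abbreviation "tup \<equiv> tuples m O1"
abbreviation "EF \<equiv> free_module R tup"
abbreviation "Erels \<equiv> exterior_rels R m O1"
abbreviation "EN \<equiv> exterior_rel_submodule R m O1"
abbreviation "OM \<equiv> Omega n I m"
abbreviation "wd \<equiv> wedge R m O1"
abbreviation "dX \<equiv> \<lambda>j. dd (cl (indet j))"

interpretation EF: Module.module R EF by (rule R.free_module_module)

lemma finite_idx: "finite idx"
  unfolding idx_def by (rule finite_lists_length_eq) simp

lemma idx_nth: "J \<in> idx \<Longrightarrow> k < m \<Longrightarrow> J ! k \<le> n"
  unfolding idx_def using nth_mem by fastforce

lemma idx_update: "J \<in> idx \<Longrightarrow> j \<le> n \<Longrightarrow> J[k := j] \<in> idx"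
  unfolding idx_def using set_update_subset_insert[of J k j] by auto

lemma tup_update: "xs \<in> tup \<Longrightarrow> x \<in> carrier O1 \<Longrightarrow> xs[i := x] \<in> tup"
  unfolding tuples_def using set_update_subset_insert[of xs i x] by auto

lemma tup_nth: "xs \<in> tup \<Longrightarrow> k < m \<Longrightarrow> xs ! k \<in> carrier O1"
  unfolding tuples_def by auto

lemma idx_tup: "J \<in> idx \<Longrightarrow> map dX J \<in> tup"
  unfolding idx_def tuples_def by auto

lemma Erels_closed: "Erels \<subseteq> carrier EF"
  by (auto simp: exterior_rels_def Let_def intro!: EF.minus_closed EF.a_closed EF.smult_closed R.free_gen_closed tup_update)

lemma exterior_quot_mod: "quot_mod R EF EN"
  by (intro quot_mod.intro quot_mod_axioms.intro R.free_module_module)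
    (simp add: exterior_rel_submodule_def EF.span_is_submodule[OF Erels_closed])

interpretation EQ: quot_mod R EF EN by (rule exterior_quot_mod)

lemma Omega_quot: "OM = quot_module EF EN"
  by (simp add: Omega_def exterior_power_def)

lemma Omega_module: "Module.module R OM"
  unfolding Omega_quot by (rule EQ.quot_module_module)

interpretation OM: Module.module R OM by (rule Omega_module)

lemma wd_proj: "wd xs = EQ.proj (free_gen R tup xs)"
  by (simp add: wedge_def EQ.proj_def)

lemma wd_closed: "xs \<in> tup \<Longrightarrow> wd xs \<in> carrier OM"
  unfolding wd_proj Omega_quot by (intro EQ.proj_closed R.free_gen_closed)

lemma Erels_EN: "\<rho> \<in> Erels \<Longrightarrow> \<rho> \<in> EN"
  unfolding exterior_rel_submodule_def using EF.in_own_span[OF Erels_closed] by blast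

lemma wd_add:
  assumes "xs \<in> tup" "i < m" "x \<in> carrier O1" "y \<in> carrier O1"
  shows "wd (xs[i := x \<oplus>\<^bsub>O1\<^esub> y]) = wd (xs[i := x]) \<oplus>\<^bsub>OM\<^esub> wd (xs[i := y])"
proof -
  let ?e = "free_gen R tup"
  have "?e (xs[i := x \<oplus>\<^bsub>O1\<^esub> y]) \<ominus>\<^bsub>EF\<^esub> (?e (xs[i := x]) \<oplus>\<^bsub>EF\<^esub> ?e (xs[i := y])) \<in> Erels"
    unfolding exterior_rels_def Let_def using assms by blast
  then have "EQ.proj (?e (xs[i := x \<oplus>\<^bsub>O1\<^esub> y])) = EQ.proj (?e (xs[i := x]) \<oplus>\<^bsub>EF\<^esub> ?e (xs[i := y]))"
    using assms by (intro EQ.proj_eqI Erels_EN) (auto intro!: EF.a_closed R.free_gen_closed tup_update)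
  then show ?thesis using assms
    by (simp add: wd_proj Omega_quot EQ.add_quot R.free_gen_closed tup_update)
qed

lemma wd_smult:
  assumes "xs \<in> tup" "i < m" "r \<in> carrier R" "x \<in> carrier O1"
  shows "wd (xs[i := r \<odot>\<^bsub>O1\<^esub> x]) = r \<odot>\<^bsub>OM\<^esub> wd (xs[i := x])"
proof -
  let ?e = "free_gen R tup"
  have "?e (xs[i := r \<odot>\<^bsub>O1\<^esub> x]) \<ominus>\<^bsub>EF\<^esub> r \<odot>\<^bsub>EF\<^esub> ?e (xs[i := x]) \<in> Erels"
    unfolding exterior_rels_def Let_def using assms by blast
  then have "EQ.proj (?e (xs[i := r \<odot>\<^bsub>O1\<^esub> x])) = EQ.proj (r \<odot>\<^bsub>EF\<^esub> ?e (xs[i := x]))"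
    using assms by (intro EQ.proj_eqI Erels_EN) (auto intro!: EF.smult_closed R.free_gen_closed tup_update)
  then show ?thesis using assms
    by (simp add: wd_proj Omega_quot EQ.smult_quot R.free_gen_closed tup_update)
qed

lemma wd_alt:
  assumes "xs \<in> tup" "i < j" "j < m" "xs ! i = xs ! j" shows "wd xs = \<zero>\<^bsub>OM\<^esub>"
proof -
  have "free_gen R tup xs \<in> Erels"
    unfolding exterior_rels_def Let_def using assms by blast
  then show ?thesis unfolding wd_proj Omega_quot using assms
    by (subst EQ.proj_eq_0_iff) (auto intro!: R.free_gen_closed Erels_EN)
qed

lemma wd_zero: 
  assumes "xs \<in> tup" "i < m" shows "wd (xs[i := \<zero>\<^bsub>O1\<^esub>]) = \<zero>\<^bsub>OM\<^esub>"
  using wd_smult[OF assms, of "\<zero>\<^bsub>R\<^esub>" "\<zero>\<^bsub>O1\<^esub>"] assms by (simp add: wd_closed tup_update)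

lemma wd_finsum:
  assumes "xs \<in> tup" "i < m" "finite A" "\<And>a. a \<in> A \<Longrightarrow> r a \<in> carrier R" "\<And>a. a \<in> A \<Longrightarrow> v a \<in> carrier O1"
  shows "wd (xs[i := \<Oplus>\<^bsub>O1\<^esub>a\<in>A. r a \<odot>\<^bsub>O1\<^esub> v a]) = (\<Oplus>\<^bsub>OM\<^esub>a\<in>A. r a \<odot>\<^bsub>OM\<^esub> wd (xs[i := v a]))"
  using assms(3-5)
proof (induction A rule: finite_induct)
  case empty
  then show ?case using wd_zero[OF assms(1,2)] by simp
next
  case (insert a A)
  have "(\<Oplus>\<^bsub>O1\<^esub>a\<in>insert a A. r a \<odot>\<^bsub>O1\<^esub> v a) = r a \<odot>\<^bsub>O1\<^esub> v a \<oplus>\<^bsub>O1\<^esub> (\<Oplus>\<^bsub>O1\<^esub>a\<in>A. r a \<odot>\<^bsub>O1\<^esub> v a)"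
    using insert by (intro O1.M.finsum_insert) auto
  then have "wd (xs[i := \<Oplus>\<^bsub>O1\<^esub>a\<in>insert a A. r a \<odot>\<^bsub>O1\<^esub> v a]) = 
      r a \<odot>\<^bsub>OM\<^esub> wd (xs[i := v a]) \<oplus>\<^bsub>OM\<^esub> wd (xs[i := \<Oplus>\<^bsub>O1\<^esub>a\<in>A. r a \<odot>\<^bsub>O1\<^esub> v a])"
    using insert.prems assms(1,2) by (simp add: wd_add wd_smult O1.M.finsum_closed Pi_def)
  also have "\<dots> = r a \<odot>\<^bsub>OM\<^esub> wd (xs[i := v a]) \<oplus>\<^bsub>OM\<^esub> (\<Oplus>\<^bsub>OM\<^esub>a\<in>A. r a \<odot>\<^bsub>OM\<^esub> wd (xs[i := v a]))"
    using insert by simp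
  also have "\<dots> = (\<Oplus>\<^bsub>OM\<^esub>a\<in>insert a A. r a \<odot>\<^bsub>OM\<^esub> wd (xs[i := v a]))"
    using insert assms(1) by (intro OM.finsum_insert[symmetric]) (auto intro!: wd_closed tup_update)
  finally show ?case .
qed

definition swap :: "nat \<Rightarrow> nat \<Rightarrow> 'a list \<Rightarrow> 'a list" where
  "swap k l J = J[k := J ! l, l := J ! k]"

text \<open>Polarization: the wedge with \<open>x \<oplus> y\<close> in both slots vanishes, and so
  do two of the four terms of its expansion.\<close>

lemma wd_swap:
  assumes xs: "xs \<in> tup" and kl: "k < l" "l < m"
  shows "wd (swap k l xs) = \<ominus>\<^bsub>OM\<^esub> wd xs"
proof -
  define x y where "x = xs ! k" and "y = xs ! l"
  have xy: "x \<in> carrier O1" "y \<in> carrier O1" using tup_nth[OF xs] kl by (auto simp: x_def y_def)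
  have len: "length xs = m" using xs by (simp add: tuples_def)
  let ?T = "\<lambda>a b. wd (xs[k := a, l := b])"
  have Tc: "?T a b \<in> carrier OM" if "a \<in> carrier O1" "b \<in> carrier O1" for a b
    using that xs by (intro wd_closed tup_update)
  have T0: "?T a a = \<zero>\<^bsub>OM\<^esub>" if "a \<in> carrier O1" for a
    using that xs kl len by (intro wd_alt[of _ k l] tup_update) auto
  have Tr: "?T a (b \<oplus>\<^bsub>O1\<^esub> c) = ?T a b \<oplus>\<^bsub>OM\<^esub> ?T a c" 
    if "a \<in> carrier O1" "b \<in> carrier O1" "c \<in> carrier O1" for a b c
    using that xs kl by (intro wd_add tup_update) auto
  have Tl: "?T (b \<oplus>\<^bsub>O1\<^esub> c) a = ?T b a \<oplus>\<^bsub>OM\<^esub> ?T c a" 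
    if "a \<in> carrier O1" "b \<in> carrier O1" "c \<in> carrier O1" for a b c
  proof -
    have "wd (xs[l := a, k := b \<oplus>\<^bsub>O1\<^esub> c]) = wd (xs[l := a, k := b]) \<oplus>\<^bsub>OM\<^esub> wd (xs[l := a, k := c])"
      using that xs kl by (intro wd_add tup_update) auto
    then show ?thesis using kl by (simp add: list_update_swap)
  qed
  have "\<zero>\<^bsub>OM\<^esub> = ?T (x \<oplus>\<^bsub>O1\<^esub> y) (x \<oplus>\<^bsub>O1\<^esub> y)" using T0 xy by simp
  also have "\<dots> = ?T x (x \<oplus>\<^bsub>O1\<^esub> y) \<oplus>\<^bsub>OM\<^esub> ?T y (x \<oplus>\<^bsub>O1\<^esub> y)"
    using xy by (intro Tl O1.M.a_closed)
  also have "\<dots> = (?T x x \<oplus>\<^bsub>OM\<^esub> ?T x y) \<oplus>\<^bsub>OM\<^esub> (?T y x \<oplus>\<^bsub>OM\<^esub> ?T y y)"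
    using xy by (simp only: Tr)
  also have "\<dots> = ?T y x \<oplus>\<^bsub>OM\<^esub> ?T x y" using xy T0 Tc by (simp add: OM.a_comm)
  finally have "?T y x = \<ominus>\<^bsub>OM\<^esub> ?T x y" 
    using OM.minus_equality[of "?T y x" "?T x y"] Tc xy by simp
  moreover have "xs[k := x, l := y] = xs" by (simp add: x_def y_def)
  ultimately show ?thesis by (simp add: swap_def x_def y_def)
qed

end

sublocale exterior \<subseteq> Om: fg_module n I "Omega n I m" idx 
  "\<lambda>J. wedge (coord_ring n I) m (Omega1 n I) 
     (map (\<lambda>j. kaehler_d (base_field :: 'k ring) (coord_map n I) (coord_ring n I) (cl (indet j))) J)"
  by (intro fg_module.intro zero_dim_axioms Omega_module fg_module_axioms.intro finite_idx wd_closed idx_tup)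

section \<open>Relations among the wedges of the dX_j\<close>

context exterior
begin


text \<open>In \<open>slot\<close>, resetting the \<open>k\<close>-th entry to \<open>0\<close> expresses that \<open>\<gamma>\<close> depends on the other entries only.\<close>

inductive_set wedge_relations :: "(nat list \<Rightarrow> 'k mpoly) set" where
  ideal: "(\<And>J. J \<in> idx \<Longrightarrow> c J \<in> I) \<Longrightarrow> c \<in> wedge_relations"
| sym: "k < l \<Longrightarrow> l < m \<Longrightarrow> (\<And>J. c J \<in> polys n) \<Longrightarrow> (\<And>J. J \<in> idx \<Longrightarrow> c (swap k l J) = c J) \<Longrightarrow> c \<in> wedge_relations"
| slot: "k < m \<Longrightarrow> (\<And>L j. \<gamma> L j \<in> polys n) \<Longrightarrow> (\<And>L. O1.mu (\<gamma> L) = \<zero>\<^bsub>O1\<^esub>) \<Longrightarrow> 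
    (\<lambda>J. \<gamma> (J[k := 0]) (J ! k)) \<in> wedge_relations"
| add: "u \<in> wedge_relations \<Longrightarrow> v \<in> wedge_relations \<Longrightarrow> (\<lambda>J. u J + v J) \<in> wedge_relations"

lemma wedge_relations_polys: "u \<in> wedge_relations \<Longrightarrow> J \<in> idx \<Longrightarrow> u J \<in> polys n"
  by (induction u rule: wedge_relations.induct) (auto intro: J_polys)

lemma wedge_relations_smult: 
  assumes p: "p \<in> polys n" and "u \<in> wedge_relations" shows "(\<lambda>J. p * u J) \<in> wedge_relations"
  using assms(2)
proof (induction u rule: wedge_relations.induct)
  case (ideal c)
  then show ?case using p by (intro wedge_relations.ideal J_mult)
next
  case (sym k l c)
  then show ?case using p by (intro wedge_relations.sym[of k l]) auto
next
  case (slot k \<gamma>)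
  have "O1.mu (\<lambda>j. p * \<gamma> L j) = \<zero>\<^bsub>O1\<^esub>" for L
    using slot p by (subst O1.mu_smult) auto
  then show ?case using slot p wedge_relations.slot[of k "\<lambda>L j. p * \<gamma> L j"] by simp
next
  case (add u v)
  then show ?case using wedge_relations.add[of "\<lambda>J. p * u J" "\<lambda>J. p * v J"] by (simp add: distrib_left)
qed

sublocale wedge_relations: poly_submodule n I idx wedge_relations
  by (intro poly_submodule.intro zero_dim_axioms poly_submodule_axioms.intro)
    (auto intro: wedge_relations.ideal wedge_relations.add wedge_relations_smult)

lemma swap_idx: "J \<in> idx \<Longrightarrow> k < m \<Longrightarrow> l < m \<Longrightarrow> swap k l J \<in> idx"
  unfolding swap_def by (intro idx_update idx_nth)

text \<open>Coefficients symmetric in positions \<open>k\<close> and \<open>l\<close> meet wedges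
  antisymmetric in them, so exchanging the entries pairs off the terms; a term with equal entries
  has a repeated factor.\<close>

lemma mu_symmetric_eq_0:
  assumes kl: "k < l" "l < m" and c: "\<And>J. J \<in> idx \<Longrightarrow> c J \<in> polys n" "\<And>J. J \<in> idx \<Longrightarrow> c (swap k l J) = c J"
  shows "Om.mu c = \<zero>\<^bsub>OM\<^esub>"
  unfolding Om.mu_def
proof (rule Om.M.finsum_antisymmetric_involution[where \<sigma> = "swap k l" and p = "\<lambda>J. J ! k" and q = "\<lambda>J. J ! l", OF finite_idx])
  show "(\<lambda>J. cl (c J) \<odot>\<^bsub>OM\<^esub> wd (map dX J)) \<in> idx \<rightarrow> carrier OM"
    using c by (auto intro!: Om.M.smult_closed wd_closed idx_tup)
  fix J assume J: "J \<in> idx"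
  then have len: "length J = m" by (simp add: idx_def)
  show "swap k l J \<in> idx" using J kl by (simp add: swap_idx)
  show "swap k l (swap k l J) = J"
    using kl len by (auto simp: swap_def list_eq_iff_nth_eq nth_list_update)
  show "swap k l J ! k < swap k l J ! l \<longleftrightarrow> J ! l < J ! k"
    using kl len by (auto simp: swap_def nth_list_update)
  have "map dX (swap k l J) = swap k l (map dX J)"
    using kl len by (simp add: swap_def map_update)
  then show "cl (c (swap k l J)) \<odot>\<^bsub>OM\<^esub> wd (map dX (swap k l J)) = \<ominus>\<^bsub>OM\<^esub> (cl (c J) \<odot>\<^bsub>OM\<^esub> wd (map dX J))"
    using wd_swap[OF idx_tup[OF J] kl] c J by (simp add: Om.M.smult_r_minus wd_closed idx_tup)
  assume "J ! k = J ! l"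
  then have "wd (map dX J) = \<zero>\<^bsub>OM\<^esub>"
    using kl len by (intro wd_alt[OF idx_tup[OF J], of k l]) auto
  then show "cl (c J) \<odot>\<^bsub>OM\<^esub> wd (map dX J) = \<zero>\<^bsub>OM\<^esub>" using c J by simp
qed

text \<open>With all entries but the \<open>k\<close>-th fixed, the terms add up by multilinearity
  to a wedge with \<open>O1.mu (\<gamma> L)\<close>, which is 0, in slot \<open>k\<close>.\<close>

lemma mu_slot_eq_0:
  assumes k: "k < m" and \<gamma>: "\<And>L j. \<gamma> L j \<in> polys n" "\<And>L. O1.mu (\<gamma> L) = \<zero>\<^bsub>O1\<^esub>"
  shows "Om.mu (\<lambda>J. \<gamma> (J[k := 0]) (J ! k)) = \<zero>\<^bsub>OM\<^esub>"
proof -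
  let ?K = "{L \<in> idx. L ! k = 0}"
  have fin: "finite ?K" using finite_idx by simp
  \<comment> \<open>Each \<open>J\<close> equals \<open>L[k := j]\<close> for exactly one pair,
    namely \<open>L = J[k := 0]\<close> and \<open>j = J ! k\<close>.\<close>
  have "Om.mu (\<lambda>J. \<gamma> (J[k := 0]) (J ! k)) = Om.mu (\<lambda>J. \<Sum>L\<in>?K. \<Sum>j\<le>n. if J = L[k := j] then \<gamma> L j else 0)"
  proof (rule Om.mu_cong)
    fix J assume J: "J \<in> idx"
    have len: "length J = m" using J by (simp add: idx_def)
    have "(\<Sum>L\<in>?K. \<Sum>j\<le>n. if J = L[k := j] then \<gamma> L j else 0) = 
      (\<Sum>L\<in>?K. if L = J[k := 0] then \<gamma> (J[k := 0]) (J ! k) else 0)"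
    proof (rule sum.cong[OF refl])
      fix L assume L: "L \<in> ?K"
      then have "length L = m" by (simp add: idx_def)
      have "J = L[k := j] \<longleftrightarrow> L = J[k := 0] \<and> j = J ! k" for j
      proof
        assume "J = L[k := j]"
        then show "L = J[k := 0] \<and> j = J ! k" using L k \<open>length L = m\<close> list_update_id[of L k] by simp
      qed simp
      then have "(\<Sum>j\<le>n. if J = L[k := j] then \<gamma> L j else 0) = (\<Sum>j\<le>n. if j = J ! k then (if L = J[k := 0] then \<gamma> L j else 0) else 0)"
        by (intro sum.cong) auto
      then show "(\<Sum>j\<le>n. if J = L[k := j] then \<gamma> L j else 0) = (if L = J[k := 0] then \<gamma> (J[k := 0]) (J ! k) else 0)"
        using idx_nth[OF J k] by simp
    qed
    also have "\<dots> = \<gamma> (J[k := 0]) (J ! k)"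
      using fin idx_update[OF J, of 0 k] k len by simp
    finally show "\<gamma> (J[k := 0]) (J ! k) - (\<Sum>L\<in>?K. \<Sum>j\<le>n. if J = L[k := j] then \<gamma> L j else 0) \<in> I" by simp
  qed (auto intro!: polys_sum \<gamma>)
  also have "\<dots> = (\<Oplus>\<^bsub>OM\<^esub>L\<in>?K. Om.mu (\<lambda>J. \<Sum>j\<le>n. if J = L[k := j] then \<gamma> L j else 0))"
    using fin by (intro Om.mu_sum) (auto intro!: polys_sum \<gamma>)
  also have "\<dots> = \<zero>\<^bsub>OM\<^esub>"
  proof (rule Om.M.finsum_all0)
    fix L assume L: "L \<in> ?K"
    have "Om.mu (\<lambda>J. \<Sum>j\<le>n. if J = L[k := j] then \<gamma> L j else 0) = 
        (\<Oplus>\<^bsub>OM\<^esub>j\<in>{..n}. Om.mu (\<lambda>J. if J = L[k := j] then \<gamma> L j else 0))"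
      by (intro Om.mu_sum) (auto intro!: \<gamma>)
    also have "\<dots> = (\<Oplus>\<^bsub>OM\<^esub>j\<in>{..n}. cl (\<gamma> L j) \<odot>\<^bsub>OM\<^esub> wd ((map dX L)[k := dX j]))"
      using L \<gamma> by (intro Om.M.finsum_cong') 
        (auto simp: Om.mu_single idx_update map_update intro!: Om.M.smult_closed wd_closed tup_update idx_tup)
    also have "\<dots> = wd ((map dX L)[k := O1.mu (\<gamma> L)])"
      unfolding O1.mu_def using L k \<gamma> by (intro wd_finsum[symmetric] idx_tup) auto
    also have "\<dots> = \<zero>\<^bsub>OM\<^esub>" unfolding \<gamma>(2) using L k by (intro wd_zero idx_tup) auto
    finally show "Om.mu (\<lambda>J. \<Sum>j\<le>n. if J = L[k := j] then \<gamma> L j else 0) = \<zero>\<^bsub>OM\<^esub>" .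
  qed
  finally show ?thesis .
qed

lemma wedge_relations_kernel: "u \<in> wedge_relations \<Longrightarrow> Om.mu u = \<zero>\<^bsub>OM\<^esub>"
proof (induction u rule: wedge_relations.induct)
  case (ideal c)
  then show ?case by (rule Om.mu_eq_0I)
next
  case (sym k l c)
  then show ?case by (intro mu_symmetric_eq_0) auto
next
  case (slot k \<gamma>)
  then show ?case by (intro mu_slot_eq_0) auto
next
  case (add u v)
  then show ?case by (subst Om.mu_add) (auto simp: wedge_relations_polys)
qed

text \<open>Division works on each kind of generator separately. In the symmetric case it is done by
  a function of the coefficient alone, so equal coefficients keep equal quotients. In the slot case
  the quotient of \<open>\<gamma> L\<close> has an image in Omega^1 killed by x_0, which
  \<open>inj\<close> forces to be 0.\<close>

lemma wedge_relations_divisible: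
  assumes div: "\<forall>p\<in>homog_part n (e + 1). \<exists>q\<in>homog_part n e. p - X0 * q \<in> I"
    and inj: "\<And>w. w \<in> O1.comp e \<Longrightarrow> cl X0 \<odot>\<^bsub>O1\<^esub> w = \<zero>\<^bsub>O1\<^esub> \<Longrightarrow> w = \<zero>\<^bsub>O1\<^esub>"
    and u: "u \<in> wedge_relations"
  shows "\<exists>v\<in>wedge_relations. \<forall>J\<in>idx. v J \<in> homog_part n e \<and> cong_I (hcomp (e + 1) (u J)) (X0 * v J)"
proof -
  \<comment> \<open>One choice for each polynomial, made independently of the index list at which
    the polynomial occurs.\<close>
  define dv where "dv p = (SOME q. q \<in> homog_part n e \<and> hcomp (e + 1) p - X0 * q \<in> I)" for p
  have dv: "dv p \<in> homog_part n e" "dv p \<in> polys n" "cong_I (hcomp (e + 1) p) (X0 * dv p)" if "p \<in> polys n" for p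
  proof -
    have "hcomp (e + 1) p \<in> homog_part n (e + 1)" using that by (simp add: homog_part_iff)
    then have "\<exists>q. q \<in> homog_part n e \<and> hcomp (e + 1) p - X0 * q \<in> I" using div by blast
    from someI_ex[OF this] show "dv p \<in> homog_part n e" "dv p \<in> polys n" "cong_I (hcomp (e + 1) p) (X0 * dv p)"
      by (simp_all add: dv_def cong_I_def homog_part_iff)
  qed
  have dv': "X0 * dv p - hcomp (e + 1) p \<in> I" if "p \<in> polys n" for p
    using cong_I_sym[OF dv(3)[OF that]] by (simp add: cong_I_def)
  from u show ?thesis
  proof (induction u rule: wedge_relations.induct)
    case (ideal c)
    then show ?case
      by (intro bexI[of _ "\<lambda>_. 0"] wedge_relations.ideal) (auto simp: cong_I_def intro!: hcomp_I)
  next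
    case (sym k l c)
    then show ?case
      by (intro bexI[of _ "\<lambda>J. dv (c J)"] wedge_relations.sym[of k l]) (auto simp: dv)
  next
    case (slot k \<gamma>)
    \<comment> \<open>\<open>\<gamma> L\<close> is an arbitrary kernel element; that its component
      of degree \<open>e + 1\<close> is one too is the gradedness of the kernel.\<close>
    have "O1.mu (\<lambda>j. dv (\<gamma> L j)) = \<zero>\<^bsub>O1\<^esub>" for L
    proof (rule inj)
      show "O1.mu (\<lambda>j. dv (\<gamma> L j)) \<in> O1.comp e" using slot dv by (intro O1.compI) auto
      have "cl X0 \<odot>\<^bsub>O1\<^esub> O1.mu (\<lambda>j. dv (\<gamma> L j)) = O1.mu (\<lambda>j. X0 * dv (\<gamma> L j))"
        using slot dv by (subst O1.mu_smult) auto
      also have "\<dots> = O1.mu (\<lambda>j. hcomp (e + 1) (\<gamma> L j))"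
        by (rule O1.mu_cong) (simp_all add: slot(2) dv(2) dv')
      also have "\<dots> = \<zero>\<^bsub>O1\<^esub>" using slot by (intro O1_kernel_graded) auto
      finally show "cl X0 \<odot>\<^bsub>O1\<^esub> O1.mu (\<lambda>j. dv (\<gamma> L j)) = \<zero>\<^bsub>O1\<^esub>" .
    qed
    then have "(\<lambda>J. dv (\<gamma> (J[k := 0]) (J ! k))) \<in> wedge_relations"
      using wedge_relations.slot[of k "\<lambda>L j. dv (\<gamma> L j)"] slot dv by simp
    then show ?case using slot dv by (intro bexI[of _ "\<lambda>J. dv (\<gamma> (J[k := 0]) (J ! k))"]) auto
  next
    case (add u v)
    then obtain u' v' where u'v': "u' \<in> wedge_relations" "\<forall>J\<in>idx. u' J \<in> homog_part n e \<and> cong_I (hcomp (e + 1) (u J)) (X0 * u' J)"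
      "v' \<in> wedge_relations" "\<forall>J\<in>idx. v' J \<in> homog_part n e \<and> cong_I (hcomp (e + 1) (v J)) (X0 * v' J)" by blast
    then have "\<forall>J\<in>idx. u' J + v' J \<in> homog_part n e \<and> cong_I (hcomp (e + 1) (u J + v J)) (X0 * (u' J + v' J))"
      by (auto simp: hcomp_add distrib_left homog_part_iff intro!: cong_I_add)
    moreover have "(\<lambda>J. u' J + v' J) \<in> wedge_relations" using u'v' by (intro wedge_relations.add)
    ultimately show ?case by (rule bexI[of _ "\<lambda>J. u' J + v' J"])
  qed
qed

end

section \<open>The kernel of the presentation of the exterior power\<close>

context exterior
begin

definition lift :: "('k mpoly set \<Rightarrow> 'k mpoly set) set \<Rightarrow> nat \<Rightarrow> 'k mpoly" where
  "lift w = (SOME p. (\<forall>j. p j \<in> polys n) \<and> O1.mu p = w)"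

lemma lift: 
  assumes "w \<in> carrier O1" shows "lift w j \<in> polys n" "O1.mu (lift w) = w"
proof -
  have "\<exists>p. (\<forall>j. p j \<in> polys n) \<and> O1.mu p = w" using O1_mu_surj[OF assms] by metis
  from someI_ex[OF this] show "lift w j \<in> polys n" "O1.mu (lift w) = w" by (simp_all add: lift_def)
qed

text \<open>The coordinates of the pure tensor of the vectors \<open>ps 0\<close>, ...,
  \<open>ps (m - 1)\<close>.\<close>

definition tensor :: "(nat \<Rightarrow> nat \<Rightarrow> 'k mpoly) \<Rightarrow> nat list \<Rightarrow> 'k mpoly" where
  "tensor ps J = (\<Prod>k<m. ps k (J ! k))"

lemma tensor_remove:
  "i < m \<Longrightarrow> tensor ps J = ps i (J ! i) * (\<Prod>k\<in>{..<m} - {i}. ps k (J ! k))"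
  unfolding tensor_def by (subst prod.remove[of _ i]) auto

text \<open>A pure tensor with a kernel element in slot \<open>i\<close>: the product of the other
  factors does not see position \<open>i\<close>, so it can be absorbed into
  \<open>\<gamma>\<close>.\<close>

lemma slot_wedge_relations:
  assumes i: "i < m" and ps: "\<And>k j. k < m \<Longrightarrow> ps k j \<in> polys n"
    and g: "\<And>j. g j \<in> polys n" "O1.mu g = \<zero>\<^bsub>O1\<^esub>"
  shows "(\<lambda>J. g (J ! i) * (\<Prod>k\<in>{..<m} - {i}. ps k (J ! k))) \<in> wedge_relations"
proof -
  define \<gamma> where "\<gamma> = (\<lambda>L j. (\<Prod>k\<in>{..<m} - {i}. ps k (L ! k)) * g j)"
  have prod: "(\<Prod>k\<in>{..<m} - {i}. ps k (L ! k)) \<in> polys n" for L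
    using ps by (intro polys_prod) auto
  have "O1.mu (\<gamma> L) = \<zero>\<^bsub>O1\<^esub>" for L
    unfolding \<gamma>_def using prod g by (subst O1.mu_smult) auto
  moreover have "\<gamma> L j \<in> polys n" for L j unfolding \<gamma>_def using prod g by simp
  ultimately have "(\<lambda>J. \<gamma> (J[i := 0]) (J ! i)) \<in> wedge_relations" using i by (intro wedge_relations.slot)
  also have "(\<lambda>J. \<gamma> (J[i := 0]) (J ! i)) = (\<lambda>J. g (J ! i) * (\<Prod>k\<in>{..<m} - {i}. ps k (J ! k)))"
    by (simp add: \<gamma>_def mult.commute)
  finally show ?thesis .
qed

text \<open>The factors are exchanged one at a time; each exchange costs a tensor with a kernel
  element in one slot.\<close>

lemma tensor_cong_wedge_relations:
  assumes ps: "\<And>k j. k < m \<Longrightarrow> ps k j \<in> polys n" and qs: "\<And>k j. k < m \<Longrightarrow> qs k j \<in> polys n"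
    and eq: "\<And>k. k < m \<Longrightarrow> O1.mu (ps k) = O1.mu (qs k)"
  shows "(\<lambda>J. tensor ps J - tensor qs J) \<in> wedge_relations"
proof -
  \<comment> \<open>The hybrid family in which the first \<open>i\<close> factors are already
    exchanged.\<close>
  let ?mix = "\<lambda>i k. if k < i then qs k else ps k"
  have mix: "?mix i k j \<in> polys n" if "k < m" for i k j using that ps qs by simp
  have "(\<lambda>J. tensor ps J - tensor (?mix i) J) \<in> wedge_relations" if "i \<le> m" for i
    using that
  proof (induction i)
    case 0
    then show ?case by (intro wedge_relations.ideal) simp
  next
    case (Suc i)
    then have i: "i < m" by simp
    have rest: "(\<Prod>k\<in>{..<m} - {i}. ?mix (Suc i) k (J ! k)) = (\<Prod>k\<in>{..<m} - {i}. ?mix i k (J ! k))" for J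
      by (intro prod.cong) auto
    have "O1.mu (\<lambda>j. ps i j - qs i j) = O1.mu (ps i) \<ominus>\<^bsub>O1\<^esub> O1.mu (qs i)"
      using ps qs i by (intro O1.mu_diff) auto
    also have "\<dots> = \<zero>\<^bsub>O1\<^esub>" using eq[OF i] O1.mu_closed[of "qs i"] qs i by (simp add: O1.M.r_neg O1.M.minus_eq)
    finally have "(\<lambda>J. (ps i (J ! i) - qs i (J ! i)) * (\<Prod>k\<in>{..<m} - {i}. ?mix i k (J ! k))) \<in> wedge_relations"
      using ps qs i mix by (intro slot_wedge_relations[where g = "\<lambda>j. ps i j - qs i j"]) auto
    also have "(\<lambda>J. (ps i (J ! i) - qs i (J ! i)) * (\<Prod>k\<in>{..<m} - {i}. ?mix i k (J ! k))) = 
        (\<lambda>J. tensor (?mix i) J - tensor (?mix (Suc i)) J)"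
      unfolding tensor_remove[OF i] rest by (simp add: left_diff_distrib)
    finally have "(\<lambda>J. (tensor ps J - tensor (?mix i) J) + (tensor (?mix i) J - tensor (?mix (Suc i)) J)) \<in> wedge_relations"
      using Suc by (intro wedge_relations.add) auto
    then show ?case by simp
  qed
  from this[of m] have "(\<lambda>J. tensor ps J - tensor (?mix m) J) \<in> wedge_relations" by simp
  moreover have "tensor (?mix m) = tensor qs" by (simp add: tensor_def fun_eq_iff)
  ultimately show ?thesis by simp
qed

text \<open>The backward map on a wedge symbol: the pure tensor of chosen coordinate vectors of its
  factors, determined only modulo \<open>wedge_relations\<close>.\<close>

definition lift_tensor :: "('k mpoly set \<Rightarrow> 'k mpoly set) set list \<Rightarrow> nat list \<Rightarrow> 'k mpoly" where
  "lift_tensor xs = tensor (\<lambda>k. lift (xs ! k))"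

lemma lift_tensor_polys: "xs \<in> tup \<Longrightarrow> lift_tensor xs J \<in> polys n"
  unfolding lift_tensor_def tensor_def by (intro polys_prod lift tup_nth) auto

lemma lift_tensor_update:
  assumes "xs \<in> tup" "i < m"
  shows "lift_tensor (xs[i := x]) J = lift x (J ! i) * (\<Prod>k\<in>{..<m} - {i}. lift (xs ! k) (J ! k))"
proof -
  have "length xs = m" using assms by (simp add: tuples_def)
  then show ?thesis using assms unfolding lift_tensor_def tensor_remove[OF assms(2)] by simp
qed

text \<open>\<open>lift\<close> is linear up to kernel elements, so multilinearity relations become
  slot relations. Since \<open>lift\<close> is a function, equal factors have equal lifts, so
  alternation relations become tensors symmetric in two slots.\<close>

lemma Phi_exterior_rels:
  assumes "\<rho> \<in> Erels" shows "Phi tup lift_tensor \<rho> \<in> wedge_relations"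
proof -
  interpret EF: Module.module R EF by (rule R.free_module_module)
  let ?e = "free_gen R tup" and ?P = "Phi tup lift_tensor"
  note h = lift_tensor_polys
  note e = R.free_gen_closed
  from assms show ?thesis unfolding exterior_rels_def Let_def Un_iff
  proof (elim disjE CollectE exE conjE)
    fix xs i x y
    assume rho: "\<rho> = ?e (xs[i := x \<oplus>\<^bsub>O1\<^esub> y]) \<ominus>\<^bsub>EF\<^esub> (?e (xs[i := x]) \<oplus>\<^bsub>EF\<^esub> ?e (xs[i := y]))"
      and add: "xs \<in> tup" "i < m" "x \<in> carrier O1" "y \<in> carrier O1"
    have lifts: "lift (xs ! k) j \<in> polys n" if "k < m" for k j using add(1) that by (intro lift tup_nth)
    have "cong_I (?P \<rho> J) (lift_tensor (xs[i := x \<oplus>\<^bsub>O1\<^esub> y]) J - (lift_tensor (xs[i := x]) J + lift_tensor (xs[i := y]) J))" for J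
    proof -
      have "cong_I (?P \<rho> J) (?P (?e (xs[i := x \<oplus>\<^bsub>O1\<^esub> y])) J - ?P (?e (xs[i := x]) \<oplus>\<^bsub>EF\<^esub> ?e (xs[i := y])) J)"
        unfolding rho using add by (intro Phi_minus h) (auto intro!: e tup_update)
      also have "cong_I \<dots> (lift_tensor (xs[i := x \<oplus>\<^bsub>O1\<^esub> y]) J - (?P (?e (xs[i := x])) J + ?P (?e (xs[i := y])) J))"
        using add by (intro cong_I_diff Phi_gen Phi_add h) (auto intro!: e tup_update)
      also have "cong_I \<dots> (lift_tensor (xs[i := x \<oplus>\<^bsub>O1\<^esub> y]) J - (lift_tensor (xs[i := x]) J + lift_tensor (xs[i := y]) J))"
        using add by (intro cong_I_diff cong_I_refl cong_I_add Phi_gen h) (auto intro!: tup_update)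
      finally show ?thesis .
    qed
    moreover have "(\<lambda>J. lift_tensor (xs[i := x \<oplus>\<^bsub>O1\<^esub> y]) J - (lift_tensor (xs[i := x]) J + lift_tensor (xs[i := y]) J)) \<in> wedge_relations"
    proof -
      let ?g = "\<lambda>j. lift (x \<oplus>\<^bsub>O1\<^esub> y) j - (lift x j + lift y j)"
      have "O1.mu ?g = O1.mu (lift (x \<oplus>\<^bsub>O1\<^esub> y)) \<ominus>\<^bsub>O1\<^esub> (O1.mu (lift x) \<oplus>\<^bsub>O1\<^esub> O1.mu (lift y))"
        using add by (subst O1.mu_diff) (auto simp: lift O1.mu_add)
      then have "O1.mu ?g = \<zero>\<^bsub>O1\<^esub>" using add by (simp add: lift O1.M.r_neg O1.M.minus_eq)
      then have "(\<lambda>J. ?g (J ! i) * (\<Prod>k\<in>{..<m} - {i}. lift (xs ! k) (J ! k))) \<in> wedge_relations"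
        using add lifts by (intro slot_wedge_relations) (auto simp: lift)
      then show ?thesis using add by (simp add: lift_tensor_update algebra_simps)
    qed
    ultimately show ?thesis using wedge_relations.U_cong by blast
  next
    fix xs i r x
    assume rho: "\<rho> = ?e (xs[i := r \<odot>\<^bsub>O1\<^esub> x]) \<ominus>\<^bsub>EF\<^esub> r \<odot>\<^bsub>EF\<^esub> ?e (xs[i := x])"
      and smult: "xs \<in> tup" "i < m" "r \<in> carrier R" "x \<in> carrier O1"
    have lifts: "lift (xs ! k) j \<in> polys n" if "k < m" for k j using smult(1) that by (intro lift tup_nth)
    have "cong_I (?P \<rho> J) (lift_tensor (xs[i := r \<odot>\<^bsub>O1\<^esub> x]) J - rep r * lift_tensor (xs[i := x]) J)" for J
    proof -
      have "cong_I (?P \<rho> J) (?P (?e (xs[i := r \<odot>\<^bsub>O1\<^esub> x])) J - ?P (r \<odot>\<^bsub>EF\<^esub> ?e (xs[i := x])) J)"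
        unfolding rho using smult by (intro Phi_minus h) (auto intro!: e tup_update)
      also have "cong_I \<dots> (lift_tensor (xs[i := r \<odot>\<^bsub>O1\<^esub> x]) J - rep r * ?P (?e (xs[i := x])) J)"
        using smult by (intro cong_I_diff Phi_gen Phi_smult h) (auto intro!: e tup_update)
      also have "cong_I \<dots> (lift_tensor (xs[i := r \<odot>\<^bsub>O1\<^esub> x]) J - rep r * lift_tensor (xs[i := x]) J)"
        using smult by (intro cong_I_diff cong_I_refl cong_I_mult_left Phi_gen h) (auto intro!: tup_update)
      finally show ?thesis .
    qed
    moreover have "(\<lambda>J. lift_tensor (xs[i := r \<odot>\<^bsub>O1\<^esub> x]) J - rep r * lift_tensor (xs[i := x]) J) \<in> wedge_relations"
    proof -
      let ?g = "\<lambda>j. lift (r \<odot>\<^bsub>O1\<^esub> x) j - rep r * lift x j"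
      have "O1.mu ?g = O1.mu (lift (r \<odot>\<^bsub>O1\<^esub> x)) \<ominus>\<^bsub>O1\<^esub> (cl (rep r) \<odot>\<^bsub>O1\<^esub> O1.mu (lift x))"
        using smult by (subst O1.mu_diff) (auto simp: lift O1.mu_smult)
      then have "O1.mu ?g = \<zero>\<^bsub>O1\<^esub>" using smult by (simp add: lift O1.M.r_neg O1.M.minus_eq)
      then have "(\<lambda>J. ?g (J ! i) * (\<Prod>k\<in>{..<m} - {i}. lift (xs ! k) (J ! k))) \<in> wedge_relations"
        using smult lifts by (intro slot_wedge_relations) (auto simp: lift)
      then show ?thesis using smult by (simp add: lift_tensor_update algebra_simps)
    qed
    ultimately show ?thesis using wedge_relations.U_cong by blast
  next
    fix xs i j
    assume rho: "\<rho> = ?e xs" and alt: "xs \<in> tup" "i < j" "j < m" "xs ! i = xs ! j"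
    \<comment> \<open>As \<open>xs ! i = xs ! j\<close>, swapping entries of \<open>J\<close>
      amounts to permuting the factors of the product by the transposition.\<close>
    have "lift_tensor xs (swap i j J) = lift_tensor xs J" if "J \<in> idx" for J
    proof -
      let ?\<tau> = "Transposition.transpose i j"
      have len: "length J = m" using that by (simp add: idx_def)
      have "lift_tensor xs (swap i j J) = (\<Prod>k<m. lift (xs ! ?\<tau> k) (J ! ?\<tau> k))"
        unfolding lift_tensor_def tensor_def
      proof (rule prod.cong[OF refl])
        fix k assume "k \<in> {..<m}"
        then show "lift (xs ! k) (swap i j J ! k) = lift (xs ! ?\<tau> k) (J ! ?\<tau> k)"
          using alt len by (auto simp: swap_def nth_list_update Transposition.transpose_def)
      qed
      also have "\<dots> = (\<Prod>k<m. lift (xs ! k) (J ! k))"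
        using alt by (intro prod.reindex_bij_betw[where h = ?\<tau> and g = "\<lambda>k. lift (xs ! k) (J ! k)"])
          (auto simp: bij_betw_def inj_on_def Transposition.transpose_def image_def split: if_splits)
      finally show ?thesis by (simp add: lift_tensor_def tensor_def)
    qed
    then have "lift_tensor xs \<in> wedge_relations" using alt by (intro wedge_relations.sym[of i j]) (auto intro: h)
    moreover have "cong_I (?P \<rho> J) (lift_tensor xs J)" for J
      unfolding rho using alt by (intro Phi_gen h)
    ultimately show ?thesis using wedge_relations.U_cong by blast
  qed
qed

text \<open>The chosen lift of dX_j need not be the unit vector, but both have the same image in
  Omega^1; the tensor of unit vectors is the indicator of \<open>J0\<close>.\<close>

lemma lift_tensor_dX:
  assumes J0: "J0 \<in> idx" 
  shows "(\<lambda>J. lift_tensor (map dX J0) J - (if J = J0 then 1 else 0)) \<in> wedge_relations"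
proof -
  let ?q = "\<lambda>k j. if j = J0 ! k then 1 else (0 :: 'k mpoly)"
  have len: "length J0 = m" using J0 by (simp add: idx_def)
  have "(\<lambda>J. tensor (\<lambda>k. lift (map dX J0 ! k)) J - tensor ?q J) \<in> wedge_relations"
  proof (rule tensor_cong_wedge_relations)
    fix k assume k: "k < m"
    have c: "map dX J0 ! k \<in> carrier O1" by (rule tup_nth[OF idx_tup[OF J0] k])
    show "lift (map dX J0 ! k) j \<in> polys n" "?q k j \<in> polys n" for j using lift(1)[OF c] by simp_all
    have "O1.mu (?q k) = dX (J0 ! k)"
      using O1.mu_single[of "J0 ! k" 1] idx_nth[OF J0 k] by (simp add: cl_1)
    then show "O1.mu (lift (map dX J0 ! k)) = O1.mu (?q k)" using lift(2)[OF c] k len by simp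
  qed
  then show ?thesis
  proof (rule wedge_relations.U_cong)
    fix J assume J: "J \<in> idx"
    have "tensor ?q J = (if J = J0 then 1 else 0)"
    proof (cases "J = J0")
      case False
      then obtain k where "k < m" "J ! k \<noteq> J0 ! k"
        using J len by (auto simp: idx_def list_eq_iff_nth_eq)
      then show ?thesis using False unfolding tensor_def by (auto intro!: prod_zero)
    qed (simp add: tensor_def)
    then show "cong_I (lift_tensor (map dX J0) J - (if J = J0 then 1 else 0)) (tensor (\<lambda>k. lift (map dX J0 ! k)) J - tensor ?q J)"
      by (simp add: lift_tensor_def)
  qed
qed

text \<open>The backward map turns the relation with coefficients \<open>c\<close> into a
  combination of the \<open>lift_tensor (map dX J0)\<close>, which is \<open>c\<close> up to
  relations. Together with \<open>wedge_relations_kernel\<close> this identifies the kernel of the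
  presentation.\<close>

lemma kernel_wedge_relations:
  assumes c: "\<And>J. J \<in> idx \<Longrightarrow> c J \<in> polys n" and zero: "Om.mu c = \<zero>\<^bsub>OM\<^esub>"
  shows "c \<in> wedge_relations"
proof -
  have "(\<lambda>J. \<Sum>J0\<in>idx. c J0 * lift_tensor (map dX J0) J) \<in> wedge_relations"
  proof (rule wedge_relations.relation_in_U[where B = tup and rels = Erels and N = EN and g = "map dX"])
    show "EN = module_span R EF Erels" by (simp add: exterior_rel_submodule_def)
    show "(\<Oplus>\<^bsub>quot_module EF EN\<^esub>a\<in>idx. cl (c a) \<odot>\<^bsub>quot_module EF EN\<^esub> (EN +>\<^bsub>EF\<^esub> free_gen R tup (map dX a))) 
        = \<zero>\<^bsub>quot_module EF EN\<^esub>"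
      using zero unfolding Om.mu_def by (simp add: Omega_quot wedge_def)
  qed (use c Erels_closed Phi_exterior_rels lift_tensor_polys finite_idx idx_tup in auto)
  moreover have "(\<lambda>J. \<Sum>J0\<in>idx. c J0 * (lift_tensor (map dX J0) J - (if J = J0 then 1 else 0))) \<in> wedge_relations"
    using c by (intro wedge_relations.U_sum wedge_relations_smult lift_tensor_dX) auto
  ultimately have "(\<lambda>J. (\<Sum>J0\<in>idx. c J0 * lift_tensor (map dX J0) J) - 
      (\<Sum>J0\<in>idx. c J0 * (lift_tensor (map dX J0) J - (if J = J0 then 1 else 0)))) \<in> wedge_relations"
    by (rule wedge_relations.U_diff)
  then show ?thesis
  proof (rule wedge_relations.U_cong)
    fix J assume J: "J \<in> idx"
    have "(\<Sum>J0\<in>idx. c J0 * lift_tensor (map dX J0) J) - (\<Sum>J0\<in>idx. c J0 * (lift_tensor (map dX J0) J - (if J = J0 then 1 else 0)))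
        = (\<Sum>J0\<in>idx. if J = J0 then c J0 else 0)"
      by (subst sum_subtractf[symmetric]) (intro sum.cong, auto simp: right_diff_distrib)
    also have "\<dots> = c J" using J finite_idx by simp
    finally show "cong_I (c J) ((\<Sum>J0\<in>idx. c J0 * lift_tensor (map dX J0) J) - 
      (\<Sum>J0\<in>idx. c J0 * (lift_tensor (map dX J0) J - (if J = J0 then 1 else 0))))" by simp
  qed
qed

text \<open>\<open>X0 * c\<close> lies in the kernel; dividing it there yields a relation
  \<open>v\<close>, and cancelling X_0 modulo I shows that \<open>c\<close> and \<open>v\<close>
  have the same image, namely 0.\<close>

lemma Omega_X0_inj:
  assumes div: "\<forall>p\<in>homog_part n (e + 1). \<exists>q\<in>homog_part n e. p - X0 * q \<in> I"
    and inj: "\<And>w. w \<in> O1.comp e \<Longrightarrow> cl X0 \<odot>\<^bsub>O1\<^esub> w = \<zero>\<^bsub>O1\<^esub> \<Longrightarrow> w = \<zero>\<^bsub>O1\<^esub>"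
    and w: "w \<in> Om.comp e" "cl X0 \<odot>\<^bsub>OM\<^esub> w = \<zero>\<^bsub>OM\<^esub>"
  shows "w = \<zero>\<^bsub>OM\<^esub>"
proof -
  obtain c where c: "w = Om.mu c" "\<And>J. J \<in> idx \<Longrightarrow> c J \<in> homog_part n e"
    using w(1) by (auto simp: Om.comp_def)
  then have cp: "c J \<in> polys n" if "J \<in> idx" for J using that by (simp add: homog_part_iff)
  have "Om.mu (\<lambda>J. X0 * c J) = \<zero>\<^bsub>OM\<^esub>"
    using w(2) cp unfolding c(1) by (subst Om.mu_smult) auto
  then have "(\<lambda>J. X0 * c J) \<in> wedge_relations" using cp by (intro kernel_wedge_relations) auto
  from wedge_relations_divisible[OF div inj this] obtain v where v: "v \<in> wedge_relations" 
    "\<And>J. J \<in> idx \<Longrightarrow> v J \<in> homog_part n e" "\<And>J. J \<in> idx \<Longrightarrow> cong_I (hcomp (e + 1) (X0 * c J)) (X0 * v J)" by blast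
  have "c J - v J \<in> I" if J: "J \<in> idx" for J
  proof (rule X0_cancel)
    show "c J - v J \<in> homog_part n e" using c(2)[OF J] v(2)[OF J] by (simp add: homog_part_iff)
    have "hcomp (e + 1) (X0 * c J) = X0 * c J"
      using c(2)[OF J] hcomp_homog[of e "c J" e] by (simp add: hcomp_mult_homog[OF homog_indet] homog_part_iff)
    then show "X0 * (c J - v J) \<in> I" using v(3)[OF J] by (simp add: cong_I_def right_diff_distrib)
  qed
  then have "Om.mu c = Om.mu v" using cp v(2) by (intro Om.mu_cong) (auto simp: homog_part_iff)
  then show ?thesis using wedge_relations_kernel[OF v(1)] c(1) by simp
qed

text \<open>Multilinear expansion, one slot at a time: \<open>k\<close> counts the leading slots not
  yet replaced by some dX_j, and expanding slot \<open>l\<close> adds \<open>f l - 1\<close> to the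
  degree of the coefficient.\<close>

lemma wedge_homogeneous:
  assumes "k \<le> m" "xs \<in> tup" "p \<in> homog_part n i"
    "\<And>l. l < k \<Longrightarrow> xs ! l \<in> O1.comp (f l - 1)" "\<And>l. k \<le> l \<Longrightarrow> l < m \<Longrightarrow> \<exists>j\<le>n. xs ! l = dX j"
  shows "cl p \<odot>\<^bsub>OM\<^esub> wd xs \<in> Om.comp (i + (\<Sum>l<k. f l - 1))"
  using assms
proof (induction k arbitrary: xs p i)
  case 0
  have len: "length xs = m" using 0 by (simp add: tuples_def)
  from 0 have "\<forall>l\<in>{..<m}. \<exists>j. j \<le> n \<and> xs ! l = dX j" by auto
  from bchoice[OF this] obtain j where j: "\<And>l. l < m \<Longrightarrow> j l \<le> n \<and> xs ! l = dX (j l)" by auto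
  define J where "J = map j [0..<m]"
  have J: "J \<in> idx" using j by (auto simp: J_def idx_def)
  have "xs = map dX J" using j len by (auto simp: J_def list_eq_iff_nth_eq)
  then have "cl p \<odot>\<^bsub>OM\<^esub> wd xs = Om.mu (\<lambda>L. if L = J then p else 0)"
    using Om.mu_single[OF J, of p] 0 by (simp add: homog_part_iff)
  then show ?case using 0 by (auto intro!: Om.compI)
next
  case (Suc k)
  have k: "k < m" and len: "length xs = m" using Suc.prems by (auto simp: tuples_def)
  have "xs ! k \<in> O1.comp (f k - 1)" using Suc.prems by simp
  then obtain c where c: "xs ! k = O1.mu c" "\<And>j. j \<in> {..n} \<Longrightarrow> c j \<in> homog_part n (f k - 1)"
    by (auto simp: O1.comp_def)
  have p: "p \<in> polys n" using Suc.prems by (simp add: homog_part_iff)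
  have cp: "c j \<in> polys n" if "j \<in> {..n}" for j using c(2)[OF that] by (simp add: homog_part_iff)
  have wc: "wd (xs[k := dX j]) \<in> carrier OM" if "j \<in> {..n}" for j
    using that Suc.prems by (intro wd_closed tup_update) auto
  have "wd xs = wd (xs[k := O1.mu c])" using c(1) by (metis list_update_id)
  also have "\<dots> = (\<Oplus>\<^bsub>OM\<^esub>j\<in>{..n}. cl (c j) \<odot>\<^bsub>OM\<^esub> wd (xs[k := dX j]))"
    unfolding O1.mu_def using Suc.prems k cp by (intro wd_finsum) auto
  finally have "cl p \<odot>\<^bsub>OM\<^esub> wd xs = cl p \<odot>\<^bsub>OM\<^esub> (\<Oplus>\<^bsub>OM\<^esub>j\<in>{..n}. cl (c j) \<odot>\<^bsub>OM\<^esub> wd (xs[k := dX j]))" by simp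
  also have "\<dots> = (\<Oplus>\<^bsub>OM\<^esub>j\<in>{..n}. cl p \<odot>\<^bsub>OM\<^esub> (cl (c j) \<odot>\<^bsub>OM\<^esub> wd (xs[k := dX j])))"
    using p cp wc by (intro Om.M.finsum_smult_ldistr) auto
  also have "\<dots> = (\<Oplus>\<^bsub>OM\<^esub>j\<in>{..n}. cl (p * c j) \<odot>\<^bsub>OM\<^esub> wd (xs[k := dX j]))"
    using p cp wc by (intro Om.M.finsum_cong') (auto simp: cl_mult Om.M.smult_assoc1)
  also have "\<dots> \<in> Om.comp (i + (\<Sum>l<Suc k. f l - 1))"
  proof (rule Om.submodule_finsum[OF Om.comp_submodule])
    fix j assume j: "j \<in> {..n}"
    have "cl (p * c j) \<odot>\<^bsub>OM\<^esub> wd (xs[k := dX j]) \<in> Om.comp ((i + (f k - 1)) + (\<Sum>l<k. f l - 1))"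
    proof (rule Suc.IH)
      show "k \<le> m" using k by simp
      show "xs[k := dX j] \<in> tup" using Suc.prems j by (intro tup_update) auto
      show "p * c j \<in> homog_part n (i + (f k - 1))"
        using Suc.prems(3) c(2)[OF j] homog_mult[of i p "f k - 1" "c j"] by (simp add: homog_part_iff)
      show "xs[k := dX j] ! l \<in> O1.comp (f l - 1)" if "l < k" for l
        using that Suc.prems(4)[of l] by simp
      show "\<exists>j'\<le>n. xs[k := dX j] ! l = dX j'" if "k \<le> l" "l < m" for l
        using that Suc.prems(5)[of l] j len by (cases "l = k") auto
    qed
    then show "cl (p * c j) \<odot>\<^bsub>OM\<^esub> wd (xs[k := dX j]) \<in> Om.comp (i + (\<Sum>l<Suc k. f l - 1))"
      by (simp add: algebra_simps)
  qed simp
  finally show ?case .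
qed

text \<open>A factor of degree \<open>ds ! l\<close> has coefficients of degree
  \<open>ds ! l - 1\<close>, so \<open>m\<close> factors produce the shift \<open>m\<close>.
  Conversely, the generators are wedges of the dX_j, each of degree 1.\<close>

lemma Omega_grading_comp: "Omega_grading n I m d = Om.comp (d - int m)"
proof
  let ?S = "{r \<odot>\<^bsub>OM\<^esub> wd xs | r xs i ds. r \<in> coord_grading n I i \<and> length xs = m \<and> length ds = m \<and> 
    (\<forall>k<m. xs ! k \<in> Omega1_grading n I (ds ! k)) \<and> i + sum_list ds = d}"
  have gr: "Omega_grading n I m d = Om.W.span ?S"
    by (simp add: Omega_grading_def exterior_grading_def Omega_def)
  have S: "?S \<subseteq> Om.comp (d - int m)"
  proof
    fix x assume "x \<in> ?S"
    then obtain r xs i ds where x: "x = r \<odot>\<^bsub>OM\<^esub> wd xs" "r \<in> coord_grading n I i" "length xs = m" 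
      "length ds = m" "\<forall>k<m. xs ! k \<in> O1.comp (ds ! k - 1)" "i + sum_list ds = d"
      unfolding Omega1_grading_comp by blast
    then obtain p where p: "r = cl p" "p \<in> homog_part n i" by (auto simp: coord_grading_cl)
    have "xs ! k \<in> carrier O1" if "k < m" for k using x(5) that O1.comp_closed by blast
    then have "xs \<in> tup" using x(3) by (auto simp: tuples_def in_set_conv_nth)
    then have "cl p \<odot>\<^bsub>OM\<^esub> wd xs \<in> Om.comp (i + (\<Sum>l<m. ds ! l - 1))"
      using p x by (intro wedge_homogeneous) auto
    moreover have "i + (\<Sum>l<m. ds ! l - 1) = d - int m"
      using x(4,6) by (auto simp: sum_list_sum_nth sum_subtractf atLeast0LessThan)
    ultimately show "x \<in> Om.comp (d - int m)" using x p by simp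
  qed
  then show "Omega_grading n I m d \<subseteq> Om.comp (d - int m)"
    unfolding gr by (rule Om.W.module.span_is_subset[OF _ Om.comp_submodule])
  have "Om.comp (d - int m) \<subseteq> carrier Om.W" using Om.comp_closed by auto
  with S have SW: "?S \<subseteq> carrier Om.W" by (rule order.trans)
  show "Om.comp (d - int m) \<subseteq> Omega_grading n I m d"
  proof
    fix w assume "w \<in> Om.comp (d - int m)"
    then obtain c where c: "w = Om.mu c" "\<And>J. J \<in> idx \<Longrightarrow> c J \<in> homog_part n (d - int m)"
      by (auto simp: Om.comp_def)
    have "cl (c J) \<odot>\<^bsub>OM\<^esub> wd (map dX J) \<in> Om.W.span ?S" if J: "J \<in> idx" for J
    proof -
      have len: "length J = m" using J by (simp add: idx_def)
      have "dX j \<in> O1.comp 0" if "j \<le> n" for j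
        using O1.mu_single[of j 1] that O1.compI[of "\<lambda>i. if i = j then 1 else 0" 0] 
        by (simp add: cl_1 homog_part_iff)
      then have "\<forall>k<m. map dX J ! k \<in> Omega1_grading n I (replicate m 1 ! k)"
        using J len by (simp add: Omega1_grading_comp idx_nth)
      moreover have "cl (c J) \<in> coord_grading n I (d - int m)" using c(2)[OF J] by (simp add: coord_grading_cl)
      moreover have "(d - int m) + sum_list (replicate m 1) = d" by (simp add: sum_list_replicate)
      ultimately have "cl (c J) \<odot>\<^bsub>OM\<^esub> wd (map dX J) \<in> ?S"
        using len by (intro CollectI exI[of _ "cl (c J)"] exI[of _ "map dX J"] exI[of _ "d - int m"] 
          exI[of _ "replicate m 1"]) simp
      then show ?thesis using Om.W.module.in_own_span[OF SW] by blast
    qed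
    then show "w \<in> Omega_grading n I m d" unfolding gr c(1) Om.mu_def
      by (intro Om.submodule_finsum Om.W.module.span_is_submodule[OF SW] finite_idx) auto
  qed
qed

lemma ri_Omega_hf: "ri_Omega n I m = regularity_index (\<lambda>d. Om.hf (d - int m))"
  unfolding ri_Omega_def Omega_grading_comp[abs_def] Om.hilbert_function_hf ..

end

section \<open>Comparison of the regularity indices\<close>

lemma int_shift_eq_const:
  fixes f :: "int \<Rightarrow> nat"
  assumes "\<And>e. e \<ge> E \<Longrightarrow> f (e + 1) = f e" "e \<ge> E"
  shows "f e = f E"
  using assms(2) by (induction e rule: int_ge_induct) (auto simp: assms(1))

theorem proposition5p3:
  fixes n m :: nat and I :: "((nat \<Rightarrow>\<^sub>0 nat) \<Rightarrow>\<^sub>0 'k::field_char_0) set"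
  assumes "n \<ge> 1"
    and "zero_dim_scheme n I"
    and "\<forall>P\<in>scheme_points n I. indet 0 \<notin> P"
    and "1 \<le> m" and "m \<le> n + 1"
  shows "ri_Omega n I m \<le> max (ri_coord_ring n I + Fin (int m)) (ri_Omega1 n I + Fin (int m - 1))"
proof -
  interpret exterior n I m using assms(2,3) by (intro exterior.intro zero_dim.intro)
  obtain r where r: "ri_coord_ring n I = Fin r"
    "\<And>e. e \<ge> r \<Longrightarrow> \<forall>p\<in>homog_part n (e + 1). \<exists>q\<in>homog_part n e. p - X0 * q \<in> I"
    using ri_coord_ring_divisible by blast
  \<comment> \<open>From \<open>r\<close> on the Hilbert function of Omega^1 cannot increase, hence
    it becomes constant; its regularity index is thereby a statement about the value
    \<open>c\<close>.\<close>
  obtain N c where N: "N \<ge> r" "\<And>e. e \<ge> N \<Longrightarrow> O1.hf e = c"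
    using eventually_const_of_nonincreasing[of r O1.hf] O1.hf_nonincreasing[OF r(2)] by blast
  \<comment> \<open>\<open>E\<close> is a coefficient degree. It corresponds to degree
    \<open>E + 1\<close> in Omega^1 and to degree \<open>E + m\<close> in Omega^m.\<close>
  have le: "ri_Omega n I m \<le> Fin (E + int m)" if E: "E \<ge> r" "ri_Omega1 n I \<le> Fin (E + 1)" for E
  proof -
    have "\<forall>j\<ge>E + 1. O1.hf (j - 1) = c"
      using E(2) regularity_index_le_iff[of "N + 1" "\<lambda>d. O1.hf (d - 1)" c "E + 1"] N(2)
      unfolding ri_Omega1_hf by simp
    then have O1c: "O1.hf e = c" if "e \<ge> E" for e using that by (metis add_le_cancel_right add_diff_cancel_right')
    \<comment> \<open>Constancy of \<open>O1.hf\<close> makes x_0 injective on Omega^1 in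
      coefficient degree \<open>e\<close>; injectivity then passes to Omega^m in the same
      coefficient degree.\<close>
    have "Om.hf (e + 1) = Om.hf e" if "e \<ge> E" for e
    proof (rule Om.hf_eq_of_inj)
      have e: "e \<ge> r" using that E(1) by simp
      show "\<forall>p\<in>homog_part n (e + 1). \<exists>q\<in>homog_part n e. p - X0 * q \<in> I" by (rule r(2)[OF e])
      have "w = \<zero>\<^bsub>O1\<^esub>" if "w \<in> O1.comp e" "cl X0 \<odot>\<^bsub>O1\<^esub> w = \<zero>\<^bsub>O1\<^esub>" for w
        using O1.X0_inj[OF r(2)[OF e] _ that] O1c \<open>e \<ge> E\<close> by simp
      then show "w = \<zero>\<^bsub>OM\<^esub>" if "w \<in> Om.comp e" "cl X0 \<odot>\<^bsub>OM\<^esub> w = \<zero>\<^bsub>OM\<^esub>" for w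
        using Omega_X0_inj[OF r(2)[OF e] _ that] by blast
    qed
    then have hfE: "Om.hf e = Om.hf E" if "e \<ge> E" for e using int_shift_eq_const[of E Om.hf e] that by blast
    have "Om.hf (j - int m) = Om.hf E" if "j \<ge> E + int m" for j 
      by (rule hfE) (use that in simp)
    then show ?thesis
      using regularity_index_le_iff[of "E + int m" "\<lambda>d. Om.hf (d - int m)" "Om.hf E" "E + int m"]
      unfolding ri_Omega_hf by simp
  qed
  have "ri_Omega1 n I \<noteq> Pinf" by (simp add: ri_Omega1_def regularity_index_def)
  then consider (fin) s where "ri_Omega1 n I = Fin s" | (minf) "ri_Omega1 n I = Minf"
    by (cases "ri_Omega1 n I") auto
  then show ?thesis
  proof cases
    case (fin s)
    \<comment> \<open>The least \<open>E\<close> allowed by both conditions,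
      \<open>E \<ge> r\<close> and \<open>E + 1 \<ge> s\<close>.\<close>
    have "ri_Omega n I m \<le> Fin (max r (s - 1) + int m)" by (rule le) (simp_all add: fin)
    also have "\<dots> = max (ri_coord_ring n I + Fin (int m)) (ri_Omega1 n I + Fin (int m - 1))"
      by (simp add: fin r(1) max_def)
    finally show ?thesis .
  next
    case minf
    \<comment> \<open>With \<open>Minf\<close> the condition on Omega^1 is void, so
      \<open>E = r\<close> suffices.\<close>
    have "ri_Omega n I m \<le> Fin (r + int m)" by (rule le) (simp_all add: minf)
    then show ?thesis by (simp add: minf r(1))
  qed
qed

end
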